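(* Let $n\ge 1$ and let $R(s)$ be a real-rational proper $n\times n$ transfer function matrix with a minimal state-space realisation $(A,B,C,D)$, where $A,B,C,D$ are real matrices, i.e. $R(s)=C(sI-A)^{-1}B+D$ with $(A,B)$ controllable and $(C,A)$ observable. Then $R(s)\in\mathscr{C}$ if and only if $A$ is Hurwitz, $D=D^*$, and there exists a real matrix $Y>0$ such that $$AY+YA^*\le 0\qquad\text{and}\qquad B=-AYC^*.$$
   Context: $\mathscr{RH}_\infty^{n\times n}$ denotes the set of $n\times n$ real-rational, proper, stable transfer function matrices (all poles in the open left half plane). $A^*$ denotes the complex conjugate transpose of $A$ (the transpose if $A$ is real). $A$ is Hurwitz if all its eigenvalues have strictly negative real part. For matrices, $X>0$ (resp. $X\ge 0$) means $X$ is Hermitian (symmetric in the real case) and positive definite (resp. positive semidefinite); $X\le 0$ means $-X\ge 0$. The class of stable systems with negative imaginary frequency response is $$\mathscr{C}:=\{R(s)\in\mathscr{RH}_\infty^{n\times n}:\ j[R(j\omega)-R(j\omega)^*]\ge 0\ \text{ for all }\omega\in(0,\infty)\},$$ where $j$ is the imaginary unit. *)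

theory Defs
  imports
    "HOL-Computational_Algebra.Polynomial_Factorial"
    "HOL-Computational_Algebra.Normalized_Fraction"
    "HOL-Computational_Algebra.Field_as_Ring"
    "Jordan_Normal_Form.Gauss_Jordan_Elimination"
    "Jordan_Normal_Form.Char_Poly"
    "Jordan_Normal_Form.Schur_Decomposition"
    "Jordan_Normal_Form.DL_Rank"
begin

text \<open>Dimensions are carried by the matrices rather than by types, so that the state dimension
  may be 0 (a constant transfer function matrix).\<close>

text \<open>A real rational function is an element of the field of fractions of \<open>\<real>[s]\<close>.  Below,
  \<open>quot_of_fract\<close> yields the fraction in lowest terms (coprime numerator and denominator), so
  the poles are exactly the roots of that denominator.\<close>

type_synonym ratfun = "real poly fract"

definition rf_num :: "ratfun \<Rightarrow> real poly"
  where "rf_num f = fst (quot_of_fract f)"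

definition rf_den :: "ratfun \<Rightarrow> real poly"
  where "rf_den f = snd (quot_of_fract f)"

definition rf_const :: "real \<Rightarrow> ratfun"
  where "rf_const c = to_fract [:c:]"

definition rf_s :: ratfun
  where "rf_s = to_fract [:0, 1:]"

text \<open>The value at a point that is not a pole; it is 0 at a pole.\<close>
definition rf_eval :: "ratfun \<Rightarrow> complex \<Rightarrow> complex"
  where "rf_eval f z = poly (map_poly complex_of_real (rf_num f)) z
                     / poly (map_poly complex_of_real (rf_den f)) z"

definition rf_pole :: "ratfun \<Rightarrow> complex \<Rightarrow> bool"
  where "rf_pole f z \<longleftrightarrow> poly (map_poly complex_of_real (rf_den f)) z = 0"

definition rf_proper :: "ratfun \<Rightarrow> bool"
  where "rf_proper f \<longleftrightarrow> degree (rf_num f) \<le> degree (rf_den f)"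

definition proper_tfm :: "ratfun mat \<Rightarrow> bool"
  where "proper_tfm R \<longleftrightarrow> (\<forall>i<dim_row R. \<forall>j<dim_col R. rf_proper (R $$ (i, j)))"

definition stable_tfm :: "ratfun mat \<Rightarrow> bool"
  where "stable_tfm R \<longleftrightarrow>
    (\<forall>i<dim_row R. \<forall>j<dim_col R. \<forall>z. rf_pole (R $$ (i, j)) z \<longrightarrow> Re z < 0)"

definition RH_inf :: "nat \<Rightarrow> ratfun mat set"
  where "RH_inf n = {R \<in> carrier_mat n n. proper_tfm R \<and> stable_tfm R}"

definition tfm_eval :: "ratfun mat \<Rightarrow> complex \<Rightarrow> complex mat"
  where "tfm_eval R z = map_mat (\<lambda>f. rf_eval f z) R"

text \<open>Used for real and for complex matrices.  On the reals \<open>mat_adjoint\<close> is the transpose and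
  \<open>\<bullet>c\<close> the dot product.  On the complex numbers the library order is such that \<open>0 \<le> z\<close> says
  that \<open>z\<close> is real and nonnegative.\<close>

definition pos_semidef :: "'a::conjugatable_ordered_field mat \<Rightarrow> bool"
  where "pos_semidef M \<longleftrightarrow> square_mat M \<and> mat_adjoint M = M \<and>
    (\<forall>v \<in> carrier_vec (dim_row M). 0 \<le> (M *\<^sub>v v) \<bullet>c v)"

definition pos_def :: "'a::conjugatable_ordered_field mat \<Rightarrow> bool"
  where "pos_def M \<longleftrightarrow> square_mat M \<and> mat_adjoint M = M \<and>
    (\<forall>v \<in> carrier_vec (dim_row M). v \<noteq> 0\<^sub>v (dim_row M) \<longrightarrow> 0 < (M *\<^sub>v v) \<bullet>c v)"

definition neg_semidef :: "'a::conjugatable_ordered_field mat \<Rightarrow> bool"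
  where "neg_semidef M \<longleftrightarrow> pos_semidef (- M)"

definition NI_class :: "nat \<Rightarrow> ratfun mat set"
  where "NI_class n = {R \<in> RH_inf n. \<forall>\<omega>::real. 0 < \<omega> \<longrightarrow>
    pos_semidef (\<i> \<cdot>\<^sub>m (tfm_eval R (\<i> * complex_of_real \<omega>)
                   - mat_adjoint (tfm_eval R (\<i> * complex_of_real \<omega>))))}"

definition hurwitz :: "real mat \<Rightarrow> bool"
  where "hurwitz A \<longleftrightarrow> (\<forall>z. eigenvalue (map_mat complex_of_real A) z \<longrightarrow> Re z < 0)"

text \<open>\<open>C (s I - A)\<^sup>-\<^sup>1 B + D\<close> over the field of rational functions, where \<open>s I - A\<close> is always
  invertible, its determinant being the characteristic polynomial of \<open>A\<close>.\<close>
definition transfer_mat :: "real mat \<Rightarrow> real mat \<Rightarrow> real mat \<Rightarrow> real mat \<Rightarrow> ratfun mat"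
  where "transfer_mat A B C D =
    map_mat rf_const C
      * the (mat_inverse (rf_s \<cdot>\<^sub>m 1\<^sub>m (dim_row A) - map_mat rf_const A))
      * map_mat rf_const B
    + map_mat rf_const D"

text \<open>The block matrix \<open>[B, A B, \<dots>, A\<^sup>m\<^sup>-\<^sup>1 B]\<close>, where \<open>m\<close> is the order of \<open>A\<close>.\<close>
definition controllability_mat :: "real mat \<Rightarrow> real mat \<Rightarrow> real mat"
  where "controllability_mat A B = mat (dim_row A) (dim_row A * dim_col B)
    (\<lambda>(i, j). (A ^\<^sub>m (j div dim_col B) * B) $$ (i, j mod dim_col B))"

text \<open>The blocks \<open>C, C A, \<dots>, C A\<^sup>m\<^sup>-\<^sup>1\<close> stacked on top of one another.\<close>
definition observability_mat :: "real mat \<Rightarrow> real mat \<Rightarrow> real mat"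
  where "observability_mat C A = mat (dim_row A * dim_row C) (dim_row A)
    (\<lambda>(i, j). (C * A ^\<^sub>m (i div dim_row C)) $$ (i mod dim_row C, j))"

text \<open>The first argument of \<open>vec_space.rank\<close> is the number of rows.\<close>
definition controllable :: "real mat \<Rightarrow> real mat \<Rightarrow> bool"
  where "controllable A B \<longleftrightarrow>
    vec_space.rank (dim_row A) (controllability_mat A B) = dim_row A"

definition observable :: "real mat \<Rightarrow> real mat \<Rightarrow> bool"
  where "observable C A \<longleftrightarrow>
    vec_space.rank (dim_row A * dim_row C) (observability_mat C A) = dim_row A"

definition minimal_realisation ::
    "ratfun mat \<Rightarrow> real mat \<Rightarrow> real mat \<Rightarrow> real mat \<Rightarrow> real mat \<Rightarrow> bool"
  where "minimal_realisation R A B C D \<longleftrightarrow>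
    R = transfer_mat A B C D \<and> controllable A B \<and> observable C A"

end

theory Submission
  imports Defs "Jordan_Normal_Form.Spectral_Radius"
begin

text \<open>
  Write \<open>v = A w + B g\<close> for the velocity at the state \<open>w\<close> under the input \<open>g\<close>.  Everything turns
  on one condition, called \<open>freq_passive\<close> below: along every harmonic motion \<open>v = \<i> \<omega> w\<close> the
  supply \<open>g\<^sup>* C v\<close> has nonnegative real part.  Since \<open>R(\<i> \<omega>) g = C w + D g\<close>, for symmetric
  \<open>D\<close> it says \<open>\<omega> Im (g\<^sup>* R(\<i> \<omega>) g) \<le> 0\<close>, which is the negative imaginary property
  (for \<open>\<omega> < 0\<close> take complex conjugates);
    and the symmetry of \<open>D\<close> follows from that property on
  letting \<open>\<omega>\<close> tend to infinity.  Stability of \<open>R\<close> is the same as \<open>A\<close> being Hurwitz, because a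
  minimal realisation has no eigenvalue of \<open>A\<close> hidden from \<open>R\<close>: if \<open>C (s I - A)\<^sup>-\<^sup>1 B\<close> has no
  pole at \<open>z\<close>, then neither has \<open>C A\<^sup>i (s I - A)\<^sup>-\<^sup>1 A\<^sup>j B\<close>, and cancelling the observability and
  the controllability matrix leaves the resolvent itself (\<open>minimal_regular_not_eigenvalue\<close>).

  Given \<open>Y\<close>, the condition \<open>freq_passive\<close> is a direct computation: with \<open>p = C\<^sup>T g\<close>,
  \<open>s = Y\<^sup>-\<^sup>1 w\<close> and \<open>z = s - p\<close> one has \<open>v = A Y z = \<i> \<omega> Y s\<close>, so \<open>s\<^sup>* v\<close> is purely
  imaginary, \<open>z\<^sup>* v\<close> has real part at most 0, and \<open>g\<^sup>* C v = p\<^sup>* v = s\<^sup>* v - z\<^sup>* v\<close>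
  (\<open>lmi_imp_freq_passive\<close>).

  The converse is a Kalman--Yakubovich--Popov lemma, proved here by dynamic programming.  The
  system is discretised by the midpoint rule, which passes from the state \<open>w - v\<close> to \<open>w + v\<close>
  and supplies \<open>g \<bullet> C v\<close>.  The discrete Fourier transform turns a motion of odd period \<open>N\<close>
  into harmonic motions of the continuous system, the Cayley transform sending the \<open>N\<close>-th roots
  of unity to the imaginary axis, so its total supply is nonnegative by Parseval's identity
  (\<open>periodic_supply_nonneg\<close>).  As the discretised free motion decays, any motion that starts at
  rest can be closed up into a long periodic one at an arbitrarily small cost, and hence has
  nonnegative supply as well (\<open>supplied_nonneg\<close>).  Let \<open>V x\<close> be the infimum of the
  supplies that lead from rest to \<open>x\<close>.  By controllability it is finite; it inherits the
  parallelogram law from the supply, so it is a quadratic form by the Jordan--von Neumann theorem;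
  and appending one step gives \<open>V (w + v) \<le> V (w - v) + g \<bullet> C v\<close>.  In terms of the
  symmetric matrix \<open>X\<close> of \<open>4 V\<close> this reads \<open>w \<bullet> X v \<le> g \<bullet> C v\<close> (\<open>storage_function\<close>).

  For \<open>g = 0\<close> this is the Lyapunov inequality.  At \<open>w = - A\<^sup>-\<^sup>1 B g\<close>, where \<open>v = 0\<close>, both
  sides vanish, so their derivatives agree, which gives \<open>X A\<^sup>-\<^sup>1 B = - C\<^sup>T\<close>.  The kernel of \<open>X\<close> is
  invariant under \<open>A\<close> and contained in that of \<open>C\<close>, hence trivial by observability, and
  \<open>Y = X\<^sup>-\<^sup>1\<close> is as required (\<open>storage_imp_lmi\<close>).
\<close>


section \<open>Full rank\<close>

lemma full_row_rank_right_inverse: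
  fixes K :: "real mat"
  assumes K: "K \<in> carrier_mat m k" and r: "vec_space.rank m K = m"
  shows "\<exists>E \<in> carrier_mat k m. K * E = 1\<^sub>m m"
proof -
  interpret vec_space "TYPE(real)" m .
  have sub: "set (cols K) \<subseteq> carrier_vec m" using K cols_dim by blast
  obtain S where S: "maximal S (\<lambda>T. T \<subseteq> set (cols K) \<and> lin_indpt T)" "finite S"
    using maximal_exists_superset[of "set (cols K)" "\<lambda>T. T \<subseteq> set (cols K) \<and> lin_indpt T" "{}"]
    by (metis (no_types, lifting) List.finite_set empty_subsetI finite_lin_indpt2 finite.emptyI empty_iff)
  have SK: "S \<subseteq> set (cols K)" and li: "lin_indpt S" using S(1) unfolding maximal_def by auto
  have "card S = m" using rank_card_indpt[OF K S(1)] r by simp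
  then have "basis S"
    using dim_li_is_basis[OF fin_dim S(2) _ li] SK sub by (auto simp: dim_is_n)
  then have "span S = carrier_vec m" by (auto simp: basis_def)
  then have "carrier_vec m \<subseteq> span (set (cols K))" using span_is_monotone[OF SK] by simp
  then have "carrier_vec m \<subseteq> {y \<in> carrier_vec m. \<exists>x \<in> carrier_vec k. K *\<^sub>v x = y}"
    using col_space_eq[OF K] K unfolding col_space_def by auto
  then have "\<forall>i. \<exists>x \<in> carrier_vec k. K *\<^sub>v x = unit_vec m i"
    using unit_vec_carrier[of m] by blast
  then obtain x where x: "\<And>i. x i \<in> carrier_vec k" "\<And>i. K *\<^sub>v x i = unit_vec m i" by metis
  define E where "E = mat_of_cols k (map x [0..<m])"
  have E: "E \<in> carrier_mat k m" by (simp add: E_def mat_of_cols_def)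
  have "K * E = 1\<^sub>m m"
  proof (rule eq_matI)
    fix i j assume "i < dim_row (1\<^sub>m m :: real mat)" "j < dim_col (1\<^sub>m m :: real mat)"
    then have ij: "i < m" "j < m" by auto
    have "col E j = x j" using ij x(1)[of j] by (simp add: E_def)
    then have "(K * E) $$ (i, j) = (K *\<^sub>v x j) $ i" using ij K E by simp
    then show "(K * E) $$ (i, j) = 1\<^sub>m m $$ (i, j)" using ij by (simp add: x(2))
  qed (use K E in auto)
  with E show ?thesis by blast
qed

lemma full_col_rank_kernel:
  fixes K :: "real mat"
  assumes K: "K \<in> carrier_mat k m" and r: "vec_space.rank k K = m"
    and v: "v \<in> carrier_vec m" and Kv: "K *\<^sub>v v = 0\<^sub>v k"
  shows "v = 0\<^sub>v m"
proof -
  interpret vec_space "TYPE(real)" k .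
  obtain S where S: "maximal S (\<lambda>T. T \<subseteq> set (cols K) \<and> lin_indpt T)" "finite S"
    using maximal_exists_superset[of "set (cols K)" "\<lambda>T. T \<subseteq> set (cols K) \<and> lin_indpt T" "{}"]
    by (metis (no_types, lifting) List.finite_set empty_subsetI finite_lin_indpt2 finite.emptyI empty_iff)
  have "card S = m" using rank_card_indpt[OF K S(1)] r by simp
  moreover have "S \<subseteq> set (cols K)" using S(1) unfolding maximal_def by auto
  ultimately have "m \<le> card (set (cols K))" by (metis List.finite_set card_mono)
  then have d: "distinct (cols K)" using K card_length[of "cols K"]
    by (intro card_distinct) auto
  show ?thesis
    using lin_depI[OF K v _ Kv d] full_rank_lin_indpt[OF K r d] by blast
qed

lemma invertible_if_kernel_trivial:
  fixes M :: "'a::field mat"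
  assumes M: "M \<in> carrier_mat m m" and "\<And>v. v \<in> carrier_vec m \<Longrightarrow> M *\<^sub>v v = 0\<^sub>v m \<Longrightarrow> v = 0\<^sub>v m"
  shows "\<exists>T \<in> carrier_mat m m. T * M = 1\<^sub>m m \<and> M * T = 1\<^sub>m m"
proof -
  have "det M \<noteq> 0" using det_0_iff_vec_prod_zero_field[OF M] assms(2) by blast
  from det_non_zero_imp_unit[OF M this, of m] show ?thesis
    unfolding Units_def ring_mat_def by auto
qed

lemma full_col_rank_left_inverse:
  fixes K :: "real mat"
  assumes K: "K \<in> carrier_mat k m" and r: "vec_space.rank k K = m"
  shows "\<exists>E \<in> carrier_mat m k. E * K = 1\<^sub>m m"
proof -
  have "v = 0\<^sub>v m" if v: "v \<in> carrier_vec m" and 0: "(K\<^sup>T * K) *\<^sub>v v = 0\<^sub>v m" for v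
  proof -
    have Kv: "K *\<^sub>v v \<in> carrier_vec k" using K v by auto
    have "(K *\<^sub>v v) \<bullet> (K *\<^sub>v v) = v \<bullet> ((K\<^sup>T * K) *\<^sub>v v)"
      using transpose_vec_mult_scalar[OF K v Kv] assoc_mult_mat_vec[of "K\<^sup>T" m k K m v] K v Kv
      by (metis (no_types, lifting) mult_mat_vec_carrier comm_scalar_prod transpose_carrier_mat)
    also have "\<dots> = 0" using 0 v by simp
    finally have "(K *\<^sub>v v) \<bullet>c (K *\<^sub>v v) = 0" by simp
    then have "K *\<^sub>v v = 0\<^sub>v k" using conjugate_square_eq_0_vec[OF Kv] by simp
    then show ?thesis using full_col_rank_kernel[OF K r v] by simp
  qed
  then obtain T where T: "T \<in> carrier_mat m m" "T * (K\<^sup>T * K) = 1\<^sub>m m"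
    using invertible_if_kernel_trivial[of "K\<^sup>T * K" m] mult_carrier_mat[of "K\<^sup>T" m k K m] K
    by (metis transpose_carrier_mat)
  have "T * K\<^sup>T * K = 1\<^sub>m m" using T K assoc_mult_mat[of T m m "K\<^sup>T" k K m] by simp
  then show ?thesis using T(1) K by (intro bexI[of _ "T * K\<^sup>T"]) auto
qed

section \<open>Evaluating rational functions\<close>

lemma poly_of_real_hom:
  "poly (map_poly complex_of_real (p * q)) z = poly (map_poly complex_of_real p) z * poly (map_poly complex_of_real q) z"
  "poly (map_poly complex_of_real (p + q)) z = poly (map_poly complex_of_real p) z + poly (map_poly complex_of_real q) z"
proof -
  interpret map_poly_comm_ring_hom complex_of_real ..
  show "poly (map_poly complex_of_real (p * q)) z = poly (map_poly complex_of_real p) z * poly (map_poly complex_of_real q) z"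
    "poly (map_poly complex_of_real (p + q)) z = poly (map_poly complex_of_real p) z + poly (map_poly complex_of_real q) z"
    by (simp_all only: hom_mult hom_add poly_mult poly_add)
qed

text \<open>A fraction need not be in lowest terms to be evaluated, as long as its denominator does not
  vanish.  Hence evaluation at a point is a ring homomorphism on the functions without a pole there.\<close>
lemma rf_fraction:
  assumes q: "poly (map_poly complex_of_real q) z \<noteq> 0" and f: "f = to_fract p / to_fract q"
  shows "\<not> rf_pole f z"
    and "rf_eval f z = poly (map_poly complex_of_real p) z / poly (map_poly complex_of_real q) z"
proof -
  let ?h = "\<lambda>p. poly (map_poly complex_of_real p) z"
  have q0: "q \<noteq> 0" using q by auto
  have "f = to_fract (rf_num f) / to_fract (rf_den f)"
    unfolding rf_num_def rf_den_def by (metis Fract_conv_to_fract Fract_quot_of_fract)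
  moreover have d0: "rf_den f \<noteq> 0" by (simp add: rf_den_def)
  ultimately have "to_fract (rf_num f) * to_fract q = to_fract p * to_fract (rf_den f)"
    using f q0 by (metis frac_eq_eq to_fract_eq_0_iff)
  then have eq: "rf_num f * q = p * rf_den f" by (metis to_fract_mult to_fract_eq_iff)
  then have "rf_den f dvd rf_num f * q" by simp
  moreover have "coprime (rf_num f) (rf_den f)"
    unfolding rf_num_def rf_den_def by (rule coprime_quot_of_fract)
  ultimately have "rf_den f dvd q"
    by (metis coprime_commute coprime_dvd_mult_right_iff)
  then obtain r where "q = rf_den f * r" by (elim dvdE)
  then have d: "?h (rf_den f) \<noteq> 0" using q by (auto simp: poly_of_real_hom)
  then show "\<not> rf_pole f z" by (simp add: rf_pole_def)
  have "?h (rf_num f) * ?h q = ?h p * ?h (rf_den f)"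
    using eq by (metis poly_of_real_hom(1))
  then show "rf_eval f z = ?h p / ?h q" using d q by (simp add: rf_eval_def field_simps)
qed

lemma rf_not_poleE:
  assumes "\<not> rf_pole f z"
  obtains p q where "poly (map_poly complex_of_real q) z \<noteq> 0" "f = to_fract p / to_fract q"
  using assms unfolding rf_pole_def rf_num_def rf_den_def
  by (metis Fract_conv_to_fract Fract_quot_of_fract)

lemma rf_mult:
  assumes "\<not> rf_pole f z" "\<not> rf_pole g z"
  shows "\<not> rf_pole (f * g) z" "rf_eval (f * g) z = rf_eval f z * rf_eval g z"
proof -
  obtain p q where pq: "poly (map_poly complex_of_real q) z \<noteq> 0" "f = to_fract p / to_fract q"
    using rf_not_poleE assms(1) by blast
  obtain a b where ab: "poly (map_poly complex_of_real b) z \<noteq> 0" "g = to_fract a / to_fract b"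
    using rf_not_poleE assms(2) by blast
  have fg: "f * g = to_fract (p * a) / to_fract (q * b)" using pq ab by simp
  have nz: "poly (map_poly complex_of_real (q * b)) z \<noteq> 0"
    using pq ab by (simp add: poly_of_real_hom)
  show "\<not> rf_pole (f * g) z" by (rule rf_fraction(1)[OF nz fg])
  show "rf_eval (f * g) z = rf_eval f z * rf_eval g z"
    unfolding rf_fraction(2)[OF nz fg] rf_fraction(2)[OF pq] rf_fraction(2)[OF ab]
    by (simp add: poly_of_real_hom)
qed

lemma rf_add:
  assumes "\<not> rf_pole f z" "\<not> rf_pole g z"
  shows "\<not> rf_pole (f + g) z" "rf_eval (f + g) z = rf_eval f z + rf_eval g z"
proof -
  obtain p q where pq: "poly (map_poly complex_of_real q) z \<noteq> 0" "f = to_fract p / to_fract q"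
    using rf_not_poleE assms(1) by blast
  obtain a b where ab: "poly (map_poly complex_of_real b) z \<noteq> 0" "g = to_fract a / to_fract b"
    using rf_not_poleE assms(2) by blast
  have "to_fract q \<noteq> 0" "to_fract b \<noteq> 0" using pq(1) ab(1) by auto
  then have fg: "f + g = to_fract (p * b + a * q) / to_fract (q * b)"
    unfolding pq(2) ab(2) by (simp add: add_frac_eq)
  have nz: "poly (map_poly complex_of_real (q * b)) z \<noteq> 0"
    using pq ab by (simp add: poly_of_real_hom)
  show "\<not> rf_pole (f + g) z" by (rule rf_fraction(1)[OF nz fg])
  show "rf_eval (f + g) z = rf_eval f z + rf_eval g z"
    unfolding rf_fraction(2)[OF nz fg] rf_fraction(2)[OF pq] rf_fraction(2)[OF ab]
    using pq(1) ab(1) by (simp add: poly_of_real_hom add_frac_eq)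
qed

lemma rf_to_fract:
  "\<not> rf_pole (to_fract p) z" "rf_eval (to_fract p) z = poly (map_poly complex_of_real p) z"
  by (simp_all add: rf_pole_def rf_eval_def rf_num_def rf_den_def)

lemma rf_const: "\<not> rf_pole (rf_const c) z" "rf_eval (rf_const c) z = of_real c"
proof -
  show "\<not> rf_pole (rf_const c) z" unfolding rf_const_def by (rule rf_to_fract)
  show "rf_eval (rf_const c) z = of_real c"
    unfolding rf_const_def rf_to_fract(2) of_real_hom.map_poly_pCons_hom map_poly_0 by simp
qed

lemma rf_s: "\<not> rf_pole rf_s z" "rf_eval rf_s z = z"
proof -
  show "\<not> rf_pole rf_s z" unfolding rf_s_def by (rule rf_to_fract)
  show "rf_eval rf_s z = z"
    unfolding rf_s_def rf_to_fract(2) of_real_hom.map_poly_pCons_hom map_poly_0 by simp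
qed

lemma to_fract_const_add: "to_fract [:a:] + to_fract [:b:] = to_fract [:a + b:]"
  by (metis add_pCons add_0_left to_fract_add)

lemma to_fract_const_mult: "to_fract [:a:] * to_fract [:b::real:] = to_fract [:a * b:]"
  unfolding to_fract_mult[symmetric] to_fract_eq_iff by simp

interpretation rf_const: comm_ring_hom rf_const
proof
  show "rf_const 1 = 1" unfolding rf_const_def one_pCons[symmetric] by (rule to_fract_1)
qed (simp_all only: rf_const_def to_fract_const_add to_fract_const_mult pCons_0_0 to_fract_0)

lemma rf_sum:
  assumes "\<And>i. i \<in> I \<Longrightarrow> \<not> rf_pole (f i) z"
  shows "\<not> rf_pole (sum f I) z \<and> rf_eval (sum f I) z = (\<Sum>i\<in>I. rf_eval (f i) z)"
  using assms
proof (induction I rule: infinite_finite_induct)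
  case (insert x F)
  have x: "\<not> rf_pole (f x) z" and F: "\<not> rf_pole (sum f F) z" 
    "rf_eval (sum f F) z = (\<Sum>i\<in>F. rf_eval (f i) z)" using insert by blast+
  show ?case unfolding sum.insert[OF insert(1,2)] rf_add(2)[OF x F(1)] F(2) using rf_add(1)[OF x F(1)] by simp
qed (use rf_const[of 0 z] in simp_all)

text \<open>No entry of the transfer function matrix \<open>P\<close> has a pole at \<open>z\<close>.\<close>
definition regular_at :: "ratfun mat \<Rightarrow> complex \<Rightarrow> bool"
  where "regular_at P z \<longleftrightarrow> (\<forall>i<dim_row P. \<forall>j<dim_col P. \<not> rf_pole (P $$ (i, j)) z)"

lemma tfm_eval_carrier [simp]: "P \<in> carrier_mat r c \<Longrightarrow> tfm_eval P z \<in> carrier_mat r c"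
  by (simp add: tfm_eval_def)

lemma regular_mult:
  assumes P: "P \<in> carrier_mat r k" and Q: "Q \<in> carrier_mat k c"
    and "regular_at P z" "regular_at Q z"
  shows "regular_at (P * Q) z" "tfm_eval (P * Q) z = tfm_eval P z * tfm_eval Q z"
proof -
  have entry: "(P * Q) $$ (i, j) = (\<Sum>l<k. P $$ (i, l) * Q $$ (l, j))" if "i < r" "j < c" for i j
    using that P Q by (simp add: scalar_prod_def lessThan_atLeast0)
  have r: "\<not> rf_pole (P $$ (i, l) * Q $$ (l, j)) z \<and>
      rf_eval (P $$ (i, l) * Q $$ (l, j)) z = rf_eval (P $$ (i, l)) z * rf_eval (Q $$ (l, j)) z"
    if "i < r" "j < c" "l < k" for i j l
  proof -
    have "\<not> rf_pole (P $$ (i, l)) z" "\<not> rf_pole (Q $$ (l, j)) z"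
      using assms that by (auto simp: regular_at_def)
    from rf_mult[OF this] show ?thesis by blast
  qed
  show "regular_at (P * Q) z"
  proof -
    have "\<not> rf_pole ((P * Q) $$ (i, j)) z" if "i < r" "j < c" for i j
      unfolding entry[OF that] by (rule rf_sum[THEN conjunct1]) (use r[OF that] in blast)
    then show ?thesis using P Q unfolding regular_at_def by simp
  qed
  show "tfm_eval (P * Q) z = tfm_eval P z * tfm_eval Q z"
  proof (rule eq_matI)
    fix i j assume "i < dim_row (tfm_eval P z * tfm_eval Q z)" "j < dim_col (tfm_eval P z * tfm_eval Q z)"
    then have ij: "i < r" "j < c" using P Q by (auto simp: tfm_eval_def)
    have "tfm_eval (P * Q) z $$ (i, j) = rf_eval ((P * Q) $$ (i, j)) z"
      using ij P Q by (simp add: tfm_eval_def)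
    also have "\<dots> = (\<Sum>l<k. rf_eval (P $$ (i, l)) z * rf_eval (Q $$ (l, j)) z)"
      using rf_sum[of "{..<k}" "\<lambda>l. P $$ (i, l) * Q $$ (l, j)" z] r[OF ij] unfolding entry[OF ij] by simp
    also have "\<dots> = (tfm_eval P z * tfm_eval Q z) $$ (i, j)"
      using ij P Q by (simp add: tfm_eval_def scalar_prod_def lessThan_atLeast0)
    finally show "tfm_eval (P * Q) z $$ (i, j) = (tfm_eval P z * tfm_eval Q z) $$ (i, j)" .
  qed (use P Q in \<open>auto simp: tfm_eval_def\<close>)
qed

lemma regular_add:
  assumes P: "P \<in> carrier_mat r c" and Q: "Q \<in> carrier_mat r c"
    and "regular_at P z" "regular_at Q z"
  shows "regular_at (P + Q) z" "tfm_eval (P + Q) z = tfm_eval P z + tfm_eval Q z"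
  using assms rf_add by (auto simp: regular_at_def tfm_eval_def intro!: eq_matI)

lemma regular_const:
  "regular_at (map_mat rf_const M) z" "tfm_eval (map_mat rf_const M) z = map_mat complex_of_real M"
  by (auto simp: regular_at_def tfm_eval_def rf_const intro!: eq_matI)

lemma regular_s:
  "regular_at (rf_s \<cdot>\<^sub>m 1\<^sub>m m) z" "tfm_eval (rf_s \<cdot>\<^sub>m 1\<^sub>m m) z = z \<cdot>\<^sub>m 1\<^sub>m m"
proof -
  have *: "\<not> rf_pole (rf_s * (if i = j then 1 else 0)) z \<and>
     rf_eval (rf_s * (if i = j then 1 else 0)) z = z * (if i = j then 1 else 0)" for i j :: nat
    using rf_const[of 0 z] rf_s[of z] by (cases "i = j") auto
  then show "regular_at (rf_s \<cdot>\<^sub>m 1\<^sub>m m) z" "tfm_eval (rf_s \<cdot>\<^sub>m 1\<^sub>m m) z = z \<cdot>\<^sub>m 1\<^sub>m m"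
    by (auto simp: regular_at_def tfm_eval_def intro!: eq_matI)
qed

section \<open>The resolvent and the transfer function matrix\<close>

lemma rf_diff:
  assumes "\<not> rf_pole f z" "\<not> rf_pole g z"
  shows "\<not> rf_pole (f - g) z" "rf_eval (f - g) z = rf_eval f z - rf_eval g z"
proof -
  have m1: "rf_const (- 1) = - 1" using rf_const.hom_uminus[of 1] by simp
  have eq: "f - g = f + rf_const (- 1) * g" unfolding m1 by simp
  note g = rf_mult[OF rf_const(1)[of "-1"] assms(2)]
  show "\<not> rf_pole (f - g) z" "rf_eval (f - g) z = rf_eval f z - rf_eval g z"
    unfolding eq rf_add(2)[OF assms(1) g(1)] g(2) rf_const(2) using rf_add(1)[OF assms(1) g(1)] by simp_all
qed

lemma regular_diff:
  assumes P: "P \<in> carrier_mat r c" and Q: "Q \<in> carrier_mat r c"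
    and "regular_at P z" "regular_at Q z"
  shows "regular_at (P - Q) z" "tfm_eval (P - Q) z = tfm_eval P z - tfm_eval Q z"
  using assms rf_diff by (auto simp: regular_at_def tfm_eval_def intro!: eq_matI)

lemma regular_smult:
  assumes "\<not> rf_pole f z" "regular_at P z"
  shows "regular_at (f \<cdot>\<^sub>m P) z"
  using assms rf_mult(1) by (auto simp: regular_at_def)

interpretation to_fract: comm_ring_hom to_fract
  by unfold_locales simp_all

lemma mat_diff_swap:
  fixes X :: "'a::ab_group_add mat"
  assumes "S \<in> carrier_mat r c" "P \<in> carrier_mat r c" "X = S - P"
  shows "P = S - X"
  unfolding assms(3) by (rule eq_matI) (use assms(1,2) in auto)

lemma smult_mat_mult_vec:
  fixes P :: "'a::comm_ring_1 mat"
  shows "P \<in> carrier_mat r c \<Longrightarrow> g \<in> carrier_vec c \<Longrightarrow> (a \<cdot>\<^sub>m P) *\<^sub>v g = a \<cdot>\<^sub>v (P *\<^sub>v g)"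
  by (rule eq_vecI) (auto simp: row_smult)

lemma char_matrix_mult_vec:
  fixes A :: "'a::comm_ring_1 mat"
  assumes A: "A \<in> carrier_mat m m" and w: "w \<in> carrier_vec m"
  shows "(z \<cdot>\<^sub>m 1\<^sub>m m - A) *\<^sub>v w = z \<cdot>\<^sub>v w - A *\<^sub>v w"
proof -
  have "(z \<cdot>\<^sub>m 1\<^sub>m m) *\<^sub>v w = z \<cdot>\<^sub>v w"
    using smult_mat_mult_vec[OF one_carrier_mat w] w by simp
  then show ?thesis using minus_mult_distrib_mat_vec[of "z \<cdot>\<^sub>m 1\<^sub>m m" m m A w] A w by simp
qed

lemma mult_mat_entry:
  assumes "P \<in> carrier_mat r k" "Q \<in> carrier_mat k c" "i < r" "j < c"
  shows "(P * Q) $$ (i, j) = (\<Sum>l<k. P $$ (i, l) * Q $$ (l, j))"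
  using assms by (simp add: scalar_prod_def lessThan_atLeast0)

lemma map_mat_entry:
  "P \<in> carrier_mat r c \<Longrightarrow> i < r \<Longrightarrow> j < c \<Longrightarrow> map_mat f P $$ (i, j) = f (P $$ (i, j))"
  by simp

lemma pow_mat_commute:
  fixes A :: "'a::semiring_1 mat"
  assumes A: "A \<in> carrier_mat m m"
  shows "A ^\<^sub>m k * A = A * A ^\<^sub>m k"
proof (induction k)
  case (Suc k)
  then show ?case using assoc_mult_mat[OF A pow_carrier_mat[OF A] A, of k] by simp
qed (use A in simp)

lemma mult_mat_zero_vec:
  fixes P :: "'a::semiring_0 mat"
  shows "P \<in> carrier_mat r c \<Longrightarrow> P *\<^sub>v 0\<^sub>v c = 0\<^sub>v r"
  by (rule eq_vecI) (auto simp: scalar_prod_def)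

lemma mat_add_diff_cancel:
  fixes P :: "'a::ab_group_add mat"
  assumes "P \<in> carrier_mat r c" "Q \<in> carrier_mat r c"
  shows "P + Q - Q = P"
  by (rule eq_matI) (use assms in auto)

text \<open>A real matrix, read as a complex matrix and as a matrix of constant rational functions.\<close>
abbreviation cmat :: "real mat \<Rightarrow> complex mat" where "cmat \<equiv> map_mat complex_of_real"
abbreviation rfmat :: "real mat \<Rightarrow> ratfun mat" where "rfmat \<equiv> map_mat rf_const"

text \<open>The resolvent \<open>(s I - A)\<^sup>-\<^sup>1\<close> as a matrix of rational functions.\<close>
definition resolvent :: "real mat \<Rightarrow> ratfun mat"
  where "resolvent A = the (mat_inverse (rf_s \<cdot>\<^sub>m 1\<^sub>m (dim_row A) - map_mat rf_const A))"

lemma resolvent: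
  assumes A: "A \<in> carrier_mat m m"
  shows "resolvent A \<in> carrier_mat m m"
    and "(rf_s \<cdot>\<^sub>m 1\<^sub>m m - rfmat A) * resolvent A = 1\<^sub>m m"
    and "resolvent A * (rf_s \<cdot>\<^sub>m 1\<^sub>m m - rfmat A) = 1\<^sub>m m"
    and "\<not> eigenvalue (cmat A) z \<Longrightarrow> regular_at (resolvent A) z"
proof -
  define M where "M = rf_s \<cdot>\<^sub>m 1\<^sub>m m - rfmat A"
  define P where "P = adj_mat (char_poly_matrix A)"
  define f where "f = to_fract (char_poly A)"
  have M: "M \<in> carrier_mat m m" unfolding M_def by (intro minus_carrier_mat) (simp add: A)
  have cA: "char_poly_matrix A \<in> carrier_mat m m" using A by simp
  have P: "P \<in> carrier_mat m m" unfolding P_def by (rule adj_mat(1)[OF cA])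
  let ?tP = "map_mat to_fract P"
  have tP: "?tP \<in> carrier_mat m m" using P by simp
  have M_eq: "M = map_mat to_fract (char_poly_matrix A)"
  proof (rule eq_matI)
    fix i j assume "i < dim_row (map_mat to_fract (char_poly_matrix A))" "j < dim_col (map_mat to_fract (char_poly_matrix A))"
    then have ij: "i < m" "j < m" using cA by auto
    have "to_fract (- [:A $$ (i, j):]) = - rf_const (A $$ (i, j))" 
      unfolding to_fract_uminus rf_const_def ..
    then have c: "to_fract [:- A $$ (i, j):] = - rf_const (A $$ (i, j))" by simp
    have "to_fract ([:0, 1:] + [:- A $$ (i, j):]) = rf_s - rf_const (A $$ (i, j))"
      unfolding to_fract_add c rf_s_def by simp
    with c show "M $$ (i, j) = map_mat to_fract (char_poly_matrix A) $$ (i, j)"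
      using A ij by (cases "i = j") (simp_all add: M_def char_poly_matrix_def)
  qed (use M cA in auto)
  have f0: "f \<noteq> 0"
    using degree_monic_char_poly[OF A] unfolding f_def to_fract_eq_0_iff
      by (metis monic_degree_0 coeff_0 zero_neq_one)
  have "M * ?tP = map_mat to_fract (char_poly A \<cdot>\<^sub>m 1\<^sub>m m)"
    unfolding M_eq to_fract.mat_hom_mult[OF cA P, symmetric] 
    using adj_mat(2)[OF cA] unfolding P_def char_poly_def by simp
  also have "\<dots> = f \<cdot>\<^sub>m 1\<^sub>m m" unfolding f_def by (auto intro!: eq_matI)
  finally have MP: "M * ?tP = f \<cdot>\<^sub>m 1\<^sub>m m" .
  have "det M = f" unfolding M_eq to_fract.hom_det f_def char_poly_def ..
  then have "M \<in> Units (ring_mat TYPE(ratfun) m m)" using det_non_zero_imp_unit[OF M] f0 by simp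
  then obtain G where G: "mat_inverse M = Some G" 
    using mat_inverse(1)[OF M, where b = m] by (cases "mat_inverse M") auto
  have res: "resolvent A = G" using G A unfolding resolvent_def M_def by simp
  from mat_inverse(2)[OF M G] have G: "M * G = 1\<^sub>m m" "G * M = 1\<^sub>m m" "G \<in> carrier_mat m m" by auto
  show "resolvent A \<in> carrier_mat m m" "(rf_s \<cdot>\<^sub>m 1\<^sub>m m - rfmat A) * resolvent A = 1\<^sub>m m"
    "resolvent A * (rf_s \<cdot>\<^sub>m 1\<^sub>m m - rfmat A) = 1\<^sub>m m"
    using G unfolding res M_def by auto
  have "?tP = (G * M) * ?tP" using G tP by simp
  also have "\<dots> = G * (M * ?tP)" using assoc_mult_mat[OF G(3) M tP] .
  also have "\<dots> = f \<cdot>\<^sub>m G" using G(3) mult_smult_distrib[OF G(3), of "1\<^sub>m m" m f]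
    unfolding MP by simp
  finally have tP_eq: "?tP = f \<cdot>\<^sub>m G" .
  assume "\<not> eigenvalue (cmat A) z"
  then have "poly (map_poly complex_of_real (char_poly A)) z \<noteq> 0"
    using eigenvalue_root_char_poly[of "cmat A" m z] A of_real_hom.char_poly_hom[OF A, where 'a=complex] by simp
  moreover have "G $$ (i, j) = to_fract (P $$ (i, j)) / to_fract (char_poly A)" if "i < m" "j < m" for i j
  proof -
    have "to_fract (P $$ (i, j)) = f * G $$ (i, j)"
      using arg_cong[OF tP_eq, of "\<lambda>X. X $$ (i, j)"] that P G(3) by simp
    then show ?thesis using f0 unfolding f_def by simp
  qed
  ultimately show "regular_at (resolvent A) z"
    using G(3) rf_fraction(1) unfolding res regular_at_def by blast
qed

lemma transfer_mat_resolvent: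
  "transfer_mat A B C D = rfmat C * resolvent A * rfmat B + rfmat D"
  unfolding transfer_mat_def resolvent_def ..

lemma rfmat_mult:
  assumes "P \<in> carrier_mat r k" "Q \<in> carrier_mat k c"
  shows "rfmat (P * Q) = rfmat P * rfmat Q"
  by (rule rf_const.mat_hom_mult[OF assms])

text \<open>Away from the eigenvalues of \<open>A\<close> the transfer function matrix has no pole, and it maps an
  input amplitude \<open>g\<close> to the output amplitude of the solution \<open>w\<close> of \<open>z w = A w + B g\<close>.\<close>
lemma transfer_mat_regular:
  assumes A: "A \<in> carrier_mat m m" and B: "B \<in> carrier_mat m n"
    and C: "C \<in> carrier_mat p m" and D: "D \<in> carrier_mat p n"
    and z: "\<not> eigenvalue (cmat A) z"
  shows "regular_at (transfer_mat A B C D) z"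
    and "w \<in> carrier_vec m \<Longrightarrow> g \<in> carrier_vec n \<Longrightarrow> z \<cdot>\<^sub>v w = cmat A *\<^sub>v w + cmat B *\<^sub>v g
      \<Longrightarrow> tfm_eval (transfer_mat A B C D) z *\<^sub>v g = cmat C *\<^sub>v w + cmat D *\<^sub>v g"
proof -
  define G where "G = resolvent A"
  note G = resolvent[OF A, folded G_def]
  note reg = G(4)[OF z]
  have cC: "rfmat C \<in> carrier_mat p m" and cB: "rfmat B \<in> carrier_mat m n" 
    and cD: "rfmat D \<in> carrier_mat p n" and cA: "rfmat A \<in> carrier_mat m m" using A B C D by auto
  note 1 = regular_mult[OF cC G(1) regular_const(1) reg, unfolded regular_const(2)]
  note 2 = regular_mult[OF mult_carrier_mat[OF cC G(1)] cB 1(1) regular_const(1), unfolded regular_const(2) 1(2)]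
  note 3 = regular_add[OF mult_carrier_mat[OF mult_carrier_mat[OF cC G(1)] cB] cD 2(1) regular_const(1), unfolded regular_const(2) 2(2)]
  show "regular_at (transfer_mat A B C D) z"
    using 3(1) unfolding transfer_mat_resolvent G_def .
  have s: "rf_s \<cdot>\<^sub>m 1\<^sub>m m \<in> carrier_mat m m" by simp
  note 4 = regular_diff[OF s cA regular_s(1) regular_const(1), unfolded regular_const(2) regular_s(2)]
  have M: "rf_s \<cdot>\<^sub>m 1\<^sub>m m - rfmat A \<in> carrier_mat m m"
    by (intro minus_carrier_mat) (simp add: A)
  let ?G = "tfm_eval G z"
  have one: "tfm_eval (1\<^sub>m m) z = 1\<^sub>m m"
    using regular_const(2)[of "1\<^sub>m m" z] by (simp add: rf_const.mat_hom_one of_real_hom.mat_hom_one)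
  have inv: "?G * (z \<cdot>\<^sub>m 1\<^sub>m m - cmat A) = 1\<^sub>m m"
    using regular_mult(2)[OF G(1) M reg 4(1)] unfolding G(3) 4(2) one by simp
  assume w: "w \<in> carrier_vec m" and g: "g \<in> carrier_vec n"
    and eq: "z \<cdot>\<^sub>v w = cmat A *\<^sub>v w + cmat B *\<^sub>v g"
  have A': "cmat A \<in> carrier_mat m m" and B': "cmat B \<in> carrier_mat m n" 
    and C': "cmat C \<in> carrier_mat p m" and D': "cmat D \<in> carrier_mat p n" using A B C D by auto
  have G': "?G \<in> carrier_mat m m" using G(1) by simp
  have "(z \<cdot>\<^sub>m 1\<^sub>m m - cmat A) *\<^sub>v w = z \<cdot>\<^sub>v w - cmat A *\<^sub>v w"
    using char_matrix_mult_vec[OF A'] w by simp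
  also have "\<dots> = cmat B *\<^sub>v g" unfolding eq using w g A' B' by (intro eq_vecI) auto
  finally have "?G *\<^sub>v (cmat B *\<^sub>v g) = ?G *\<^sub>v ((z \<cdot>\<^sub>m 1\<^sub>m m - cmat A) *\<^sub>v w)" by simp
  also have "\<dots> = (?G * (z \<cdot>\<^sub>m 1\<^sub>m m - cmat A)) *\<^sub>v w"
    by (rule assoc_mult_mat_vec[symmetric, OF G' minus_carrier_mat[OF A'] w])
  also have "\<dots> = w" unfolding inv using w by simp
  finally have GB: "?G *\<^sub>v (cmat B *\<^sub>v g) = w" .
  have "tfm_eval (transfer_mat A B C D) z *\<^sub>v g = (cmat C * ?G * cmat B + cmat D) *\<^sub>v g"
    using 3(2) unfolding transfer_mat_resolvent G_def by simp
  also have "\<dots> = cmat C *\<^sub>v (?G *\<^sub>v (cmat B *\<^sub>v g)) + cmat D *\<^sub>v g"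
    using add_mult_distrib_mat_vec[OF mult_carrier_mat[OF mult_carrier_mat[OF C' G'] B'] D' g]
      assoc_mult_mat_vec[OF mult_carrier_mat[OF C' G'] B' g]
      assoc_mult_mat_vec[OF C' G' mult_mat_vec_carrier[OF B' g]] by simp
  finally show "tfm_eval (transfer_mat A B C D) z *\<^sub>v g = cmat C *\<^sub>v w + cmat D *\<^sub>v g"
    unfolding GB .
qed

text \<open>A minimal realisation hides no eigenvalue of \<open>A\<close>.  From \<open>A (s I - A)\<^sup>-\<^sup>1 = s (s I - A)\<^sup>-\<^sup>1 - I\<close>
  the absence of a pole passes from \<open>C (s I - A)\<^sup>-\<^sup>1 B\<close> to \<open>C A\<^sup>k (s I - A)\<^sup>-\<^sup>1 B\<close>; a left
  inverse of the observability matrix removes \<open>C\<close>, and dually for \<open>B\<close>.\<close>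
lemma minimal_regular_not_eigenvalue:
  assumes n: "n \<ge> 1" and A: "A \<in> carrier_mat m m" and B: "B \<in> carrier_mat m n"
    and C: "C \<in> carrier_mat n m" and D: "D \<in> carrier_mat n n"
    and co: "controllable A B" and ob: "observable C A"
    and reg: "regular_at (transfer_mat A B C D) z"
  shows "\<not> eigenvalue (cmat A) z"
proof -
  define G where "G = resolvent A"
  note G = resolvent[OF A, folded G_def]
  have cC: "rfmat C \<in> carrier_mat n m" and cB: "rfmat B \<in> carrier_mat m n" 
    and cD: "rfmat D \<in> carrier_mat n n" and cA: "rfmat A \<in> carrier_mat m m" using A B C D by auto
  have s: "rf_s \<cdot>\<^sub>m 1\<^sub>m m \<in> carrier_mat m m" by simp
  have sG: "rf_s \<cdot>\<^sub>m G \<in> carrier_mat m m" using G(1) by simp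
  have "1\<^sub>m m = rf_s \<cdot>\<^sub>m G - rfmat A * G"
    using minus_mult_distrib_mat[OF s cA G(1)] G(1,2) by (simp add: mult_smult_assoc_mat[of _ m m])
  then have AG: "rfmat A * G = rf_s \<cdot>\<^sub>m G - 1\<^sub>m m"
    using mat_diff_swap[OF sG mult_carrier_mat[OF cA G(1)]] by blast
  have "1\<^sub>m m = rf_s \<cdot>\<^sub>m G - G * rfmat A"
    using mult_minus_distrib_mat[OF G(1) s cA] G(1,3) by (simp add: mult_smult_distrib[OF G(1) one_carrier_mat])
  then have GA: "G * rfmat A = rf_s \<cdot>\<^sub>m G - 1\<^sub>m m"
    using mat_diff_swap[OF sG mult_carrier_mat[OF G(1) cA]] by blast
  define F where "F = G * rfmat B"
  have F: "F \<in> carrier_mat m n" using G(1) cB by (simp add: F_def)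
  have Ak: "A ^\<^sub>m k \<in> carrier_mat m m" for k using A by simp
  have AF: "rfmat A * F = rf_s \<cdot>\<^sub>m F - rfmat B"
    unfolding F_def assoc_mult_mat[OF cA G(1) cB, symmetric] AG
    using minus_mult_distrib_mat[OF sG one_carrier_mat cB] mult_smult_assoc_mat[OF G(1) cB] cB by simp
  have 1: "regular_at (rfmat (C * A ^\<^sub>m k) * F) z" for k
  proof (induction k)
    case 0
    have CF: "rfmat C * F \<in> carrier_mat n n" using cC F by simp
    have "rfmat C * F = transfer_mat A B C D - rfmat D"
      unfolding transfer_mat_resolvent F_def G_def[symmetric] assoc_mult_mat[OF cC G(1) cB]
      by (rule mat_add_diff_cancel[OF CF[unfolded F_def] cD, symmetric])
    moreover have "transfer_mat A B C D \<in> carrier_mat n n"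
      using cC cB cD unfolding transfer_mat_resolvent by simp
    ultimately show ?case
      using regular_diff(1)[OF _ cD reg regular_const(1)] A C by simp
  next
    case (Suc k)
    have CAk: "C * A ^\<^sub>m k \<in> carrier_mat n m" using C Ak by simp
    have cCAk: "rfmat (C * A ^\<^sub>m k) \<in> carrier_mat n m" using CAk by simp
    have "C * A ^\<^sub>m (Suc k) = (C * A ^\<^sub>m k) * A" using assoc_mult_mat[OF C Ak A] by simp
    then have "rfmat (C * A ^\<^sub>m (Suc k)) * F = rfmat (C * A ^\<^sub>m k) * (rfmat A * F)"
      using rfmat_mult[OF CAk A] assoc_mult_mat[OF cCAk cA F] by simp
    also have "\<dots> = rf_s \<cdot>\<^sub>m (rfmat (C * A ^\<^sub>m k) * F) - rfmat (C * A ^\<^sub>m k) * rfmat B"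
      unfolding AF using mult_minus_distrib_mat[OF cCAk _ cB, of "rf_s \<cdot>\<^sub>m F"] F
        mult_smult_distrib[OF cCAk F] by simp
    finally show ?case
      using regular_diff(1)[of _ n n, OF _ _ regular_smult[OF rf_s(1) Suc] regular_mult(1)[OF cCAk cB regular_const(1) regular_const(1)]]
        cCAk F cB by simp
  qed
  define Ob where "Ob = observability_mat C A"
  have Ob: "Ob \<in> carrier_mat (m * n) m" using A C by (simp add: Ob_def observability_mat_def)
  obtain L where L: "L \<in> carrier_mat m (m * n)" "L * Ob = 1\<^sub>m m"
    using full_col_rank_left_inverse[OF Ob] ob A C unfolding observable_def Ob_def by auto
  have cO: "rfmat Ob \<in> carrier_mat (m * n) m" and cL: "rfmat L \<in> carrier_mat m (m * n)" using Ob L by auto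
  have "(rfmat Ob * F) $$ (i, j) = (rfmat (C * A ^\<^sub>m (i div n)) * F) $$ (i mod n, j)"
    if i: "i < m * n" and j: "j < n" for i j
  proof -
    have CAk: "C * A ^\<^sub>m (i div n) \<in> carrier_mat n m" using C Ak by simp
    have im: "i mod n < n" using n by simp
    have "Ob $$ (i, l) = (C * A ^\<^sub>m (i div n)) $$ (i mod n, l)" if "l < m" for l
      using i that A C by (simp add: Ob_def observability_mat_def del: index_mult_mat(1))
    then show ?thesis unfolding mult_mat_entry[OF cO F i j] 
      mult_mat_entry[OF map_carrier_mat[THEN iffD2, OF CAk] F im j]
      using i im Ob CAk by (intro sum.cong refl) (simp add: map_mat_entry[OF Ob] map_mat_entry[OF CAk] del: index_mult_mat(1) index_map_mat(1))
  qed
  then have "regular_at (rfmat Ob * F) z"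
    using 1 n F Ob C A unfolding regular_at_def
      by (simp add: carrier_matD[OF F] carrier_matD[OF Ob] del: index_mult_mat(1))
  moreover have "F = rfmat L * (rfmat Ob * F)"
    using rfmat_mult[OF L(1) Ob] L(2) F assoc_mult_mat[OF cL cO F]
    by (metis left_mult_one_mat rf_const.mat_hom_one)
  ultimately have F_reg: "regular_at F z"
    using regular_mult(1)[OF cL mult_carrier_mat[OF cO F] regular_const(1)] by metis
  have 2: "regular_at (G * rfmat (A ^\<^sub>m k * B)) z" for k
  proof (induction k)
    case 0
    then show ?case using F_reg A B unfolding F_def by simp
  next
    case (Suc k)
    have AkB: "A ^\<^sub>m k * B \<in> carrier_mat m n" by (rule mult_carrier_mat[OF Ak B])
    have cAkB: "rfmat (A ^\<^sub>m k * B) \<in> carrier_mat m n" using AkB by simp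
    have "A ^\<^sub>m k * A = A * A ^\<^sub>m k" by (rule pow_mat_commute[OF A])
    then have "A ^\<^sub>m (Suc k) * B = A * (A ^\<^sub>m k * B)" using assoc_mult_mat[OF A Ak B] by simp
    then have "G * rfmat (A ^\<^sub>m (Suc k) * B) = (G * rfmat A) * rfmat (A ^\<^sub>m k * B)"
      using rfmat_mult[OF A AkB] assoc_mult_mat[OF G(1) cA cAkB] by simp
    also have "\<dots> = rf_s \<cdot>\<^sub>m (G * rfmat (A ^\<^sub>m k * B)) - rfmat (A ^\<^sub>m k * B)"
      unfolding GA using minus_mult_distrib_mat[OF sG one_carrier_mat cAkB] mult_smult_assoc_mat[OF G(1) cAkB] left_mult_one_mat[OF cAkB] by metis
    finally show ?case
      using regular_diff(1)[OF smult_carrier_mat[OF mult_carrier_mat[OF G(1) cAkB]] cAkB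
          regular_smult[OF rf_s(1) Suc] regular_const(1)] by metis
  qed
  define Co where "Co = controllability_mat A B"
  have Co: "Co \<in> carrier_mat m (m * n)" using A B by (simp add: Co_def controllability_mat_def)
  obtain E where E: "E \<in> carrier_mat (m * n) m" "Co * E = 1\<^sub>m m"
    using full_row_rank_right_inverse[OF Co] co A B unfolding controllable_def Co_def by auto
  have cCo: "rfmat Co \<in> carrier_mat m (m * n)" and cE: "rfmat E \<in> carrier_mat (m * n) m" using Co E by auto
  have "(G * rfmat Co) $$ (i, j) = (G * rfmat (A ^\<^sub>m (j div n) * B)) $$ (i, j mod n)"
    if i: "i < m" and j: "j < m * n" for i j
  proof -
    have AkB: "A ^\<^sub>m (j div n) * B \<in> carrier_mat m n" by (rule mult_carrier_mat[OF Ak B])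
    have jm: "j mod n < n" using n by simp
    have "Co $$ (l, j) = (A ^\<^sub>m (j div n) * B) $$ (l, j mod n)" if "l < m" for l
      using j that A B by (simp add: Co_def controllability_mat_def del: index_mult_mat(1))
    then show ?thesis unfolding mult_mat_entry[OF G(1) cCo i j] 
      mult_mat_entry[OF G(1) map_carrier_mat[THEN iffD2, OF AkB] i jm]
      using j jm by (intro sum.cong refl) (simp add: map_mat_entry[OF Co] map_mat_entry[OF AkB] del: index_mult_mat(1) index_map_mat(1))
  qed
  then have "regular_at (G * rfmat Co) z"
    using 2 n G(1) Co A B unfolding regular_at_def
      by (simp add: carrier_matD[OF G(1)] carrier_matD[OF Co] del: index_mult_mat(1))
  moreover have "G = (G * rfmat Co) * rfmat E"
    using rfmat_mult[OF Co E(1)] E(2) G(1) assoc_mult_mat[OF G(1) cCo cE]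
    by (metis right_mult_one_mat rf_const.mat_hom_one)
  ultimately have G_reg: "regular_at G z"
    using regular_mult(1)[OF mult_carrier_mat[OF G(1) cCo] cE _ regular_const(1)] by metis
  note 4 = regular_diff[OF s cA regular_s(1) regular_const(1), unfolded regular_const(2) regular_s(2)]
  have M: "rf_s \<cdot>\<^sub>m 1\<^sub>m m - rfmat A \<in> carrier_mat m m"
    by (intro minus_carrier_mat) (simp add: A)
  have one: "tfm_eval (1\<^sub>m m) z = 1\<^sub>m m"
    using regular_const(2)[of "1\<^sub>m m" z] by (simp add: rf_const.mat_hom_one of_real_hom.mat_hom_one)
  have inv: "tfm_eval G z * (z \<cdot>\<^sub>m 1\<^sub>m m - cmat A) = 1\<^sub>m m"
    using regular_mult(2)[OF G(1) M G_reg 4(1)] unfolding G(3) 4(2) one by simp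
  show ?thesis
  proof
    assume "eigenvalue (cmat A) z"
    then obtain w where w: "w \<in> carrier_vec m" "w \<noteq> 0\<^sub>v m" "cmat A *\<^sub>v w = z \<cdot>\<^sub>v w"
      using A unfolding eigenvalue_def eigenvector_def by auto
    have A': "cmat A \<in> carrier_mat m m" using A by simp
    have G': "tfm_eval G z \<in> carrier_mat m m" using G(1) by simp
    have "(z \<cdot>\<^sub>m 1\<^sub>m m - cmat A) *\<^sub>v w = z \<cdot>\<^sub>v w - cmat A *\<^sub>v w"
      using char_matrix_mult_vec[OF A'] w by simp
    also have "\<dots> = 0\<^sub>v m" using w by simp
    finally have "tfm_eval G z *\<^sub>v ((z \<cdot>\<^sub>m 1\<^sub>m m - cmat A) *\<^sub>v w) = 0\<^sub>v m"
      using mult_mat_zero_vec[OF G'] by simp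
    moreover have "tfm_eval G z *\<^sub>v ((z \<cdot>\<^sub>m 1\<^sub>m m - cmat A) *\<^sub>v w) = w"
      using assoc_mult_mat_vec[OF G' _ w(1), of "z \<cdot>\<^sub>m 1\<^sub>m m - cmat A"] minus_carrier_mat[OF A'] w(1)
      unfolding inv by simp
    ultimately show False using w(2) by simp
  qed
qed

section \<open>The discrete Fourier transform of periodic motions\<close>

lemma roots_of_unity_orthogonal:
  assumes k: "k < N" and l: "l < N"
  defines "z \<equiv> \<lambda>j. cis (2 * pi * real j / real N)"
  shows "(\<Sum>j<N. cnj (z j ^ k) * z j ^ l) = (if k = l then of_nat N else 0)"
proof (cases "k = l")
  case True
  have "cnj (z j ^ k) * z j ^ k = 1" for j
    by (metis Complex.DeMoivre cis_cnj cis_mult cis_zero add.left_inverse z_def)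
  then show ?thesis using True by simp
next
  case False
  define q where "q = cnj (z k) * z l"
  have N: "N > 0" using k by simp
  have pow: "z j ^ i = z i ^ j" for i j
    unfolding z_def by (simp add: Complex.DeMoivre mult_ac)
  have unit: "cnj (z k) * z k = 1" for k
    unfolding z_def cis_cnj cis_mult by simp
  have eq: "cnj (z j ^ k) * z j ^ l = q ^ j" for j
    unfolding q_def power_mult_distrib pow[of j] by simp
  have one: "z j ^ N = 1" for j
  proof -
    have "z j ^ N = cis (2 * pi * real j)" using N unfolding z_def Complex.DeMoivre by simp
    then show ?thesis using cis_multiple_2pi[of "real j"] by simp
  qed
  have qN: "q ^ N = 1" unfolding q_def power_mult_distrib complex_cnj_power[symmetric] one by simp
  have "q \<noteq> 1"
  proof
    assume "q = 1"
    then have "z k * (cnj (z k) * z l) = z k" unfolding q_def by simp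
    then have "z l = z k" using unit[of k] by (metis mult.assoc mult.commute mult_1)
    moreover have "inj_on z {..<N}"
      using bij_betw_roots_unity[OF N] unfolding z_def bij_betw_def by blast
    ultimately show False using False k l by (auto dest: inj_onD)
  qed
  then have "(\<Sum>j<N. q ^ j) = 0" using qN by (simp add: geometric_sum)
  then show ?thesis using False unfolding eq by simp
qed

lemma parseval:
  fixes a b :: "nat \<Rightarrow> complex"
  defines "z \<equiv> \<lambda>j N. cis (2 * pi * real j / real N)"
  shows "(\<Sum>j<N. cnj (\<Sum>k<N. a k * z j N ^ k) * (\<Sum>l<N. b l * z j N ^ l)) = of_nat N * (\<Sum>k<N. cnj (a k) * b k)"
proof -
  have "(\<Sum>j<N. cnj (\<Sum>k<N. a k * z j N ^ k) * (\<Sum>l<N. b l * z j N ^ l))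
      = (\<Sum>j<N. \<Sum>k<N. \<Sum>l<N. cnj (a k) * b l * (cnj (z j N ^ k) * z j N ^ l))"
    unfolding cnj_sum sum_product by (intro sum.cong refl) (simp add: mult_ac)
  also have "\<dots> = (\<Sum>k<N. \<Sum>j<N. \<Sum>l<N. cnj (a k) * b l * (cnj (z j N ^ k) * z j N ^ l))"
    by (rule sum.swap)
  also have "\<dots> = (\<Sum>k<N. \<Sum>l<N. \<Sum>j<N. cnj (a k) * b l * (cnj (z j N ^ k) * z j N ^ l))"
    by (intro sum.cong refl sum.swap)
  also have "\<dots> = (\<Sum>k<N. \<Sum>l<N. cnj (a k) * b l * (if k = l then of_nat N else 0))"
    unfolding sum_distrib_left[symmetric] z_def
    by (intro sum.cong refl arg_cong2[of _ _ _ _ "(*)"] roots_of_unity_orthogonal) auto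
  also have "\<dots> = (\<Sum>k<N. cnj (a k) * b k * of_nat N)"
    by (intro sum.cong refl) (simp add: if_distrib sum.delta cong: if_cong)
  finally show ?thesis by (simp add: sum_distrib_left mult.commute)
qed

text \<open>Value at \<open>z\<close> of the polynomial whose coefficients are the first \<open>N\<close> vectors of a sequence
  in \<open>\<real>\<^sup>d\<close>; at the \<open>N\<close>-th roots of unity these are the discrete Fourier coefficients.\<close>
definition vdft :: "nat \<Rightarrow> nat \<Rightarrow> (nat \<Rightarrow> real vec) \<Rightarrow> complex \<Rightarrow> complex vec"
  where "vdft N d a z = vec d (\<lambda>i. \<Sum>k<N. complex_of_real (a k $ i) * z ^ k)"

lemma vdft_carrier [simp]: "vdft N d a z \<in> carrier_vec d"
  by (simp add: vdft_def)

lemma vdft_index: "i < d \<Longrightarrow> vdft N d a z $ i = (\<Sum>k<N. complex_of_real (a k $ i) * z ^ k)"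
  by (simp add: vdft_def)

lemma vdft_dim [simp]: "dim_vec (vdft N d a z) = d"
  by (simp add: vdft_def)

lemma vdft_add:
  assumes "\<And>k. k < N \<Longrightarrow> a k \<in> carrier_vec d" "\<And>k. k < N \<Longrightarrow> b k \<in> carrier_vec d"
  shows "vdft N d (\<lambda>k. a k + b k) z = vdft N d a z + vdft N d b z"
proof (rule eq_vecI)
  fix i assume "i < dim_vec (vdft N d a z + vdft N d b z)"
  then have i: "i < d" by (simp add: vdft_def)
  have *: "complex_of_real ((a k + b k) $ i) * z ^ k = complex_of_real (a k $ i) * z ^ k + complex_of_real (b k $ i) * z ^ k"
    if "k < N" for k
  proof -
    have "(a k + b k) $ i = a k $ i + b k $ i" using assms(2)[OF that] i by simp
    then show ?thesis by (simp only: distrib_right of_real_add)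
  qed
  have "vdft N d (\<lambda>k. a k + b k) z $ i = (\<Sum>k<N. complex_of_real (a k $ i) * z ^ k + complex_of_real (b k $ i) * z ^ k)"
    unfolding vdft_index[OF i] by (rule sum.cong[OF refl]) (use * in blast)
  also have "\<dots> = (vdft N d a z + vdft N d b z) $ i"
    unfolding sum.distrib using i by (simp add: vdft_index)
  finally show "vdft N d (\<lambda>k. a k + b k) z $ i = (vdft N d a z + vdft N d b z) $ i" .
qed (simp add: vdft_def)

lemma vdft_diff:
  assumes "\<And>k. k < N \<Longrightarrow> a k \<in> carrier_vec d" "\<And>k. k < N \<Longrightarrow> b k \<in> carrier_vec d"
  shows "vdft N d (\<lambda>k. a k - b k) z = vdft N d a z - vdft N d b z"
proof (rule eq_vecI)
  fix i assume "i < dim_vec (vdft N d a z - vdft N d b z)"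
  then have i: "i < d" by (simp add: vdft_def)
  have *: "complex_of_real ((a k - b k) $ i) * z ^ k = complex_of_real (a k $ i) * z ^ k - complex_of_real (b k $ i) * z ^ k"
    if "k < N" for k
  proof -
    have "(a k - b k) $ i = a k $ i - b k $ i" using assms(2)[OF that] i by simp
    then show ?thesis by (simp only: left_diff_distrib of_real_diff)
  qed
  have "vdft N d (\<lambda>k. a k - b k) z $ i = (\<Sum>k<N. complex_of_real (a k $ i) * z ^ k - complex_of_real (b k $ i) * z ^ k)"
    unfolding vdft_index[OF i] by (rule sum.cong[OF refl]) (use * in blast)
  also have "\<dots> = (vdft N d a z - vdft N d b z) $ i"
    unfolding sum_subtractf using i by (simp add: vdft_index)
  finally show "vdft N d (\<lambda>k. a k - b k) z $ i = (vdft N d a z - vdft N d b z) $ i" .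
qed (simp add: vdft_def)

lemma mult_mat_vec_entry:
  "M \<in> carrier_mat r c \<Longrightarrow> v \<in> carrier_vec c \<Longrightarrow> i < r \<Longrightarrow> (M *\<^sub>v v) $ i = (\<Sum>j<c. M $$ (i, j) * v $ j)"
  by (simp add: scalar_prod_def lessThan_atLeast0)

lemma vdft_mult_mat:
  assumes M: "M \<in> carrier_mat r c" and a: "\<And>k. k < N \<Longrightarrow> a k \<in> carrier_vec c"
  shows "vdft N r (\<lambda>k. M *\<^sub>v a k) z = cmat M *\<^sub>v vdft N c a z"
proof (rule eq_vecI)
  fix i assume "i < dim_vec (cmat M *\<^sub>v vdft N c a z)"
  then have i: "i < r" using M by simp
  have cM: "cmat M \<in> carrier_mat r c" using M by simp
  have "vdft N r (\<lambda>k. M *\<^sub>v a k) z $ i = (\<Sum>k<N. complex_of_real (\<Sum>j<c. M $$ (i, j) * a k $ j) * z ^ k)"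
    using i mult_mat_vec_entry[OF M a i] by (simp add: vdft_def cong: sum.cong_simp)
  also have "\<dots> = (\<Sum>k<N. \<Sum>j<c. complex_of_real (M $$ (i, j)) * (complex_of_real (a k $ j) * z ^ k))"
    by (simp add: sum_distrib_right mult.assoc)
  also have "\<dots> = (\<Sum>j<c. \<Sum>k<N. complex_of_real (M $$ (i, j)) * (complex_of_real (a k $ j) * z ^ k))"
    by (rule sum.swap)
  also have "\<dots> = (cmat M *\<^sub>v vdft N c a z) $ i"
    unfolding mult_mat_vec_entry[OF cM vdft_carrier i] using M i
    by (simp add: vdft_def sum_distrib_left)
  finally show "vdft N r (\<lambda>k. M *\<^sub>v a k) z $ i = (cmat M *\<^sub>v vdft N c a z) $ i" .
qed (use M in \<open>simp add: vdft_def\<close>)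

lemma vdft_cyclic_shift:
  assumes ab: "\<And>k. k < N \<Longrightarrow> a k = b (Suc k mod N)" and z: "z ^ N = 1" and N: "N > 0"
  shows "z \<cdot>\<^sub>v vdft N d a z = vdft N d b z"
proof (rule eq_vecI)
  fix i assume "i < dim_vec (vdft N d b z)"
  then have i: "i < d" by (simp add: vdft_def)
  obtain M where M: "N = Suc M" using N by (cases N) auto
  have "z * (\<Sum>k<N. complex_of_real (a k $ i) * z ^ k) = (\<Sum>k<N. complex_of_real (b (Suc k mod N) $ i) * z ^ Suc k)"
    unfolding sum_distrib_left by (intro sum.cong refl) (simp add: ab)
  also have "\<dots> = (\<Sum>k<M. complex_of_real (b (Suc k) $ i) * z ^ Suc k) + complex_of_real (b 0 $ i) * z ^ N"
    unfolding M by (simp cong: sum.cong_simp)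
  also have "\<dots> = (\<Sum>k<N. complex_of_real (b k $ i) * z ^ k)"
    unfolding z unfolding M sum.lessThan_Suc_shift by simp
  finally show "(z \<cdot>\<^sub>v vdft N d a z) $ i = vdft N d b z $ i" using i by (simp add: vdft_def)
qed (simp add: vdft_def)

text \<open>The Cayley transform takes the unit circle without \<open>-1\<close> to the imaginary axis.\<close>
lemma Re_cayley_unit_circle:
  assumes "norm z = 1"
  shows "Re ((z - 1) / (z + 1)) = 0"
proof -
  have "Re z * Re z + Im z * Im z = 1"
    using assms by (metis cmod_power2 power2_eq_square mult_1)
  then show ?thesis by (simp add: Re_divide algebra_simps)
qed

text \<open>The supply rate \<open>g\<^sup>* C v\<close> has nonnegative real part along every steady-state
  oscillation of \<open>x' = A x + B u\<close> with state amplitude \<open>w\<close>, input amplitude \<open>g\<close> and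
  state velocity \<open>v = \<i> \<omega> w\<close>.\<close>
definition freq_passive :: "real mat \<Rightarrow> real mat \<Rightarrow> real mat \<Rightarrow> bool"
  where "freq_passive A B C \<longleftrightarrow> (\<forall>\<omega>::real. \<forall>w \<in> carrier_vec (dim_row A). \<forall>g \<in> carrier_vec (dim_col B).
    (\<i> * of_real \<omega>) \<cdot>\<^sub>v w = cmat A *\<^sub>v w + cmat B *\<^sub>v g \<longrightarrow>
    0 \<le> Re (conjugate g \<bullet> (cmat C *\<^sub>v ((\<i> * of_real \<omega>) \<cdot>\<^sub>v w))))"

text \<open>For an \<open>N\<close>-th root of unity \<open>z\<close>, the Fourier coefficients of an \<open>N\<close>-periodic motion
  satisfy \<open>z (\<^bold>w - \<^bold>v) = \<^bold>w + \<^bold>v\<close>, that is, \<open>\<^bold>v = s \<^bold>w\<close> with \<open>s = (z - 1) / (z + 1)\<close> on the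
  imaginary axis.  An odd \<open>N\<close> keeps \<open>z\<close> away from \<open>-1\<close>.\<close>
lemma periodic_supply_nonneg:
  assumes A: "A \<in> carrier_mat m m" and B: "B \<in> carrier_mat m n" and C: "C \<in> carrier_mat n m"
    and fp: "freq_passive A B C" and N: "odd N"
    and w: "\<And>k. k < N \<Longrightarrow> w k \<in> carrier_vec m"
      and u: "\<And>k. k < N \<Longrightarrow> u k \<in> carrier_vec n"
    and v: "\<And>k. k < N \<Longrightarrow> v k = A *\<^sub>v w k + B *\<^sub>v u k"
    and per: "\<And>k. k < N \<Longrightarrow> w k - v k = w (Suc k mod N) + v (Suc k mod N)"
  shows "0 \<le> (\<Sum>k<N. u k \<bullet> (C *\<^sub>v v k))"
proof -
  have N0: "N > 0" using N by (cases N) auto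
  have vc: "v k \<in> carrier_vec m" if "k < N" for k
    using that by (simp add: v mult_mat_vec_carrier[OF A w] mult_mat_vec_carrier[OF B u])
  define z where "z = (\<lambda>j. cis (2 * pi * real j / real N))"
  define W U V Y where "W = (\<lambda>j. vdft N m w (z j))" and "U = (\<lambda>j. vdft N n u (z j))"
    and "V = (\<lambda>j. vdft N m v (z j))" and "Y = (\<lambda>j. vdft N n (\<lambda>k. C *\<^sub>v v k) (z j))"
  have pos: "0 \<le> Re (conjugate (U j) \<bullet> Y j)" for j
  proof -
    have "z j ^ N = cis (2 * pi * real j)" using N0 unfolding z_def Complex.DeMoivre by simp
    then have zN: "z j ^ N = 1" using cis_multiple_2pi[of "real j"] by simp
    have z1: "z j + 1 \<noteq> 0"
    proof
      assume "z j + 1 = 0"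
      then have "z j = - 1" by (simp add: add_eq_0_iff2)
      then have "z j ^ N = - 1" using N by simp
      with zN show False by simp
    qed
    have Y: "Y j = cmat C *\<^sub>v V j" unfolding Y_def V_def by (rule vdft_mult_mat[OF C vc])
    have "vdft N m v (z j) = vdft N m (\<lambda>k. A *\<^sub>v w k + B *\<^sub>v u k) (z j)"
      using v by (auto simp: vdft_def cong: sum.cong_simp)
    also have "\<dots> = vdft N m (\<lambda>k. A *\<^sub>v w k) (z j) + vdft N m (\<lambda>k. B *\<^sub>v u k) (z j)"
      by (rule vdft_add) (simp_all add: mult_mat_vec_carrier[OF A w] mult_mat_vec_carrier[OF B u])
    also have "vdft N m (\<lambda>k. A *\<^sub>v w k) (z j) = cmat A *\<^sub>v W j"
      unfolding W_def by (rule vdft_mult_mat[OF A w])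
    also have "vdft N m (\<lambda>k. B *\<^sub>v u k) (z j) = cmat B *\<^sub>v U j"
      unfolding U_def by (rule vdft_mult_mat[OF B u])
    finally have V: "V j = cmat A *\<^sub>v W j + cmat B *\<^sub>v U j"
      unfolding V_def .
    have plus: "W j + V j = vdft N m (\<lambda>k. w k + v k) (z j)"
      unfolding W_def V_def by (rule vdft_add[OF w vc, symmetric])
    have minus: "W j - V j = vdft N m (\<lambda>k. w k - v k) (z j)"
      unfolding W_def V_def by (rule vdft_diff[OF w vc, symmetric])
    have shift: "z j \<cdot>\<^sub>v (W j - V j) = W j + V j"
      unfolding plus minus
      by (rule vdft_cyclic_shift[where a="\<lambda>k. w k - v k" and b="\<lambda>k. w k + v k", OF per zN N0])
    then have e: "z j * (W j $ i - V j $ i) = W j $ i + V j $ i" if "i < m" for i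
    proof -
      have d: "dim_vec (W j) = m" "dim_vec (V j) = m" by (simp_all add: W_def V_def)
      show ?thesis using arg_cong[OF shift, of "\<lambda>x. x $ i"] that by (simp add: d)
    qed
    define s where "s = (z j - 1) / (z j + 1)"
    have "V j $ i = s * W j $ i" if "i < m" for i
      using e[OF that] z1 by (simp add: s_def field_simps)
    then have Vs: "V j = s \<cdot>\<^sub>v W j" by (intro eq_vecI) (auto simp: V_def W_def vdft_def)
    have "Re s = 0" unfolding s_def by (rule Re_cayley_unit_circle) (simp add: z_def)
    then have s: "s = \<i> * of_real (Im s)" by (simp add: complex_eq_iff)
    have "(\<i> * of_real (Im s)) \<cdot>\<^sub>v W j = cmat A *\<^sub>v W j + cmat B *\<^sub>v U j"
      using V Vs s by simp
    then have "0 \<le> Re (conjugate (U j) \<bullet> (cmat C *\<^sub>v ((\<i> * of_real (Im s)) \<cdot>\<^sub>v W j)))"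
      using fp A B unfolding freq_passive_def U_def W_def by auto
    then show ?thesis unfolding Y using Vs s by simp
  qed
  have "(\<Sum>j<N. conjugate (U j) \<bullet> Y j) = (\<Sum>j<N. \<Sum>i<n. cnj (U j $ i) * Y j $ i)"
    by (simp add: scalar_prod_def U_def Y_def vdft_def lessThan_atLeast0)
  also have "\<dots> = (\<Sum>i<n. \<Sum>j<N. cnj (U j $ i) * Y j $ i)" by (rule sum.swap)
  also have "\<dots> = (\<Sum>i<n. of_nat N * (\<Sum>k<N. of_real (u k $ i * (C *\<^sub>v v k) $ i)))"
  proof (rule sum.cong[OF refl])
    fix i assume "i \<in> {..<n}"
    then show "(\<Sum>j<N. cnj (U j $ i) * Y j $ i) = of_nat N * (\<Sum>k<N. of_real (u k $ i * (C *\<^sub>v v k) $ i))"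
      using parseval[where N=N and a="\<lambda>k. of_real (u k $ i)" and b="\<lambda>k. of_real ((C *\<^sub>v v k) $ i)"]
      by (simp add: U_def Y_def vdft_def z_def del: index_mult_mat_vec)
  qed
  also have "\<dots> = of_nat N * (\<Sum>i<n. \<Sum>k<N. of_real (u k $ i * (C *\<^sub>v v k) $ i))"
    by (rule sum_distrib_left[symmetric])
  also have "\<dots> = of_nat N * (\<Sum>k<N. \<Sum>i<n. of_real (u k $ i * (C *\<^sub>v v k) $ i))"
    by (subst sum.swap) simp
  also have "\<dots> = of_real (real N * (\<Sum>k<N. u k \<bullet> (C *\<^sub>v v k)))"
    using C by (simp add: scalar_prod_def lessThan_atLeast0)
  finally have "real N * (\<Sum>k<N. u k \<bullet> (C *\<^sub>v v k)) = (\<Sum>j<N. Re (conjugate (U j) \<bullet> Y j))"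
    by (metis Re_complex_of_real Re_sum)
  also have "\<dots> \<ge> 0" using pos by (intro sum_nonneg) auto
  finally show ?thesis using N0 by (simp add: zero_le_mult_iff)
qed

section \<open>Quadratic forms from the parallelogram law\<close>

text \<open>The defect \<open>g t = f t - t f 1\<close> is additive and vanishes on the integers, so it is periodic and
  therefore bounded on the whole line; being additive, it is 0.\<close>
lemma additive_bounded_linear:
  fixes f :: "real \<Rightarrow> real"
  assumes add: "\<And>s t. f (s + t) = f s + f t"
    and bd: "\<And>t. \<bar>t\<bar> \<le> 1 \<Longrightarrow> \<bar>f t\<bar> \<le> M"
  shows "f t = t * f 1"
proof -
  define g where "g t = f t - t * f 1" for t
  have g_add: "g (s + t) = g s + g t" for s t by (simp add: g_def add algebra_simps)
  have g0: "g 0 = 0" using g_add[of 0 0] by simp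
  have g_nat: "g (real n * t) = real n * g t" for n t
  proof (induction n)
    case (Suc n)
    have "g (real (Suc n) * t) = g (real n * t + t)" by (simp add: algebra_simps)
    then show ?case using Suc g_add by (simp add: algebra_simps)
  qed (simp add: g0)
  have g1: "g 1 = 0" by (simp add: g_def)
  have g_bd: "\<bar>g t\<bar> \<le> 2 * M" if "\<bar>t\<bar> \<le> 1" for t
  proof -
    have "\<bar>t * f 1\<bar> \<le> \<bar>f 1\<bar>" using that by (simp add: abs_mult mult_left_le_one_le)
    then show ?thesis using bd[OF that] bd[of 1] unfolding g_def by linarith
  qed
  have g_int: "g (of_int k) = 0" for k
  proof (cases k)
    case (nonneg n) then show ?thesis using g_nat[of n 1] g1 by simp
  next
    case (neg n)
    have "g (- real (Suc n)) + g (real (Suc n)) = 0" using g_add[of "- real (Suc n)" "real (Suc n)"] g0 by simp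
    then show ?thesis using g_nat[of "Suc n" 1] g1 neg by simp
  qed
  have g_all: "\<bar>g t\<bar> \<le> 2 * M" for t
  proof -
    have "g t = g (frac t)" using g_add[of "frac t" "of_int \<lfloor>t\<rfloor>"] g_int by (simp add: frac_def)
    then show ?thesis using g_bd[of "frac t"] by (simp add: frac_ge_0 frac_lt_1 less_imp_le)
  qed
  have "g t = 0"
  proof (rule ccontr)
    assume "g t \<noteq> 0"
    then obtain n where "2 * M < real n * \<bar>g t\<bar>" using reals_Archimedean3[of "\<bar>g t\<bar>"] by auto
    moreover have "real n * \<bar>g t\<bar> = \<bar>g (real n * t)\<bar>" by (simp add: g_nat abs_mult)
    ultimately show False using g_all[of "real n * t"] by simp
  qed
  then show ?thesis by (simp add: g_def)
qed

lemma linear_functional_coordinates: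
  fixes L :: "real vec \<Rightarrow> real"
  assumes add: "\<And>x y. x \<in> carrier_vec m \<Longrightarrow> y \<in> carrier_vec m \<Longrightarrow> L (x + y) = L x + L y"
    and hom: "\<And>a x. x \<in> carrier_vec m \<Longrightarrow> L (a \<cdot>\<^sub>v x) = a * L x"
    and x: "x \<in> carrier_vec m"
  shows "L x = (\<Sum>i<m. x $ i * L (unit_vec m i))"
proof -
  define p where "p k = vec m (\<lambda>i. if i < k then x $ i else 0)" for k
  have pc: "p k \<in> carrier_vec m" for k by (simp add: p_def)
  have "L (p k) = (\<Sum>i<k. x $ i * L (unit_vec m i))" if "k \<le> m" for k
    using that
  proof (induction k)
    case 0
    have "p 0 = 0 \<cdot>\<^sub>v x" by (rule eq_vecI) (use x in \<open>auto simp: p_def\<close>)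
    then show ?case using hom[OF x, of 0] by simp
  next
    case (Suc k)
    have "p (Suc k) = p k + x $ k \<cdot>\<^sub>v unit_vec m k"
      by (rule eq_vecI) (use Suc.prems in \<open>auto simp: p_def less_Suc_eq\<close>)
    then show ?case using Suc add[OF pc[of k], of "x $ k \<cdot>\<^sub>v unit_vec m k"] hom[of "unit_vec m k" "x $ k"] by simp
  qed
  moreover have "p m = x" by (rule eq_vecI) (use x in \<open>auto simp: p_def\<close>)
  ultimately show ?thesis by (metis order_refl)
qed

text \<open>The Jordan--von Neumann theorem for a nonnegative function on \<open>\<real>\<^sup>m\<close>.\<close>
lemma parallelogram_imp_quadratic_form:
  fixes V :: "real vec \<Rightarrow> real"
  assumes par: "\<And>x y. x \<in> carrier_vec m \<Longrightarrow> y \<in> carrier_vec m \<Longrightarrow> V (x + y) + V (x - y) = 2 * V x + 2 * V y"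
    and hom: "\<And>a x. x \<in> carrier_vec m \<Longrightarrow> V (a \<cdot>\<^sub>v x) = a\<^sup>2 * V x"
    and nonneg: "\<And>x. x \<in> carrier_vec m \<Longrightarrow> 0 \<le> V x"
  shows "\<exists>X \<in> carrier_mat m m. X\<^sup>T = X \<and> (\<forall>x \<in> carrier_vec m. V x = x \<bullet> (X *\<^sub>v x))"
proof -
  define b where "b x y = (V (x + y) - V (x - y)) / 4" for x y
  note [simp] = add_carrier_vec minus_carrier_vec
  have neg: "V (x - y) = V (y - x)" if "x \<in> carrier_vec m" "y \<in> carrier_vec m" for x y
  proof -
    have "x - y = (-1) \<cdot>\<^sub>v (y - x)" by (rule eq_vecI) (use that in auto)
    then show ?thesis using hom[of "y - x" "-1"] that by simp
  qed
  have sym: "b x y = b y x" if "x \<in> carrier_vec m" "y \<in> carrier_vec m" for x y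
    unfolding b_def using neg[OF that] comm_add_vec[OF that] by simp
  have "0 \<cdot>\<^sub>v 0\<^sub>v m = (0\<^sub>v m :: real vec)" by (rule eq_vecI) auto
  then have V0: "V (0\<^sub>v m) = 0" using hom[of "0\<^sub>v m" 0] by simp
  have b0: "b (0\<^sub>v m) z = 0" if z: "z \<in> carrier_vec m" for z
    using neg[of "0\<^sub>v m" z] z by (simp add: b_def)
  have half: "b x z + b y z = b (x + y) (2 \<cdot>\<^sub>v z) / 2"
    if x: "x \<in> carrier_vec m" and y: "y \<in> carrier_vec m" and z: "z \<in> carrier_vec m" for x y z
  proof -
    have 1: "(x + z) + (y + z) = (x + y) + 2 \<cdot>\<^sub>v z" "(x + z) - (y + z) = x - y"
      "(x - z) + (y - z) = (x + y) - 2 \<cdot>\<^sub>v z" "(x - z) - (y - z) = x - y"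
      by (rule eq_vecI; use x y z in auto)+
    have c: "x + z \<in> carrier_vec m" "y + z \<in> carrier_vec m" "x - z \<in> carrier_vec m" "y - z \<in> carrier_vec m"
      using x y z by auto
    have average: "(p - r) / 4 + (q - s) / 4 = (a - d) / 4 / 2"
      if "a + e = 2 * p + 2 * q" "d + e = 2 * r + 2 * s" for a d e p q r s :: real
      using that by (simp add: field_simps)
    show ?thesis
      unfolding b_def by (rule average[OF par[OF c(1,2), unfolded 1] par[OF c(3,4), unfolded 1]])
  qed
  have b_add: "b (x + y) z = b x z + b y z"
    if x: "x \<in> carrier_vec m" and y: "y \<in> carrier_vec m" and z: "z \<in> carrier_vec m" for x y z
  proof -
    have "x + y + 0\<^sub>v m = x + y" using x y by simp
    then show ?thesis using half[OF x y z] half[of "x + y" "0\<^sub>v m" z] x y z b0[OF z] by simp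
  qed
  have b_hom: "b (t \<cdot>\<^sub>v x) z = t * b x z" if x: "x \<in> carrier_vec m" and z: "z \<in> carrier_vec m"
    for t x z
  proof -
    have "b (t \<cdot>\<^sub>v x) z = t * b (1 \<cdot>\<^sub>v x) z"
    proof (rule additive_bounded_linear[where f = "\<lambda>t. b (t \<cdot>\<^sub>v x) z"])
      show "b ((s + t) \<cdot>\<^sub>v x) z = b (s \<cdot>\<^sub>v x) z + b (t \<cdot>\<^sub>v x) z" for s t
        unfolding add_smult_distrib_vec by (rule b_add) (use x z in auto)
      show "\<bar>b (t \<cdot>\<^sub>v x) z\<bar> \<le> (V x + V z) / 2" if t: "\<bar>t\<bar> \<le> 1" for t
      proof -
        have "t\<^sup>2 \<le> 1" using t by (simp add: abs_square_le_1)
        then have "t\<^sup>2 * V x \<le> V x" using nonneg[OF x] by (simp add: mult_left_le_one_le)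
        moreover have "V (t \<cdot>\<^sub>v x + z) + V (t \<cdot>\<^sub>v x - z) = 2 * (t\<^sup>2 * V x) + 2 * V z"
          using par[of "t \<cdot>\<^sub>v x" z] hom[OF x] x z by simp
        moreover have "0 \<le> V (t \<cdot>\<^sub>v x + z)" "0 \<le> V (t \<cdot>\<^sub>v x - z)" using x z
          by (simp_all add: nonneg)
        ultimately show ?thesis unfolding b_def by (simp add: abs_le_iff)
      qed
    qed
    then show ?thesis by simp
  qed
  define X where "X = mat m m (\<lambda>(i, j). b (unit_vec m i) (unit_vec m j))"
  have X: "X \<in> carrier_mat m m" by (simp add: X_def)
  have "X\<^sup>T = X" by (rule eq_matI) (auto simp: X_def intro!: sym)
  moreover have "V x = x \<bullet> (X *\<^sub>v x)" if x: "x \<in> carrier_vec m" for x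
  proof -
    have "x - x = 0\<^sub>v m" "x + x = 2 \<cdot>\<^sub>v x" using x by (auto intro!: eq_vecI)
    then have "V x = b x x" using hom[OF x, of 2] V0 by (simp add: b_def)
    also have "b x x = (\<Sum>i<m. x $ i * b (unit_vec m i) x)"
      by (rule linear_functional_coordinates[where L = "\<lambda>y. b y x"]) (use x in \<open>auto simp: b_add b_hom\<close>)
    also have "\<dots> = (\<Sum>i<m. x $ i * (\<Sum>j<m. x $ j * b (unit_vec m j) (unit_vec m i)))"
    proof (rule sum.cong[OF refl], rule arg_cong[of _ _ "(*) _"])
      fix i
      have "b (unit_vec m i) x = b x (unit_vec m i)" using x by (simp add: sym)
      also have "\<dots> = (\<Sum>j<m. x $ j * b (unit_vec m j) (unit_vec m i))"
        by (rule linear_functional_coordinates[where L = "\<lambda>y. b y (unit_vec m i)"]) (use x in \<open>auto simp: b_add b_hom\<close>)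
      finally show "b (unit_vec m i) x = (\<Sum>j<m. x $ j * b (unit_vec m j) (unit_vec m i))" .
    qed
    also have "\<dots> = x \<bullet> (X *\<^sub>v x)"
      using x X sym unfolding scalar_prod_def[of x]
      by (auto simp: X_def scalar_prod_def lessThan_atLeast0 mult.commute intro!: sum.cong)
    finally show ?thesis .
  qed
  ultimately show ?thesis using X by blast
qed

section \<open>The Cayley transform of a Hurwitz matrix\<close>

text \<open>The sum norm.\<close>
definition vnorm :: "real vec \<Rightarrow> real"
  where "vnorm v = (\<Sum>i<dim_vec v. \<bar>v $ i\<bar>)"

lemma vnorm_nonneg: "0 \<le> vnorm v"
  by (simp add: vnorm_def sum_nonneg)

lemma vnorm_zero_imp: "x \<in> carrier_vec m \<Longrightarrow> vnorm x = 0 \<Longrightarrow> x = 0\<^sub>v m"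
  by (auto simp: vnorm_def sum_nonneg_eq_0_iff intro!: eq_vecI)

lemma vnorm_triangle:
  assumes "x \<in> carrier_vec m" "y \<in> carrier_vec m"
  shows "vnorm (x + y) \<le> vnorm x + vnorm y"
proof -
  have d: "dim_vec x = m" "dim_vec y = m" "dim_vec (x + y) = m" using assms by auto
  have "(\<Sum>i<m. \<bar>(x + y) $ i\<bar>) \<le> (\<Sum>i<m. \<bar>x $ i\<bar> + \<bar>y $ i\<bar>)"
    by (rule sum_mono) (simp add: d abs_triangle_ineq)
  then show ?thesis unfolding vnorm_def d sum.distrib .
qed

lemma scalar_prod_le_vnorm:
  assumes y: "y \<in> carrier_vec m" and x: "x \<in> carrier_vec m"
  shows "\<bar>y \<bullet> x\<bar> \<le> vnorm y * vnorm x"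
proof -
  have d: "dim_vec x = m" "dim_vec y = m" using assms by auto
  have "\<bar>y \<bullet> x\<bar> \<le> (\<Sum>i<m. \<bar>y $ i\<bar> * \<bar>x $ i\<bar>)"
    unfolding scalar_prod_def d lessThan_atLeast0 abs_mult[symmetric] by (rule sum_abs)
  also have "\<dots> \<le> (\<Sum>i<m. \<bar>y $ i\<bar> * vnorm x)"
  proof (intro sum_mono mult_left_mono)
    fix i assume "i \<in> {..<m}"
    then show "\<bar>x $ i\<bar> \<le> vnorm x" unfolding vnorm_def d by (intro member_le_sum) auto
  qed auto
  also have "\<dots> = vnorm y * vnorm x" by (simp add: vnorm_def d sum_distrib_right)
  finally show ?thesis .
qed

lemma two_vec_minus:
  fixes p q :: "real vec"
  assumes "p \<in> carrier_vec m" "q \<in> carrier_vec m"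
  shows "2 \<cdot>\<^sub>v p - (p - q) = p + q"
  by (rule eq_vecI) (use assms in auto)

lemma smult_diff_entry:
  fixes p q :: "complex vec"
  assumes "p \<in> carrier_vec m" "q \<in> carrier_vec m"
    and e: "z \<cdot>\<^sub>v (p - q) = 2 \<cdot>\<^sub>v p - (p - q)" and i: "i < m"
  shows "z * (p $ i - q $ i) = p $ i + q $ i"
  using arg_cong[OF e, of "\<lambda>x. x $ i"] assms(1,2) i by simp

lemma smult_mat_entry:
  "P \<in> carrier_mat r c \<Longrightarrow> i < r \<Longrightarrow> j < c \<Longrightarrow> (a \<cdot>\<^sub>m P) $$ (i, j) = a * P $$ (i, j)"
  by simp

lemma pow_smult_mat:
  fixes M :: "'a::field mat"
  assumes M: "M \<in> carrier_mat m m"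
  shows "(a \<cdot>\<^sub>m M) ^\<^sub>m k = a ^ k \<cdot>\<^sub>m (M ^\<^sub>m k)"
proof (induction k)
  case 0
  show ?case using M by (auto intro!: eq_matI)
next
  case (Suc k)
  have Mk: "M ^\<^sub>m k \<in> carrier_mat m m" using M by simp
  have "(a \<cdot>\<^sub>m M) ^\<^sub>m Suc k = (a ^ k \<cdot>\<^sub>m (M ^\<^sub>m k)) * (a \<cdot>\<^sub>m M)"
    using Suc by simp
  also have "\<dots> = a ^ k \<cdot>\<^sub>m (a \<cdot>\<^sub>m (M ^\<^sub>m k * M))"
    using mult_smult_assoc_mat[OF Mk smult_carrier_mat[OF M]] mult_smult_distrib[OF Mk M] by simp
  also have "\<dots> = a ^ Suc k \<cdot>\<^sub>m (M ^\<^sub>m Suc k)"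
    by (rule eq_matI) auto
  finally show ?case .
qed

text \<open>Powers of a matrix of spectral radius less than 1 are bounded; apply this to \<open>M / r\<close> for some
  \<open>r < 1\<close> above the spectral radius of \<open>M\<close>.\<close>
lemma spectrum_in_disc_imp_geometric_decay:
  fixes M :: "complex mat"
  assumes M: "M \<in> carrier_mat m m" and ev: "\<And>z. eigenvalue M z \<Longrightarrow> norm z < 1"
  shows "\<exists>c r. 0 \<le> c \<and> 0 < r \<and> r < 1 \<and> (\<forall>k i j. i < m \<longrightarrow> j < m \<longrightarrow> norm ((M ^\<^sub>m k) $$ (i, j)) \<le> c * r ^ k)"
proof (cases "m = 0")
  case True
  then show ?thesis by (intro exI[of _ 0] exI[of _ "1/2"]) auto
next
  case False
  then have m: "m > 0" by simp
  define q where "q = spectral_radius M"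
  obtain z where z: "z \<in> spectrum M" "q = norm z"
    using spectral_radius_mem_max(1)[OF M m] unfolding q_def by auto
  then have q: "0 \<le> q" "q < 1" using ev unfolding spectrum_def by auto
  define r where "r = (q + 1) / 2"
  have r: "0 < r" "r < 1" "q < r" using q by (auto simp: r_def)
  define M' where "M' = complex_of_real (1 / r) \<cdot>\<^sub>m M"
  have M': "M' \<in> carrier_mat m m" using M by (simp add: M'_def)
  have MM': "M = complex_of_real r \<cdot>\<^sub>m M'" using r by (auto simp: M'_def intro!: eq_matI)
  have "spectral_radius M' < 1"
  proof -
    obtain z where z: "z \<in> spectrum M'" "spectral_radius M' = norm z"
      using spectral_radius_mem_max(1)[OF M' m] by auto
    then obtain v where v: "v \<in> carrier_vec m" "v \<noteq> 0\<^sub>v m" "M' *\<^sub>v v = z \<cdot>\<^sub>v v"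
      using M' unfolding spectrum_def eigenvalue_def eigenvector_def by auto
    have "M *\<^sub>v v = (of_real r * z) \<cdot>\<^sub>v v"
    proof (rule eq_vecI)
      fix i assume "i < dim_vec ((of_real r * z) \<cdot>\<^sub>v v)"
      then have i: "i < m" using v by simp
      have "(M *\<^sub>v v) $ i = of_real r * (M' *\<^sub>v v) $ i"
        using i M' v(1) unfolding MM' by (simp add: row_smult)
      then show "(M *\<^sub>v v) $ i = ((of_real r * z) \<cdot>\<^sub>v v) $ i" unfolding v(3) using i v(1) by simp
    qed (use M v(1) in simp)
    then have "of_real r * z \<in> spectrum M"
      using v M unfolding spectrum_def eigenvalue_def eigenvector_def by auto
    then have "norm (of_real r * z) \<le> q"
      using spectral_radius_mem_max(2)[OF M m] unfolding q_def by auto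
    then have "r * norm z \<le> q" using r by (simp add: norm_mult)
    then have "r * norm z < r * 1" using r by linarith
    then show ?thesis using z(2) r by simp
  qed
  then obtain c where c: "\<And>k. norm_bound (M' ^\<^sub>m k) c"
    using spectral_radius_jnf_norm_bound_less_1_upper_triangular[OF M'] by blast
  have bd: "norm ((M' ^\<^sub>m k) $$ (i, j)) \<le> c" if "i < m" "j < m" for i j k
    using c[of k] that M' unfolding norm_bound_def by (simp add: pow_mat_dim_square[OF M'])
  have "norm ((M ^\<^sub>m k) $$ (i, j)) \<le> c * r ^ k" if ij: "i < m" "j < m" for i j k
  proof -
    have "(M ^\<^sub>m k) $$ (i, j) = of_real r ^ k * (M' ^\<^sub>m k) $$ (i, j)"
      unfolding MM' pow_smult_mat[OF M'] by (rule smult_mat_entry[OF pow_carrier_mat[OF M'] ij])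
    then have "norm ((M ^\<^sub>m k) $$ (i, j)) = r ^ k * norm ((M' ^\<^sub>m k) $$ (i, j))"
      using r by (simp add: norm_mult norm_power)
    also have "\<dots> \<le> r ^ k * c" using bd[OF ij] r by (intro mult_left_mono) auto
    finally show ?thesis by (simp add: mult.commute)
  qed
  moreover have "0 \<le> c" using bd[OF m m, of 0] norm_ge_zero order_trans by blast
  ultimately show ?thesis using r by blast
qed

text \<open>The system \<open>x' = A x + B u\<close> with state dimension \<open>m\<close> and as many outputs as inputs.\<close>
locale linear_system =
  fixes m n :: nat and A B C :: "real mat"
  assumes A: "A \<in> carrier_mat m m" and B: "B \<in> carrier_mat m n" and C: "C \<in> carrier_mat n m"
begin

text \<open>The velocity at state \<open>w\<close> under input \<open>u\<close>.\<close>
definition vel :: "real vec \<Rightarrow> real vec \<Rightarrow> real vec"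
  where "vel w u = A *\<^sub>v w + B *\<^sub>v u"

lemma vel_carrier [simp]: "w \<in> carrier_vec m \<Longrightarrow> u \<in> carrier_vec n \<Longrightarrow> vel w u \<in> carrier_vec m"
  using A B by (simp add: vel_def)

end

locale stable_system = linear_system +
  assumes hurwitz: "hurwitz A"
begin

lemma ex_T: "\<exists>T \<in> carrier_mat m m. T * (1\<^sub>m m - A) = 1\<^sub>m m \<and> (1\<^sub>m m - A) * T = 1\<^sub>m m"
proof (rule invertible_if_kernel_trivial)
  show "1\<^sub>m m - A \<in> carrier_mat m m" by (rule minus_carrier_mat[OF A])
  fix v assume v: "v \<in> carrier_vec m" and 0: "(1\<^sub>m m - A) *\<^sub>v v = 0\<^sub>v m"
  have "1\<^sub>m m = (1::real) \<cdot>\<^sub>m 1\<^sub>m m" by (auto intro!: eq_matI)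
  then have "v - A *\<^sub>v v = 0\<^sub>v m" using char_matrix_mult_vec[OF A v, of 1] 0 v by simp
  then have e: "A *\<^sub>v v = v" using v A by (auto simp: vec_eq_iff)
  show "v = 0\<^sub>v m"
  proof (rule ccontr)
    assume nz: "v \<noteq> 0\<^sub>v m"
    have "eigenvector (cmat A) (map_vec complex_of_real v) 1"
      unfolding eigenvector_def using v A nz e by (auto simp: of_real_hom.mult_mat_vec_hom[OF A v, symmetric])
    then show False using hurwitz unfolding hurwitz_def eigenvalue_def by fastforce
  qed
qed

text \<open>The inverse of \<open>I - A\<close>, which exists since 1 is not an eigenvalue of a Hurwitz matrix.\<close>
definition T :: "real mat"
  where "T = (SOME T. T \<in> carrier_mat m m \<and> T * (1\<^sub>m m - A) = 1\<^sub>m m \<and> (1\<^sub>m m - A) * T = 1\<^sub>m m)"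

lemma T: "T \<in> carrier_mat m m" "T * (1\<^sub>m m - A) = 1\<^sub>m m" "(1\<^sub>m m - A) * T = 1\<^sub>m m"
  using someI_ex[OF ex_T[unfolded Bex_def], folded T_def] by auto

lemma one_minus_A_vec: "w \<in> carrier_vec m \<Longrightarrow> (1\<^sub>m m - A) *\<^sub>v w = w - A *\<^sub>v w"
  using minus_mult_distrib_mat_vec[of "1\<^sub>m m" m m A w] A by simp

lemma T_left:
  assumes x: "x \<in> carrier_vec m"
  shows "T *\<^sub>v (x - A *\<^sub>v x) = x"
  using assoc_mult_mat_vec[OF T(1) minus_carrier_mat[OF A, of "1\<^sub>m m"] x] x
  by (simp add: one_minus_A_vec T(2))

lemma T_right:
  assumes x: "x \<in> carrier_vec m"
  shows "T *\<^sub>v x - A *\<^sub>v (T *\<^sub>v x) = x"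
  using assoc_mult_mat_vec[OF minus_carrier_mat[OF A, of "1\<^sub>m m"] T(1) x] x
    one_minus_A_vec[OF mult_mat_vec_carrier[OF T(1) x]] by (simp add: T(3))

text \<open>The Cayley transform \<open>2 (I - A)\<^sup>-\<^sup>1 - I = (I + A) (I - A)\<^sup>-\<^sup>1\<close>.\<close>
definition Q :: "real mat" where "Q = 2 \<cdot>\<^sub>m T - 1\<^sub>m m"

lemma Q: "Q \<in> carrier_mat m m" unfolding Q_def by (rule minus_carrier_mat) simp

lemma Q_vec: "x \<in> carrier_vec m \<Longrightarrow> Q *\<^sub>v x = T *\<^sub>v x + A *\<^sub>v (T *\<^sub>v x)"
proof -
  assume x: "x \<in> carrier_vec m"
  have Tx: "T *\<^sub>v x \<in> carrier_vec m" using T x by simp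
  have ATx: "A *\<^sub>v (T *\<^sub>v x) \<in> carrier_vec m" using A Tx by simp
  have "(2 \<cdot>\<^sub>m T) *\<^sub>v x = 2 \<cdot>\<^sub>v (T *\<^sub>v x)" by (rule smult_mat_mult_vec[OF T(1) x])
  then have "Q *\<^sub>v x = 2 \<cdot>\<^sub>v (T *\<^sub>v x) - x"
    unfolding Q_def using minus_mult_distrib_mat_vec[of "2 \<cdot>\<^sub>m T" m m "1\<^sub>m m" x] T(1) x by simp
  also have "\<dots> = 2 \<cdot>\<^sub>v (T *\<^sub>v x) - (T *\<^sub>v x - A *\<^sub>v (T *\<^sub>v x))"
    by (simp add: T_right[OF x])
  also have "\<dots> = T *\<^sub>v x + A *\<^sub>v (T *\<^sub>v x)"
    by (rule two_vec_minus[OF Tx ATx])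
  finally show ?thesis .
qed

lemma Q_spectrum:
  assumes "eigenvalue (cmat Q) z"
  shows "norm z < 1"
proof -
  obtain y where y: "y \<in> carrier_vec m" "y \<noteq> 0\<^sub>v m" "cmat Q *\<^sub>v y = z \<cdot>\<^sub>v y"
    using assms Q unfolding eigenvalue_def eigenvector_def by auto
  have cA: "cmat A \<in> carrier_mat m m" and cT: "cmat T \<in> carrier_mat m m"
    and cQ: "cmat Q \<in> carrier_mat m m"
    using A T Q by auto
  define w where "w = cmat T *\<^sub>v y"
  have w: "w \<in> carrier_vec m" using cT y by (simp add: w_def)
  have Aw: "cmat A *\<^sub>v w \<in> carrier_vec m" using cA w by simp
  have sub: "cmat (1\<^sub>m m - A) = 1\<^sub>m m - cmat A" using A by (auto intro!: eq_matI)
  have "(cmat (1\<^sub>m m - A) * cmat T) = 1\<^sub>m m"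
    using of_real_hom.mat_hom_mult[OF minus_carrier_mat[OF A] T(1), where 'a=complex] T(3)
    by (metis of_real_hom.mat_hom_one)
  then have yw: "y = w - cmat A *\<^sub>v w"
    using assoc_mult_mat_vec[OF minus_carrier_mat[OF cA, of "1\<^sub>m m"] cT y(1)] minus_mult_distrib_mat_vec[of "1\<^sub>m m" m m "cmat A" w] cA w y(1)
    unfolding sub w_def by simp
  have "cmat Q = 2 \<cdot>\<^sub>m cmat T - 1\<^sub>m m" using T(1) unfolding Q_def by (auto intro!: eq_matI)
  moreover have "(2 \<cdot>\<^sub>m cmat T) *\<^sub>v y = 2 \<cdot>\<^sub>v w"
    unfolding w_def by (rule smult_mat_mult_vec[OF cT y(1)])
  ultimately have "z \<cdot>\<^sub>v y = 2 \<cdot>\<^sub>v w - y"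
    using minus_mult_distrib_mat_vec[of "2 \<cdot>\<^sub>m cmat T" m m "1\<^sub>m m" y] cT y by simp
  then have e: "z * (w $ i - (cmat A *\<^sub>v w) $ i) = w $ i + (cmat A *\<^sub>v w) $ i" if "i < m" for i
    using smult_diff_entry[OF w Aw _ that] yw \<open>z \<cdot>\<^sub>v y = 2 \<cdot>\<^sub>v w - y\<close> by simp
  have w0: "w \<noteq> 0\<^sub>v m"
  proof
    assume "w = 0\<^sub>v m"
    then show False using yw y(2) mult_mat_zero_vec[OF cA] by simp
  qed
  have z1: "z + 1 \<noteq> 0"
  proof
    assume "z + 1 = 0"
    then have "z = - 1" by (simp add: add_eq_0_iff2)
    then have "w $ i = 0" if "i < m" for i using e[OF that] by (simp add: algebra_simps)
    then show False using w0 w by (auto simp: vec_eq_iff)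
  qed
  define s where "s = (z - 1) / (z + 1)"
  have "(cmat A *\<^sub>v w) $ i = s * w $ i" if "i < m" for i
    using e[OF that] z1 by (simp add: s_def field_simps del: index_mult_mat_vec)
  then have "cmat A *\<^sub>v w = s \<cdot>\<^sub>v w"
    by (intro eq_vecI) (use w Aw A in \<open>auto simp del: index_mult_mat_vec\<close>)
  then have "Re s < 0"
    using hurwitz w w0 A unfolding hurwitz_def eigenvalue_def eigenvector_def by auto
  moreover have "Re s = ((norm z)\<^sup>2 - 1) / (norm (z + 1))\<^sup>2"
    unfolding s_def Re_divide cmod_power2 by (simp add: power2_eq_square algebra_simps)
  ultimately have "(norm z)\<^sup>2 < 1"
    using z1 by (simp add: divide_less_0_iff)
  then show ?thesis by (simp add: power_less_one_iff abs_square_less_1)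
qed

lemma Q_decay: "\<exists>c r. 0 \<le> c \<and> 0 < r \<and> r < 1 \<and> (\<forall>k. \<forall>x \<in> carrier_vec m. vnorm (Q ^\<^sub>m k *\<^sub>v x) \<le> c * r ^ k * vnorm x)"
proof -
  obtain c r where c: "0 \<le> c" "0 < r" "r < 1"
    and bd: "\<And>k i j. i < m \<Longrightarrow> j < m \<Longrightarrow> norm ((cmat Q ^\<^sub>m k) $$ (i, j)) \<le> c * r ^ k"
    using spectrum_in_disc_imp_geometric_decay[of "cmat Q" m] Q_spectrum Q by auto
  have bd': "\<bar>(Q ^\<^sub>m k) $$ (i, j)\<bar> \<le> c * r ^ k" if "i < m" "j < m" for i j k
  proof -
    have "(cmat Q ^\<^sub>m k) $$ (i, j) = complex_of_real ((Q ^\<^sub>m k) $$ (i, j))"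
      unfolding of_real_hom.mat_hom_pow[OF Q, symmetric]
      by (rule map_mat_entry[OF pow_carrier_mat[OF Q] that])
    then show ?thesis using bd[OF that, of k] by simp
  qed
  have "vnorm (Q ^\<^sub>m k *\<^sub>v x) \<le> (real m * c) * r ^ k * vnorm x" if x: "x \<in> carrier_vec m" for k x
  proof -
    have Qk: "Q ^\<^sub>m k \<in> carrier_mat m m" using Q by simp
    have "\<bar>(Q ^\<^sub>m k *\<^sub>v x) $ i\<bar> \<le> c * r ^ k * vnorm x" if i: "i < m" for i
    proof -
      have "\<bar>(Q ^\<^sub>m k *\<^sub>v x) $ i\<bar> = \<bar>\<Sum>j<m. (Q ^\<^sub>m k) $$ (i, j) * x $ j\<bar>"
        by (simp only: mult_mat_vec_entry[OF Qk x i])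
      also have "\<dots> \<le> (\<Sum>j<m. \<bar>(Q ^\<^sub>m k) $$ (i, j)\<bar> * \<bar>x $ j\<bar>)"
        unfolding abs_mult[symmetric] by (rule sum_abs)
      also have "\<dots> \<le> (\<Sum>j<m. c * r ^ k * \<bar>x $ j\<bar>)"
        by (intro sum_mono mult_right_mono bd' i) auto
      also have "\<dots> = c * r ^ k * vnorm x" using x by (simp add: vnorm_def sum_distrib_left)
      finally show ?thesis .
    qed
    then have "(\<Sum>i<m. \<bar>(Q ^\<^sub>m k *\<^sub>v x) $ i\<bar>) \<le> (\<Sum>i<m. c * r ^ k * vnorm x)"
      by (intro sum_mono) blast
    moreover have d: "dim_vec (Q ^\<^sub>m k *\<^sub>v x) = m" using Q by simp
    have "vnorm (Q ^\<^sub>m k *\<^sub>v x) = (\<Sum>i<m. \<bar>(Q ^\<^sub>m k *\<^sub>v x) $ i\<bar>)"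
      unfolding vnorm_def d ..
    ultimately have "vnorm (Q ^\<^sub>m k *\<^sub>v x) \<le> (\<Sum>i<m. c * r ^ k * vnorm x)" by simp
    then show ?thesis by (simp add: mult.assoc)
  qed
  then show ?thesis using c by (intro exI[of _ "real m * c"] exI[of _ r]) auto
qed

end

section \<open>Trajectories and their supply\<close>

lemma bilinear_parallelogram:
  fixes y y' g g' :: "real vec"
  assumes "g \<in> carrier_vec n" "g' \<in> carrier_vec n" "y \<in> carrier_vec n" "y' \<in> carrier_vec n"
  shows "(g + g') \<bullet> (y + y') + (g - g') \<bullet> (y - y') = 2 * (g \<bullet> y) + 2 * (g' \<bullet> y')"
  using assms
  by (simp add: add_scalar_prod_distrib[of _ n] scalar_prod_add_distrib[of _ n]
      minus_scalar_prod_distrib[of _ n] scalar_prod_minus_distrib[of _ n])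

context linear_system
begin

lemma vel_add:
  "w \<in> carrier_vec m \<Longrightarrow> w' \<in> carrier_vec m \<Longrightarrow> u \<in> carrier_vec n \<Longrightarrow> u' \<in> carrier_vec n \<Longrightarrow>
   vel (w + w') (u + u') = vel w u + vel w' u'"
  unfolding vel_def mult_add_distrib_mat_vec[OF A] mult_add_distrib_mat_vec[OF B]
  by (rule eq_vecI) (use A B in \<open>auto simp del: index_mult_mat_vec\<close>)

lemma vel_diff:
  "w \<in> carrier_vec m \<Longrightarrow> w' \<in> carrier_vec m \<Longrightarrow> u \<in> carrier_vec n \<Longrightarrow> u' \<in> carrier_vec n \<Longrightarrow>
   vel (w - w') (u - u') = vel w u - vel w' u'"
  unfolding vel_def mult_minus_distrib_mat_vec[OF A] mult_minus_distrib_mat_vec[OF B]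
  by (rule eq_vecI) (use A B in \<open>auto simp del: index_mult_mat_vec\<close>)

lemma vel_smult:
  "w \<in> carrier_vec m \<Longrightarrow> u \<in> carrier_vec n \<Longrightarrow> vel (a \<cdot>\<^sub>v w) (a \<cdot>\<^sub>v u) = a \<cdot>\<^sub>v vel w u"
  unfolding vel_def mult_mat_vec[OF A] mult_mat_vec[OF B]
  by (rule eq_vecI) (use A B in \<open>auto simp: algebra_simps simp del: index_mult_mat_vec\<close>)

lemma vel_zero_input: "w \<in> carrier_vec m \<Longrightarrow> vel w (0\<^sub>v n) = A *\<^sub>v w"
  unfolding vel_def mult_mat_zero_vec[OF B] using A by (intro eq_vecI) auto

lemma vel_zero: "vel (0\<^sub>v m) (0\<^sub>v n) = 0\<^sub>v m"
  unfolding vel_def mult_mat_zero_vec[OF B] mult_mat_zero_vec[OF A] by (intro eq_vecI) auto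

text \<open>A trajectory of the implicit midpoint discretisation, indexed backwards in time: the state
  passes from \<open>x\<^sub>k\<^sub>+\<^sub>1 = w\<^sub>k - v\<^sub>k\<close> to \<open>x\<^sub>k = w\<^sub>k + v\<^sub>k\<close>, where \<open>v\<^sub>k = A w\<^sub>k + B u\<^sub>k\<close>.  It
  starts from rest, that is, \<open>w\<^sub>k\<close> and \<open>u\<^sub>k\<close> vanish for \<open>k \<ge> K\<close>.\<close>
definition traj :: "nat \<Rightarrow> (nat \<Rightarrow> real vec) \<Rightarrow> (nat \<Rightarrow> real vec) \<Rightarrow> bool"
  where "traj K w u \<longleftrightarrow> (\<forall>k. w k \<in> carrier_vec m \<and> u k \<in> carrier_vec n \<and>
    w k - vel (w k) (u k) = w (Suc k) + vel (w (Suc k)) (u (Suc k))) \<and>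
    (\<forall>k\<ge>K. w k = 0\<^sub>v m \<and> u k = 0\<^sub>v n)"

text \<open>The state \<open>x\<^sub>0\<close> that the trajectory reaches.\<close>
definition endpoint :: "(nat \<Rightarrow> real vec) \<Rightarrow> (nat \<Rightarrow> real vec) \<Rightarrow> real vec"
  where "endpoint w u = w 0 + vel (w 0) (u 0)"

text \<open>The total supply along a trajectory that is at rest for \<open>k \<ge> K\<close>.\<close>
definition supplied :: "nat \<Rightarrow> (nat \<Rightarrow> real vec) \<Rightarrow> (nat \<Rightarrow> real vec) \<Rightarrow> real"
  where "supplied K w u = (\<Sum>k<K. u k \<bullet> (C *\<^sub>v vel (w k) (u k)))"

lemma traj_carrier: "traj K w u \<Longrightarrow> w k \<in> carrier_vec m" "traj K w u \<Longrightarrow> u k \<in> carrier_vec n"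
  unfolding traj_def by auto

lemma endpoint_carrier: "traj K w u \<Longrightarrow> endpoint w u \<in> carrier_vec m"
  unfolding endpoint_def using traj_carrier by auto

lemma traj_mono: "traj K w u \<Longrightarrow> K \<le> K' \<Longrightarrow> traj K' w u"
  unfolding traj_def by auto

lemma supplied_mono:
  assumes t: "traj K w u" and K: "K \<le> K'"
  shows "supplied K' w u = supplied K w u"
proof -
  have "(\<Sum>k<K'. u k \<bullet> (C *\<^sub>v vel (w k) (u k))) = (\<Sum>k<K. u k \<bullet> (C *\<^sub>v vel (w k) (u k)))"
  proof (rule sum.mono_neutral_right)
    show "\<forall>i\<in>{..<K'} - {..<K}. u i \<bullet> (C *\<^sub>v vel (w i) (u i)) = 0"
    proof
      fix i assume "i \<in> {..<K'} - {..<K}"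
      then have "u i = 0\<^sub>v n" "w i = 0\<^sub>v m" using t unfolding traj_def by auto
      then show "u i \<bullet> (C *\<^sub>v vel (w i) (u i)) = 0"
        using C by (simp add: vel_zero mult_mat_zero_vec[OF C])
    qed
  qed (use K in auto)
  then show ?thesis unfolding supplied_def .
qed

lemma traj_add:
  assumes "traj K w u" "traj K w' u'"
  shows "traj K (\<lambda>k. w k + w' k) (\<lambda>k. u k + u' k)"
    and "endpoint (\<lambda>k. w k + w' k) (\<lambda>k. u k + u' k) = endpoint w u + endpoint w' u'"
proof -
  note c = traj_carrier[OF assms(1)] traj_carrier[OF assms(2)]
  have v: "vel (w k + w' k) (u k + u' k) = vel (w k) (u k) + vel (w' k) (u' k)" for k
    by (rule vel_add[OF c(1,3,2,4)])
  have vc: "vel (w k) (u k) \<in> carrier_vec m" "vel (w' k) (u' k) \<in> carrier_vec m" for k using c by auto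
  have swap: "(p + p') - (q + q') = (p - q) + (p' - q')" "(p + p') + (q + q') = (p + q) + (p' + q')"
    if "p \<in> carrier_vec m" "p' \<in> carrier_vec m" "q \<in> carrier_vec m" "q' \<in> carrier_vec m"
      for p p' q q' :: "real vec"
    by (rule eq_vecI; use that in auto)+
  show "traj K (\<lambda>k. w k + w' k) (\<lambda>k. u k + u' k)"
    using assms c unfolding traj_def v by (auto simp: swap[OF c(1) c(3) vc])
  show "endpoint (\<lambda>k. w k + w' k) (\<lambda>k. u k + u' k) = endpoint w u + endpoint w' u'"
    unfolding endpoint_def v by (rule swap(2)[OF c(1) c(3) vc])
qed

lemma traj_smult:
  assumes "traj K w u"
  shows "traj K (\<lambda>k. a \<cdot>\<^sub>v w k) (\<lambda>k. a \<cdot>\<^sub>v u k)"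
    and "endpoint (\<lambda>k. a \<cdot>\<^sub>v w k) (\<lambda>k. a \<cdot>\<^sub>v u k) = a \<cdot>\<^sub>v endpoint w u"
    and "supplied K (\<lambda>k. a \<cdot>\<^sub>v w k) (\<lambda>k. a \<cdot>\<^sub>v u k) = a\<^sup>2 * supplied K w u"
proof -
  note c = traj_carrier[OF assms]
  have v: "vel (a \<cdot>\<^sub>v w k) (a \<cdot>\<^sub>v u k) = a \<cdot>\<^sub>v vel (w k) (u k)" for k
    by (rule vel_smult[OF c])
  have vc: "vel (w k) (u k) \<in> carrier_vec m" for k using c by auto
  have dist: "a \<cdot>\<^sub>v p - a \<cdot>\<^sub>v q = a \<cdot>\<^sub>v (p - q)" "a \<cdot>\<^sub>v p + a \<cdot>\<^sub>v q = a \<cdot>\<^sub>v (p + q)"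
    if "p \<in> carrier_vec m" "q \<in> carrier_vec m" for p q :: "real vec"
    by (rule eq_vecI; use that in \<open>auto simp: algebra_simps\<close>)+
  show "traj K (\<lambda>k. a \<cdot>\<^sub>v w k) (\<lambda>k. a \<cdot>\<^sub>v u k)"
    using assms c unfolding traj_def v by (auto simp: dist[OF c(1) vc] intro!: eq_vecI)
  show "endpoint (\<lambda>k. a \<cdot>\<^sub>v w k) (\<lambda>k. a \<cdot>\<^sub>v u k) = a \<cdot>\<^sub>v endpoint w u"
    unfolding endpoint_def v by (rule dist(2)[OF c(1) vc])
  have "(a \<cdot>\<^sub>v u k) \<bullet> (C *\<^sub>v (a \<cdot>\<^sub>v vel (w k) (u k))) = a\<^sup>2 * (u k \<bullet> (C *\<^sub>v vel (w k) (u k)))" for k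
    unfolding mult_mat_vec[OF C vc] power2_eq_square
    using smult_scalar_prod_distrib[OF c(2) smult_carrier_vec[THEN iffD2, OF mult_mat_vec_carrier[OF C vc]]]
      scalar_prod_smult_distrib[OF c(2) mult_mat_vec_carrier[OF C vc]] by (simp add: mult.assoc)
  then show "supplied K (\<lambda>k. a \<cdot>\<^sub>v w k) (\<lambda>k. a \<cdot>\<^sub>v u k) = a\<^sup>2 * supplied K w u"
    unfolding supplied_def v sum_distrib_left by (intro sum.cong) auto
qed

lemma traj_diff:
  assumes "traj K w u" "traj K w' u'"
  shows "traj K (\<lambda>k. w k - w' k) (\<lambda>k. u k - u' k)"
    and "endpoint (\<lambda>k. w k - w' k) (\<lambda>k. u k - u' k) = endpoint w u - endpoint w' u'"
proof -
  note c = traj_carrier[OF assms(1)] traj_carrier[OF assms(2)]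
  have v: "vel (w k - w' k) (u k - u' k) = vel (w k) (u k) - vel (w' k) (u' k)" for k
    by (rule vel_diff[OF c(1,3,2,4)])
  have vc: "vel (w k) (u k) \<in> carrier_vec m" "vel (w' k) (u' k) \<in> carrier_vec m" for k using c by auto
  have swap: "(p - p') - (q - q') = (p - q) - (p' - q')" "(p - p') + (q - q') = (p + q) - (p' + q')"
    if "p \<in> carrier_vec m" "p' \<in> carrier_vec m" "q \<in> carrier_vec m" "q' \<in> carrier_vec m"
      for p p' q q' :: "real vec"
    by (rule eq_vecI; use that in auto)+
  show "traj K (\<lambda>k. w k - w' k) (\<lambda>k. u k - u' k)"
    using assms c unfolding traj_def v by (auto simp: swap[OF c(1) c(3) vc])
  show "endpoint (\<lambda>k. w k - w' k) (\<lambda>k. u k - u' k) = endpoint w u - endpoint w' u'"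
    unfolding endpoint_def v by (rule swap(2)[OF c(1) c(3) vc])
qed

lemma supplied_parallelogram:
  assumes "traj K w u" "traj K w' u'"
  shows "supplied K (\<lambda>k. w k + w' k) (\<lambda>k. u k + u' k) + supplied K (\<lambda>k. w k - w' k) (\<lambda>k. u k - u' k)
    = 2 * supplied K w u + 2 * supplied K w' u'"
proof -
  note c = traj_carrier[OF assms(1)] traj_carrier[OF assms(2)]
  have vc: "vel (w k) (u k) \<in> carrier_vec m" "vel (w' k) (u' k) \<in> carrier_vec m" for k using c by auto
  have "(u k + u' k) \<bullet> (C *\<^sub>v vel (w k + w' k) (u k + u' k)) + (u k - u' k) \<bullet> (C *\<^sub>v vel (w k - w' k) (u k - u' k))
     = 2 * (u k \<bullet> (C *\<^sub>v vel (w k) (u k))) + 2 * (u' k \<bullet> (C *\<^sub>v vel (w' k) (u' k)))" for k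
    unfolding vel_add[OF c(1,3,2,4)] vel_diff[OF c(1,3,2,4)] 
      mult_add_distrib_mat_vec[OF C vc] mult_minus_distrib_mat_vec[OF C vc]
    by (rule bilinear_parallelogram[OF c(2,4) mult_mat_vec_carrier[OF C vc(1)] mult_mat_vec_carrier[OF C vc(2)]])
  then show ?thesis
    unfolding supplied_def sum_distrib_left sum.distrib[symmetric] by (intro sum.cong refl)
qed

text \<open>Appending one step, with midpoint \<open>w0\<close> and input \<open>g\<close>.\<close>
lemma traj_step:
  assumes t: "traj K w u" and w0: "w0 \<in> carrier_vec m" and g: "g \<in> carrier_vec n"
    and e: "w0 - vel w0 g = endpoint w u"
  shows "traj (Suc K) (case_nat w0 w) (case_nat g u)"
    and "endpoint (case_nat w0 w) (case_nat g u) = w0 + vel w0 g"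
    and "supplied (Suc K) (case_nat w0 w) (case_nat g u) = g \<bullet> (C *\<^sub>v vel w0 g) + supplied K w u"
proof -
  show "traj (Suc K) (case_nat w0 w) (case_nat g u)"
    using t w0 g e unfolding traj_def endpoint_def by (auto split: nat.split simp: Suc_le_eq)
  show "endpoint (case_nat w0 w) (case_nat g u) = w0 + vel w0 g"
    by (simp add: endpoint_def)
  show "supplied (Suc K) (case_nat w0 w) (case_nat g u) = g \<bullet> (C *\<^sub>v vel w0 g) + supplied K w u"
    unfolding supplied_def sum.lessThan_Suc_shift by simp
qed

lemma traj_rest: "traj 0 (\<lambda>_. 0\<^sub>v m) (\<lambda>_. 0\<^sub>v n)" "endpoint (\<lambda>_. 0\<^sub>v m) (\<lambda>_. 0\<^sub>v n) = 0\<^sub>v m"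
  "supplied 0 w u = 0"
  by (auto simp: traj_def endpoint_def supplied_def vel_zero)

end

context stable_system
begin

text \<open>The free motion \<open>y\<close> of the discretised system through \<open>x\<close>, with midpoints \<open>T y\<^sub>k\<close>.\<close>
lemma pow_Q_vec:
  assumes x: "x \<in> carrier_vec m"
  defines "y \<equiv> \<lambda>k. Q ^\<^sub>m k *\<^sub>v x"
  shows "y k \<in> carrier_vec m" "T *\<^sub>v y k \<in> carrier_vec m" "A *\<^sub>v (T *\<^sub>v y k) \<in> carrier_vec m"
    "T *\<^sub>v y k - A *\<^sub>v (T *\<^sub>v y k) = y k" "T *\<^sub>v y k + A *\<^sub>v (T *\<^sub>v y k) = y (Suc k)" "y 0 = x"
    "y (k + l) = Q ^\<^sub>m k *\<^sub>v y l"
proof -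
  show y: "y k \<in> carrier_vec m" for k
    unfolding y_def using Q x by (metis mult_mat_vec_carrier pow_carrier_mat)
  show "T *\<^sub>v y k \<in> carrier_vec m" using T(1) y by simp
  then show "A *\<^sub>v (T *\<^sub>v y k) \<in> carrier_vec m" using A by simp
  show "T *\<^sub>v y k - A *\<^sub>v (T *\<^sub>v y k) = y k" by (rule T_right[OF y])
  have Suc: "y (Suc k) = Q *\<^sub>v y k" for k
    unfolding y_def pow_mat.simps(2) pow_mat_commute[OF Q] by (rule assoc_mult_mat_vec[OF Q pow_carrier_mat[OF Q] x])
  then show "T *\<^sub>v y k + A *\<^sub>v (T *\<^sub>v y k) = y (Suc k)" using Q_vec[OF y] by simp
  show y0: "y 0 = x" unfolding y_def using Q x by simp
  show "y (k + l) = Q ^\<^sub>m k *\<^sub>v y l"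
  proof (induction k)
    case 0 then show ?case using y[of l] Q by simp
  next
    case (Suc k)
    have "y (Suc k + l) = Q *\<^sub>v (Q ^\<^sub>m k *\<^sub>v y l)"
      using Suc \<open>y (Suc (k + l)) = Q *\<^sub>v y (k + l)\<close> by simp
    then show ?case unfolding pow_mat.simps(2) pow_mat_commute[OF Q]
      using assoc_mult_mat_vec[OF Q pow_carrier_mat[OF Q] y[of l]] by simp
  qed
qed

text \<open>For large \<open>N\<close> the map \<open>e \<mapsto> Q\<^sup>N e + f\<close> at least halves distances, which bounds its fixed point.\<close>
lemma affine_fixed_point:
  "\<exists>N0. \<forall>N\<ge>N0. \<forall>f \<in> carrier_vec m. \<exists>e \<in> carrier_vec m. e = Q ^\<^sub>m N *\<^sub>v e + f \<and> vnorm e \<le> 2 * vnorm f"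
proof -
  obtain c r where cr: "0 \<le> c" "0 < r" "r < 1"
    and decay: "\<And>k x. x \<in> carrier_vec m \<Longrightarrow> vnorm (Q ^\<^sub>m k *\<^sub>v x) \<le> c * r ^ k * vnorm x"
    using Q_decay by blast
  have "(\<lambda>k. c * r ^ k) \<longlonglongrightarrow> c * 0" using cr
    by (intro tendsto_mult tendsto_const LIMSEQ_power_zero) auto
  then have "\<forall>\<^sub>F k in sequentially. c * r ^ k < 1 / 2" by (rule order_tendstoD(2)) simp
  then obtain N0 where N0: "\<And>N. N \<ge> N0 \<Longrightarrow> c * r ^ N < 1 / 2"
    unfolding eventually_sequentially by blast
  have half: "vnorm (Q ^\<^sub>m N *\<^sub>v x) \<le> vnorm x / 2" if "N \<ge> N0" "x \<in> carrier_vec m" for N x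
    using decay[OF that(2), of N] mult_right_mono[OF less_imp_le[OF N0[OF that(1)]] vnorm_nonneg[of x]] by simp
  have "\<exists>e \<in> carrier_vec m. e = Q ^\<^sub>m N *\<^sub>v e + f \<and> vnorm e \<le> 2 * vnorm f"
    if N: "N \<ge> N0" and f: "f \<in> carrier_vec m" for N f
  proof -
    have P: "Q ^\<^sub>m N \<in> carrier_mat m m" using Q by simp
    have M: "1\<^sub>m m - Q ^\<^sub>m N \<in> carrier_mat m m" by (rule minus_carrier_mat[OF P])
    have Mv: "(1\<^sub>m m - Q ^\<^sub>m N) *\<^sub>v v = v - Q ^\<^sub>m N *\<^sub>v v" if "v \<in> carrier_vec m"
      for v
      using minus_mult_distrib_mat_vec[OF one_carrier_mat P that] that by simp
    have "\<exists>R \<in> carrier_mat m m. R * (1\<^sub>m m - Q ^\<^sub>m N) = 1\<^sub>m m \<and> (1\<^sub>m m - Q ^\<^sub>m N) * R = 1\<^sub>m m"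
    proof (rule invertible_if_kernel_trivial[OF M])
      fix v assume v: "v \<in> carrier_vec m" and "(1\<^sub>m m - Q ^\<^sub>m N) *\<^sub>v v = 0\<^sub>v m"
      then have 0: "v - Q ^\<^sub>m N *\<^sub>v v = 0\<^sub>v m" using Mv by simp
      have "Q ^\<^sub>m N *\<^sub>v v \<in> carrier_vec m" by (rule mult_mat_vec_carrier[OF P v])
      with 0 v have "Q ^\<^sub>m N *\<^sub>v v = v" by (auto simp: vec_eq_iff simp del: index_mult_mat_vec)
      then have "vnorm v \<le> vnorm v / 2" using half[OF N v] by simp
      then show "v = 0\<^sub>v m" using vnorm_zero_imp[OF v] vnorm_nonneg[of v] by simp
    qed
    then obtain R where R: "R \<in> carrier_mat m m" "(1\<^sub>m m - Q ^\<^sub>m N) * R = 1\<^sub>m m" by blast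
    define e where "e = R *\<^sub>v f"
    have e: "e \<in> carrier_vec m" using R f by (simp add: e_def)
    have Pe: "Q ^\<^sub>m N *\<^sub>v e \<in> carrier_vec m" by (rule mult_mat_vec_carrier[OF P e])
    have "e - Q ^\<^sub>m N *\<^sub>v e = f"
      using Mv[OF e] assoc_mult_mat_vec[OF M R(1) f] R(2) f unfolding e_def by simp
    with e Pe f have eq: "e = Q ^\<^sub>m N *\<^sub>v e + f" by (auto simp: vec_eq_iff simp del: index_mult_mat_vec)
    have "vnorm e \<le> vnorm e / 2 + vnorm f"
      using vnorm_triangle[OF Pe f] half[OF N e] eq by simp
    with eq e show ?thesis by auto
  qed
  then show ?thesis by blast
qed

text \<open>To make a trajectory from rest periodic with period \<open>M + K\<close>, let it run on freely for \<open>M\<close>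
  steps and add the free motion that starts at the state \<open>e\<close>, chosen so that the sum ends at \<open>e\<close>
  again.  The second summand in the conclusion is the change in the supply.\<close>
lemma supplied_periodic_correction:
  assumes fp: "freq_passive A B C" and t: "traj K w u" and odd: "odd (M + K)"
    and e: "e \<in> carrier_vec m" "e = Q ^\<^sub>m (M + K) *\<^sub>v e + Q ^\<^sub>m M *\<^sub>v endpoint w u"
  shows "0 \<le> supplied K w u + (\<Sum>j<K. u j \<bullet> (C *\<^sub>v (A *\<^sub>v (T *\<^sub>v (Q ^\<^sub>m (K - 1 - j) *\<^sub>v e)))))"
proof -
  define N where "N = M + K"
  define p where "p = endpoint w u"
  have p: "p \<in> carrier_vec m" unfolding p_def by (rule endpoint_carrier[OF t])
  note c = traj_carrier[OF t]
  note P = pow_Q_vec[OF p] and E = pow_Q_vec[OF e(1)]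
  \<comment> \<open>Midpoints \<open>b\<close>, inputs \<open>U\<close> and states \<open>y\<close> of the prolonged trajectory, and midpoints \<open>h\<close>
    of the added free motion; the index still runs backwards in time.\<close>
  define b where "b k = (if k < M then T *\<^sub>v (Q ^\<^sub>m (M - 1 - k) *\<^sub>v p) else w (k - M))" for k
  define U where "U k = (if k < M then 0\<^sub>v n else u (k - M))" for k
  define h where "h k = T *\<^sub>v (Q ^\<^sub>m (N - 1 - k) *\<^sub>v e)" for k
  define y where "y k = (if k \<le> M then Q ^\<^sub>m (M - k) *\<^sub>v p else w (k - M) + vel (w (k - M)) (u (k - M)))" for k
  define W where "W k = b k + h k" for k
  define V where "V k = vel (b k) (U k) + A *\<^sub>v h k" for k
  have bc: "b k \<in> carrier_vec m" for k using P(2) c(1) by (simp add: b_def)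
  have Uc: "U k \<in> carrier_vec n" for k using c(2) by (simp add: U_def)
  have hc: "h k \<in> carrier_vec m" "A *\<^sub>v h k \<in> carrier_vec m" for k using E(2,3) by (simp_all add: h_def)
  have vc: "vel (b k) (U k) \<in> carrier_vec m" for k using bc Uc by simp
  have b_plus: "b k + vel (b k) (U k) = y k" if "k < N" for k
  proof (cases "k < M")
    case True
    then have "Suc (M - 1 - k) = M - k" by simp
    then show ?thesis using True P(5)[of "M - 1 - k"] bc[of k]
      by (simp add: b_def U_def y_def vel_zero_input[OF P(2)])
  next
    case False
    then show ?thesis
    proof (cases "k = M")
      case True
      then show ?thesis using P(6) by (simp add: b_def U_def y_def p_def endpoint_def)
    qed (simp add: b_def U_def y_def)
  qed
  have b_minus: "b k - vel (b k) (U k) = y (Suc k)" if "k < N" for k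
  proof (cases "k < M")
    case True
    then have "M - 1 - k = M - Suc k" by simp
    then show ?thesis using True P(4)[of "M - 1 - k"] bc[of k]
      by (simp add: b_def U_def y_def vel_zero_input[OF P(2)])
  next
    case False
    then show ?thesis using t unfolding traj_def by (simp add: b_def U_def y_def Suc_diff_le)
  qed
  have h_plus: "h k + A *\<^sub>v h k = Q ^\<^sub>m (N - k) *\<^sub>v e"
    and h_minus: "h k - A *\<^sub>v h k = Q ^\<^sub>m (N - Suc k) *\<^sub>v e"
    if "k < N" for k
  proof -
    have "Suc (N - 1 - k) = N - k" "N - 1 - k = N - Suc k" using that by auto
    then show "h k + A *\<^sub>v h k = Q ^\<^sub>m (N - k) *\<^sub>v e" "h k - A *\<^sub>v h k = Q ^\<^sub>m (N - Suc k) *\<^sub>v e"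
      using E(4,5)[of "N - 1 - k"] by (simp_all add: h_def)
  qed
  have swap: "(a + a') - (d + d') = (a - d) + (a' - d')" "(a + a') + (d + d') = (a + d) + (a' + d')"
    if "a \<in> carrier_vec m" "a' \<in> carrier_vec m" "d \<in> carrier_vec m" "d' \<in> carrier_vec m"
      for a a' d d' :: "real vec"
    by (rule eq_vecI; use that in auto)+
  have plus: "W k + V k = y k + Q ^\<^sub>m (N - k) *\<^sub>v e"
    and minus: "W k - V k = y (Suc k) + Q ^\<^sub>m (N - Suc k) *\<^sub>v e"
    if "k < N" for k
    unfolding W_def V_def swap[OF bc hc(1) vc hc(2)] b_plus[OF that] b_minus[OF that] h_plus[OF that] h_minus[OF that]
    by simp_all
  have "y N = 0\<^sub>v m"
  proof -
    have "w K = 0\<^sub>v m" "u K = 0\<^sub>v n" using t unfolding traj_def by auto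
    then show ?thesis using P(6) by (cases "K = 0") (auto simp: y_def N_def p_def endpoint_def vel_zero)
  qed
  moreover have "y 0 + Q ^\<^sub>m N *\<^sub>v e = e"
    using e(2) comm_add_vec[OF P(1) E(1)] unfolding N_def p_def y_def by simp
  ultimately have close: "y N + Q ^\<^sub>m (N - N) *\<^sub>v e = y 0 + Q ^\<^sub>m (N - 0) *\<^sub>v e"
    using E(6) e(1) by simp
  have per: "W k - V k = W (Suc k mod N) + V (Suc k mod N)" if "k < N" for k
  proof (cases "Suc k = N")
    case True
    then have "W (Suc k mod N) + V (Suc k mod N) = y 0 + Q ^\<^sub>m (N - 0) *\<^sub>v e" using plus[of 0] by simp
    then show ?thesis using minus[OF that] close True by simp
  next
    case False
    then have "Suc k < N" using that by simp
    then show ?thesis using plus[of "Suc k"] minus[OF that] by simp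
  qed
  have V: "V k = A *\<^sub>v W k + B *\<^sub>v U k" for k
    unfolding V_def W_def vel_def mult_add_distrib_mat_vec[OF A bc hc(1)]
    by (rule eq_vecI) (use A B in \<open>auto simp del: index_mult_mat_vec\<close>)
  have Wc: "W k \<in> carrier_vec m" for k using bc hc by (simp add: W_def)
  have "0 \<le> (\<Sum>k<N. U k \<bullet> (C *\<^sub>v V k))"
    by (rule periodic_supply_nonneg[where w = W and u = U and v = V, OF A B C fp odd[folded N_def] Wc Uc V per])
  also have "(\<Sum>k<N. U k \<bullet> (C *\<^sub>v V k)) = (\<Sum>k<M. U k \<bullet> (C *\<^sub>v V k)) + (\<Sum>j<K. U (j + M) \<bullet> (C *\<^sub>v V (j + M)))"
  proof -
    have "(\<Sum>k<N. U k \<bullet> (C *\<^sub>v V k)) = (\<Sum>k=0..<M. U k \<bullet> (C *\<^sub>v V k)) + (\<Sum>k=M..<M+K. U k \<bullet> (C *\<^sub>v V k))"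
      unfolding N_def lessThan_atLeast0 by (rule sum.atLeastLessThan_concat[symmetric]) auto
    also have "(\<Sum>k=M..<M+K. U k \<bullet> (C *\<^sub>v V k)) = (\<Sum>j=0..<K. U (j + M) \<bullet> (C *\<^sub>v V (j + M)))"
      using sum.shift_bounds_nat_ivl[of "\<lambda>k. U k \<bullet> (C *\<^sub>v V k)" 0 M K]
        by (simp add: add.commute)
    finally show ?thesis unfolding lessThan_atLeast0 .
  qed
  also have "(\<Sum>k<M. U k \<bullet> (C *\<^sub>v V k)) = 0"
  proof (rule sum.neutral, rule ballI)
    fix k assume "k \<in> {..<M}"
    then have "U k = 0\<^sub>v n" by (simp add: U_def)
    moreover have "C *\<^sub>v V k \<in> carrier_vec n" using C vc hc by (simp add: V_def)
    ultimately show "U k \<bullet> (C *\<^sub>v V k) = 0" by simp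
  qed
  also have "(\<Sum>j<K. U (j + M) \<bullet> (C *\<^sub>v V (j + M))) 
    = (\<Sum>j<K. u j \<bullet> (C *\<^sub>v vel (w j) (u j)) + u j \<bullet> (C *\<^sub>v (A *\<^sub>v (T *\<^sub>v (Q ^\<^sub>m (K - 1 - j) *\<^sub>v e)))))"
  proof (rule sum.cong[OF refl])
    fix j assume "j \<in> {..<K}"
    then have "N - 1 - (j + M) = K - 1 - j" by (simp add: N_def)
    then have Vj: "V (j + M) = vel (w j) (u j) + A *\<^sub>v (T *\<^sub>v (Q ^\<^sub>m (K - 1 - j) *\<^sub>v e))"
      by (simp add: V_def b_def U_def h_def)
    have vj: "vel (w j) (u j) \<in> carrier_vec m" using c by simp
    have "U (j + M) = u j" by (simp add: U_def)
    then show "U (j + M) \<bullet> (C *\<^sub>v V (j + M)) = u j \<bullet> (C *\<^sub>v vel (w j) (u j)) + u j \<bullet> (C *\<^sub>v (A *\<^sub>v (T *\<^sub>v (Q ^\<^sub>m (K - 1 - j) *\<^sub>v e))))"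
      unfolding Vj mult_add_distrib_mat_vec[OF C vj E(3)]
      using scalar_prod_add_distrib[OF c(2) mult_mat_vec_carrier[OF C vj] mult_mat_vec_carrier[OF C E(3)]] by simp
  qed
  finally show ?thesis unfolding supplied_def sum.distrib by simp
qed

text \<open>The free motion decays, so the state \<open>e\<close> that closes the loop, and with it the change in the
  supply, tends to 0 as \<open>M\<close> grows.\<close>
lemma supplied_nonneg:
  assumes fp: "freq_passive A B C" and t: "traj K w u"
  shows "0 \<le> supplied K w u"
proof (rule ccontr)
  assume neg: "\<not> 0 \<le> supplied K w u"
  note c = traj_carrier[OF t]
  define p where "p = endpoint w u"
  have p: "p \<in> carrier_vec m" unfolding p_def by (rule endpoint_carrier[OF t])
  define G where "G j = (C * (A * (T * Q ^\<^sub>m (K - 1 - j))))\<^sup>T *\<^sub>v u j" for j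
  have CT: "C * (A * (T * Q ^\<^sub>m k)) \<in> carrier_mat n m" for k using A C T(1) Q by simp
  have G: "G j \<in> carrier_vec m" for j
    unfolding G_def by (rule mult_mat_vec_carrier[OF transpose_carrier_mat[THEN iffD2, OF CT] c(2)])
  define \<kappa> where "\<kappa> = (\<Sum>j<K. vnorm (G j))"
  have \<kappa>: "0 \<le> \<kappa>" unfolding \<kappa>_def by (intro sum_nonneg vnorm_nonneg)
  have bound: "(\<Sum>j<K. u j \<bullet> (C *\<^sub>v (A *\<^sub>v (T *\<^sub>v (Q ^\<^sub>m (K - 1 - j) *\<^sub>v e))))) \<le> \<kappa> * vnorm e"
    if e: "e \<in> carrier_vec m" for e
  proof -
    note E = pow_Q_vec[OF e]
    have "u j \<bullet> (C *\<^sub>v (A *\<^sub>v (T *\<^sub>v (Q ^\<^sub>m (K - 1 - j) *\<^sub>v e)))) \<le> vnorm (G j) * vnorm e" for j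
    proof -
      have Qk: "Q ^\<^sub>m (K - 1 - j) \<in> carrier_mat m m" using Q by simp
      have "C *\<^sub>v (A *\<^sub>v (T *\<^sub>v (Q ^\<^sub>m (K - 1 - j) *\<^sub>v e))) = (C * (A * (T * Q ^\<^sub>m (K - 1 - j)))) *\<^sub>v e"
        using assoc_mult_mat_vec[OF T(1) Qk e] assoc_mult_mat_vec[OF A mult_carrier_mat[OF T(1) Qk] e]
          assoc_mult_mat_vec[OF C mult_carrier_mat[OF A mult_carrier_mat[OF T(1) Qk]] e] by simp
      moreover have "u j \<bullet> ((C * (A * (T * Q ^\<^sub>m (K - 1 - j)))) *\<^sub>v e) = G j \<bullet> e"
        unfolding G_def using transpose_vec_mult_scalar[OF CT e c(2)] by simp
      ultimately show ?thesis using scalar_prod_le_vnorm[OF G e, of j] by simp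
    qed
    then show ?thesis unfolding \<kappa>_def sum_distrib_right by (intro sum_mono) auto
  qed
  obtain N0 where N0: "\<And>N f. N \<ge> N0 \<Longrightarrow> f \<in> carrier_vec m \<Longrightarrow> \<exists>e \<in> carrier_vec m. e = Q ^\<^sub>m N *\<^sub>v e + f \<and> vnorm e \<le> 2 * vnorm f"
    using affine_fixed_point by blast
  obtain d r where dr: "0 \<le> d" "0 < r" "r < 1"
    and decay: "\<And>k x. x \<in> carrier_vec m \<Longrightarrow> vnorm (Q ^\<^sub>m k *\<^sub>v x) \<le> d * r ^ k * vnorm x"
    using Q_decay by blast
  have "(\<lambda>k. \<kappa> * (2 * (d * r ^ k * vnorm p))) \<longlonglongrightarrow> \<kappa> * (2 * (d * 0 * vnorm p))"
    using dr by (intro tendsto_mult tendsto_const LIMSEQ_power_zero) auto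
  then have "\<forall>\<^sub>F k in sequentially. \<kappa> * (2 * (d * r ^ k * vnorm p)) < - supplied K w u"
    by (rule order_tendstoD(2)) (use neg in simp)
  then obtain M0 where M0: "\<And>k. k \<ge> M0 \<Longrightarrow> \<kappa> * (2 * (d * r ^ k * vnorm p)) < - supplied K w u"
    unfolding eventually_sequentially by blast
  define M where "M = 2 * (M0 + N0) + K + 1"
  have M: "M \<ge> M0" "M + K \<ge> N0" "odd (M + K)" by (auto simp: M_def)
  obtain e where e: "e \<in> carrier_vec m" "e = Q ^\<^sub>m (M + K) *\<^sub>v e + Q ^\<^sub>m M *\<^sub>v p" "vnorm e \<le> 2 * vnorm (Q ^\<^sub>m M *\<^sub>v p)"
    using N0[OF M(2) pow_Q_vec(1)[OF p]] by blast
  have "0 \<le> supplied K w u + \<kappa> * vnorm e"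
    using supplied_periodic_correction[OF fp t M(3) e(1) e(2)[unfolded p_def]] bound[OF e(1)] by linarith
  also have "\<kappa> * vnorm e \<le> \<kappa> * (2 * (d * r ^ M * vnorm p))"
    using e(3) decay[OF p, of M] \<kappa> by (intro mult_left_mono) auto
  finally show False using M0[OF M(1)] by simp
qed

end

section \<open>Reachability and the storage function\<close>

text \<open>The vector \<open>c\<^sub>0 x + c\<^sub>1 T x + c\<^sub>2 T\<^sup>2 x + \<dots>\<close> in Horner form.\<close>
fun krylov_comb :: "real mat \<Rightarrow> real vec \<Rightarrow> real list \<Rightarrow> real vec" where
  "krylov_comb T x [] = 0\<^sub>v (dim_row T)"
| "krylov_comb T x (c # cs) = c \<cdot>\<^sub>v x + T *\<^sub>v krylov_comb T x cs"

lemma krylov_comb_carrier: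
  assumes "T \<in> carrier_mat m m" "x \<in> carrier_vec m"
  shows "krylov_comb T x cs \<in> carrier_vec m"
  using assms by (induction cs) auto

lemma add_smult_entry:
  fixes p q :: "real vec"
  shows "q \<in> carrier_vec d \<Longrightarrow> p \<in> carrier_vec d \<Longrightarrow> i < d \<Longrightarrow> (c \<cdot>\<^sub>v p + q) $ i = c * p $ i + q $ i"
  by simp

lemma diff_eq_add_entry:
  fixes a b p q :: "real vec"
  assumes e: "a - b = p + q" and c: "b \<in> carrier_vec d" "q \<in> carrier_vec d" and i: "i < d"
  shows "a $ i - b $ i = p $ i + q $ i"
  using arg_cong[OF e, of "\<lambda>z. z $ i"] c i by simp

lemma krylov_comb_entry:
  assumes T: "T \<in> carrier_mat m m" and x: "x \<in> carrier_vec m" and i: "i < m"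
  shows "(T ^\<^sub>m k *\<^sub>v krylov_comb T x cs) $ i = (\<Sum>j<length cs. cs ! j * (T ^\<^sub>m (k + j) *\<^sub>v x) $ i)"
proof (induction cs arbitrary: k)
  case Nil
  have Tk: "T ^\<^sub>m k \<in> carrier_mat m m" using T by simp
  show ?case using T mult_mat_zero_vec[OF Tk] i by simp
next
  case (Cons c cs)
  define y where "y = krylov_comb T x cs"
  have y: "y \<in> carrier_vec m" unfolding y_def by (rule krylov_comb_carrier[OF T x])
  have Tk: "T ^\<^sub>m k \<in> carrier_mat m m" using T by simp
  have Ty: "T *\<^sub>v y \<in> carrier_vec m" using T y by simp
  have "T ^\<^sub>m k *\<^sub>v krylov_comb T x (c # cs) = c \<cdot>\<^sub>v (T ^\<^sub>m k *\<^sub>v x) + T ^\<^sub>m Suc k *\<^sub>v y"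
    using mult_add_distrib_mat_vec[OF Tk _ Ty, of "c \<cdot>\<^sub>v x"] mult_mat_vec[OF Tk x] assoc_mult_mat_vec[OF Tk T y] x
    unfolding y_def by simp
  moreover have "T ^\<^sub>m Suc k *\<^sub>v y \<in> carrier_vec m" "T ^\<^sub>m k *\<^sub>v x \<in> carrier_vec m"
    using mult_mat_vec_carrier[OF Tk x] mult_mat_vec_carrier[OF pow_carrier_mat[OF T, of "Suc k"] y] by auto
  ultimately have "(T ^\<^sub>m k *\<^sub>v krylov_comb T x (c # cs)) $ i = c * (T ^\<^sub>m k *\<^sub>v x) $ i + (T ^\<^sub>m Suc k *\<^sub>v y) $ i"
    using add_smult_entry i by metis
  then show ?case unfolding y_def Cons.IH
    by (simp add: sum.lessThan_Suc_shift del: index_mult_mat_vec pow_mat.simps sum.lessThan_Suc)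
qed

text \<open>The \<open>m + 1\<close> vectors \<open>x, T x, \<dots>, T\<^sup>m x\<close> in \<open>\<real>\<^sup>m\<close> are linearly dependent.\<close>
lemma krylov_dependent:
  assumes T: "T \<in> carrier_mat m m" and x: "x \<in> carrier_vec m"
  shows "\<exists>cs. krylov_comb T x cs = 0\<^sub>v m \<and> (\<exists>c \<in> set cs. c \<noteq> 0)"
proof -
  define M where "M = mat (Suc m) (Suc m) (\<lambda>(i, j). if i < m then (T ^\<^sub>m j *\<^sub>v x) $ i else 0)"
  have M: "M \<in> carrier_mat (Suc m) (Suc m)" by (simp add: M_def)
  have MT: "M\<^sup>T \<in> carrier_mat (Suc m) (Suc m)" using M by simp
  \<comment> \<open>The last row of \<open>M\<close> is zero.\<close>
  have "M\<^sup>T *\<^sub>v unit_vec (Suc m) m = 0\<^sub>v (Suc m)" by (rule eq_vecI) (auto simp: M_def)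
  moreover have "unit_vec (Suc m) m \<noteq> (0\<^sub>v (Suc m) :: real vec)" by simp
  ultimately have "det M\<^sup>T = 0" using det_0_iff_vec_prod_zero_field[OF MT] unit_vec_carrier by blast
  then have "det M = 0" using det_transpose[OF M] by simp
  then obtain v where v: "v \<in> carrier_vec (Suc m)" "v \<noteq> 0\<^sub>v (Suc m)" "M *\<^sub>v v = 0\<^sub>v (Suc m)"
    using det_0_iff_vec_prod_zero_field[OF M] by auto
  define cs where "cs = list_of_vec v"
  have len: "length cs = Suc m" and nth: "\<And>j. j < Suc m \<Longrightarrow> cs ! j = v $ j"
    using v(1) by (auto simp: cs_def list_of_vec_index)
  have "(krylov_comb T x cs) $ i = 0" if i: "i < m" for i
  proof -
    have "(krylov_comb T x cs) $ i = (T ^\<^sub>m 0 *\<^sub>v krylov_comb T x cs) $ i"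
      using T krylov_comb_carrier[OF T x] by (metis carrier_matD(1) one_mult_mat_vec pow_mat.simps(1))
    also have "\<dots> = (\<Sum>j<Suc m. M $$ (i, j) * v $ j)"
      unfolding krylov_comb_entry[OF T x i] len using i
      by (intro sum.cong refl) (simp add: nth M_def del: index_mult_mat_vec)
    also have "\<dots> = (M *\<^sub>v v) $ i" using i by (subst mult_mat_vec_entry[OF M v(1)]) auto
    finally show ?thesis using v(3) i by simp
  qed
  then have "krylov_comb T x cs = 0\<^sub>v m"
    using krylov_comb_carrier[OF T x] by (intro eq_vecI) auto
  moreover have "\<exists>c \<in> set cs. c \<noteq> 0"
  proof (rule ccontr)
    assume "\<not> (\<exists>c \<in> set cs. c \<noteq> 0)"
    then have "v $ j = 0" if "j < Suc m" for j using nth[OF that] that len nth_mem[of j cs] by auto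
    then show False using v(1,2) by (auto simp: vec_eq_iff)
  qed
  ultimately show ?thesis by blast
qed

text \<open>A linear subspace of \<open>\<real>\<^sup>m\<close>.\<close>
locale vec_subspace =
  fixes m :: nat and S :: "real vec set"
  assumes carrier: "S \<subseteq> carrier_vec m" and zero: "0\<^sub>v m \<in> S"
    and add: "x \<in> S \<Longrightarrow> y \<in> S \<Longrightarrow> x + y \<in> S"
      and smult: "x \<in> S \<Longrightarrow> a \<cdot>\<^sub>v x \<in> S"
begin

text \<open>A subspace invariant under an invertible map is invariant under its inverse: a linear relation
  between \<open>x, T x, T\<^sup>2 x, \<dots>\<close>, divided by a power of \<open>T\<close>, expresses \<open>x\<close> by \<open>T x, T\<^sup>2 x, \<dots>\<close>.\<close>
lemma invariant_inverse:
  assumes T: "T \<in> carrier_mat m m" and inj: "\<And>y. y \<in> carrier_vec m \<Longrightarrow> T *\<^sub>v y = 0\<^sub>v m \<Longrightarrow> y = 0\<^sub>v m"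
    and inv: "\<And>y. y \<in> S \<Longrightarrow> T *\<^sub>v y \<in> S" and x: "x \<in> carrier_vec m"
      and Tx: "T *\<^sub>v x \<in> S"
  shows "x \<in> S"
proof -
  have TS: "T *\<^sub>v krylov_comb T x cs \<in> S" for cs
  proof (induction cs)
    case Nil
    then show ?case using T zero mult_mat_zero_vec[OF T] by simp
  next
    case (Cons c cs)
    have y: "krylov_comb T x cs \<in> carrier_vec m" by (rule krylov_comb_carrier[OF T x])
    have "T *\<^sub>v krylov_comb T x (c # cs) = c \<cdot>\<^sub>v (T *\<^sub>v x) + T *\<^sub>v (T *\<^sub>v krylov_comb T x cs)"
      using mult_add_distrib_mat_vec[OF T, of "c \<cdot>\<^sub>v x" "T *\<^sub>v krylov_comb T x cs"] mult_mat_vec[OF T x] T y x by simp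
    then show ?case using add[OF smult[OF Tx] inv[OF Cons.IH]] by simp
  qed
  have "x \<in> S" if "krylov_comb T x cs = 0\<^sub>v m" "\<exists>c \<in> set cs. c \<noteq> 0" for cs
    using that
  proof (induction cs)
    case (Cons c cs)
    define y where "y = T *\<^sub>v krylov_comb T x cs"
    have y: "y \<in> S" "y \<in> carrier_vec m" using TS carrier by (auto simp: y_def)
    have 0: "c \<cdot>\<^sub>v x + y = 0\<^sub>v m" using Cons.prems(1) by (simp add: y_def)
    show ?case
    proof (cases "c = 0")
      case True
      then have "0 \<cdot>\<^sub>v x + y = 0\<^sub>v m" using 0 by simp
      moreover have "0 \<cdot>\<^sub>v x + y = y" by (rule eq_vecI) (use x y in auto)
      ultimately have "y = 0\<^sub>v m" by metis
      then have "krylov_comb T x cs = 0\<^sub>v m" unfolding y_def by (rule inj[OF krylov_comb_carrier[OF T x]])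
      then show ?thesis using Cons True by auto
    next
      case False
      have e: "c * x $ i + y $ i = 0" if "i < m" for i
        using arg_cong[OF 0, of "\<lambda>z. z $ i"] that x y(2) by simp
      have "x = (- 1 / c) \<cdot>\<^sub>v y"
        by (rule eq_vecI) (use x y(2) e False in \<open>auto simp: field_simps add_eq_0_iff\<close>)
      then show ?thesis using smult[OF y(1)] by metis
    qed
  qed simp
  then show ?thesis using krylov_dependent[OF T x] by blast
qed

lemma column_span_subset:
  assumes M: "M \<in> carrier_mat m k" and cols: "\<And>j. j < k \<Longrightarrow> col M j \<in> S"
    and v: "v \<in> carrier_vec k"
  shows "M *\<^sub>v v \<in> S"
proof -
  define p where "p l = vec m (\<lambda>i. \<Sum>j<l. M $$ (i, j) * v $ j)" for l
  have "p l \<in> S" if "l \<le> k" for l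
    using that
  proof (induction l)
    case 0
    have "p 0 = 0\<^sub>v m" by (rule eq_vecI) (auto simp: p_def)
    then show ?case using zero by simp
  next
    case (Suc l)
    have "p (Suc l) = p l + v $ l \<cdot>\<^sub>v col M l"
      by (rule eq_vecI) (use M Suc.prems in \<open>auto simp: p_def\<close>)
    then show ?case using add[OF Suc.IH smult[OF cols]] Suc.prems by simp
  qed
  moreover have "p k = M *\<^sub>v v"
    by (rule eq_vecI) (use M mult_mat_vec_entry[OF M v] in \<open>auto simp: p_def simp del: index_mult_mat_vec\<close>)
  ultimately show ?thesis by (metis order_refl)
qed

end

context stable_system
begin

text \<open>From the state \<open>p\<close>, the input \<open>g\<close> leads to the midpoint \<open>T (p + B g)\<close>.\<close>
lemma next_state:
  assumes p: "p \<in> carrier_vec m" and g: "g \<in> carrier_vec n"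
  defines "w0 \<equiv> T *\<^sub>v (p + B *\<^sub>v g)"
  shows "w0 \<in> carrier_vec m" "w0 - vel w0 g = p" "w0 + vel w0 g = 2 \<cdot>\<^sub>v w0 - p"
proof -
  have Bg: "B *\<^sub>v g \<in> carrier_vec m" using B g by simp
  then have pg: "p + B *\<^sub>v g \<in> carrier_vec m" using p by simp
  then show w0: "w0 \<in> carrier_vec m" unfolding w0_def using T(1) by simp
  have Aw: "A *\<^sub>v w0 \<in> carrier_vec m" using A w0 by simp
  have "w0 - A *\<^sub>v w0 = p + B *\<^sub>v g" unfolding w0_def by (rule T_right[OF pg])
  then have e: "w0 $ i - (A *\<^sub>v w0) $ i = p $ i + (B *\<^sub>v g) $ i" if "i < m" for i
    by (rule diff_eq_add_entry[OF _ Aw Bg that])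
  have vi: "vel w0 g $ i = (A *\<^sub>v w0) $ i + (B *\<^sub>v g) $ i" if "i < m" for i
    unfolding vel_def using that Bg B by (simp del: index_mult_mat_vec)
  have vc: "vel w0 g \<in> carrier_vec m" using w0 g by simp
  have v: "vel w0 g $ i = w0 $ i - p $ i" if "i < m" for i using e[OF that] vi[OF that] by simp
  show "w0 - vel w0 g = p" "w0 + vel w0 g = 2 \<cdot>\<^sub>v w0 - p"
    by (rule eq_vecI; use w0 vc p v in auto)+
qed

text \<open>The states that the discretised system reaches from rest.\<close>
definition reachable :: "real vec set"
  where "reachable = {endpoint w u | K w u. traj K w u}"

lemma reachableI: "traj K w u \<Longrightarrow> endpoint w u \<in> reachable"
  unfolding reachable_def by blast

sublocale reach: vec_subspace m reachable
proof
  show "reachable \<subseteq> carrier_vec m" unfolding reachable_def using endpoint_carrier by blast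
  show "0\<^sub>v m \<in> reachable" using reachableI[OF traj_rest(1)] traj_rest(2) by simp
next
  fix x y assume "x \<in> reachable" "y \<in> reachable"
  then obtain K w u K' w' u' where *: "x = endpoint w u" "traj K w u" "y = endpoint w' u'" "traj K' w' u'"
    unfolding reachable_def by blast
  have t: "traj (max K K') w u" "traj (max K K') w' u'" using * traj_mono by auto
  show "x + y \<in> reachable" using reachableI[OF traj_add(1)[OF t]] traj_add(2)[OF t] * by simp
next
  fix x a assume "x \<in> reachable"
  then obtain K w u where *: "x = endpoint w u" "traj K w u" unfolding reachable_def by blast
  show "a \<cdot>\<^sub>v x \<in> reachable" using reachableI[OF traj_smult(1)[OF *(2)]] traj_smult(2)[OF *(2)] *
    by simp
qed

lemma reachable_step:
  assumes "p \<in> reachable" and g: "g \<in> carrier_vec n"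
  shows "T *\<^sub>v (p + B *\<^sub>v g) \<in> reachable"
proof -
  obtain K w u where *: "p = endpoint w u" "traj K w u" using assms(1) unfolding reachable_def by blast
  have p: "p \<in> carrier_vec m" using assms(1) reach.carrier by blast
  define w0 where "w0 = T *\<^sub>v (p + B *\<^sub>v g)"
  note w0 = next_state[OF p g, folded w0_def]
  have "2 \<cdot>\<^sub>v w0 - p \<in> reachable"
    using reachableI[OF traj_step(1)[OF *(2) w0(1) g]] traj_step(2)[OF *(2) w0(1) g] w0(2,3) * by simp
  then have "(1 / 2) \<cdot>\<^sub>v ((2 \<cdot>\<^sub>v w0 - p) + p) \<in> reachable"
    using reach.smult reach.add assms(1) by blast
  moreover have "(1 / 2) \<cdot>\<^sub>v ((2 \<cdot>\<^sub>v w0 - p) + p) = w0"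
    by (rule eq_vecI) (use w0(1) p in auto)
  ultimately show ?thesis unfolding w0_def by simp
qed

text \<open>The reachable states form a subspace that is invariant under \<open>T\<close> and contains every \<open>T B g\<close>.
  Being invariant under \<open>T\<^sup>-\<^sup>1 = I - A\<close> too, it contains every \<open>A\<^sup>k B g\<close>.\<close>
lemma controllable_imp_reachable:
  assumes n: "n \<ge> 1" and co: "controllable A B" and p: "p \<in> carrier_vec m"
  shows "p \<in> reachable"
proof -
  have inj: "y = 0\<^sub>v m" if "y \<in> carrier_vec m" "T *\<^sub>v y = 0\<^sub>v m" for y
    using T_right[OF that(1)] that(2) mult_mat_zero_vec[OF A] by simp
  have T_inv: "T *\<^sub>v y \<in> reachable" if "y \<in> reachable" for y
  proof -
    have "y \<in> carrier_vec m" using that reach.carrier by blast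
    then have "y + B *\<^sub>v 0\<^sub>v n = y" using mult_mat_zero_vec[OF B] by simp
    then show ?thesis using reachable_step[OF that zero_carrier_vec] by simp
  qed
  note pull_back = reach.invariant_inverse[OF T(1) inj T_inv]
  have Bg: "B *\<^sub>v g \<in> reachable" if g: "g \<in> carrier_vec n" for g
  proof (rule pull_back)
    show c: "B *\<^sub>v g \<in> carrier_vec m" using B g by simp
    then have "0\<^sub>v m + B *\<^sub>v g = B *\<^sub>v g" by simp
    then show "T *\<^sub>v (B *\<^sub>v g) \<in> reachable" using reachable_step[OF reach.zero g] by simp
  qed
  have A_inv: "A *\<^sub>v x \<in> reachable" if x: "x \<in> reachable" for x
  proof -
    have xc: "x \<in> carrier_vec m" using x reach.carrier by blast
    have Ax: "A *\<^sub>v x \<in> carrier_vec m" using A xc by simp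
    have "x - A *\<^sub>v x \<in> reachable"
    proof (rule pull_back)
      show "x - A *\<^sub>v x \<in> carrier_vec m" using xc Ax by simp
      show "T *\<^sub>v (x - A *\<^sub>v x) \<in> reachable" using T_left[OF xc] x by simp
    qed
    then have "x + (-1) \<cdot>\<^sub>v (x - A *\<^sub>v x) \<in> reachable" using reach.add[OF x] reach.smult
      by blast
    moreover have "x + (-1) \<cdot>\<^sub>v (x - A *\<^sub>v x) = A *\<^sub>v x"
      by (rule eq_vecI) (use xc Ax A in \<open>auto simp del: index_mult_mat_vec\<close>)
    ultimately show ?thesis by simp
  qed
  have AkB: "(A ^\<^sub>m k * B) *\<^sub>v g \<in> reachable" if g: "g \<in> carrier_vec n" for k g
  proof (induction k)
    case 0
    show ?case using Bg[OF g] A B by simp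
  next
    case (Suc k)
    have Ak: "A ^\<^sub>m k \<in> carrier_mat m m" using A by simp
    have c: "A ^\<^sub>m k * B \<in> carrier_mat m n" by (rule mult_carrier_mat[OF Ak B])
    have "A ^\<^sub>m Suc k * B = A * (A ^\<^sub>m k * B)"
      unfolding pow_mat.simps(2) pow_mat_commute[OF A] by (rule assoc_mult_mat[OF A Ak B])
    then show ?case using A_inv[OF Suc] assoc_mult_mat_vec[OF A c g] by simp
  qed
  define Co where "Co = controllability_mat A B"
  have Co: "Co \<in> carrier_mat m (m * n)" using A B by (simp add: Co_def controllability_mat_def)
  obtain E where E: "E \<in> carrier_mat (m * n) m" "Co * E = 1\<^sub>m m"
    using full_row_rank_right_inverse[OF Co] co A B unfolding controllable_def Co_def by auto
  have "col Co j \<in> reachable" if j: "j < m * n" for j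
  proof -
    have c: "A ^\<^sub>m (j div n) * B \<in> carrier_mat m n" using mult_carrier_mat[OF pow_carrier_mat[OF A] B] .
    have jn: "j mod n < n" using n by simp
    have "col Co j = (A ^\<^sub>m (j div n) * B) *\<^sub>v unit_vec n (j mod n)"
    proof (rule eq_vecI)
      fix i assume "i < dim_vec ((A ^\<^sub>m (j div n) * B) *\<^sub>v unit_vec n (j mod n))"
      then have i: "i < m" using A by simp
      have "((A ^\<^sub>m (j div n) * B) *\<^sub>v unit_vec n (j mod n)) $ i = (\<Sum>l<n. (A ^\<^sub>m (j div n) * B) $$ (i, l) * (if l = j mod n then 1 else 0))"
        unfolding mult_mat_vec_entry[OF c unit_vec_carrier i] using jn
          by (intro sum.cong refl) (simp add: unit_vec_def)
      also have "\<dots> = (A ^\<^sub>m (j div n) * B) $$ (i, j mod n)"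
        using jn by (simp add: if_distrib sum.delta cong: if_cong del: index_mult_mat(1))
      also have "\<dots> = col Co j $ i" using i j A B Co
        by (simp add: Co_def controllability_mat_def del: index_mult_mat(1))
      finally show "col Co j $ i = ((A ^\<^sub>m (j div n) * B) *\<^sub>v unit_vec n (j mod n)) $ i" ..
    qed (use A Co in simp)
    then show ?thesis using AkB[of "unit_vec n (j mod n)" "j div n"] by simp
  qed
  then have "Co *\<^sub>v (E *\<^sub>v p) \<in> reachable"
    by (rule reach.column_span_subset[OF Co]) (use E p in auto)
  moreover have "Co *\<^sub>v (E *\<^sub>v p) = p" using assoc_mult_mat_vec[OF Co E(1) p] E(2) p by simp
  ultimately show ?thesis by simp
qed

text \<open>The least supply that brings the system from rest to a given state is a quadratic form, and
  \<open>X\<close> is the matrix of 4 times that form.  Since the optimum cannot be beaten by appending one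
  step with midpoint \<open>w\<close> and input \<open>g\<close>, it satisfies the dissipation inequality.\<close>
lemma storage_function:
  assumes n: "n \<ge> 1" and co: "controllable A B" and fp: "freq_passive A B C"
  shows "\<exists>X \<in> carrier_mat m m. X\<^sup>T = X \<and> (\<forall>x \<in> carrier_vec m. 0 \<le> x \<bullet> (X *\<^sub>v x)) \<and>
    (\<forall>w \<in> carrier_vec m. \<forall>g \<in> carrier_vec n. w \<bullet> (X *\<^sub>v vel w g) \<le> g \<bullet> (C *\<^sub>v vel w g))"
proof -
  define S where "S p = {supplied K w u | K w u. traj K w u \<and> endpoint w u = p}" for p
  define V where "V p = Inf (S p)" for p
  have SI: "supplied K w u \<in> S (endpoint w u)" if "traj K w u" for K w u
    using that unfolding S_def by blast
  have ne: "S p \<noteq> {}" if "p \<in> carrier_vec m" for p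
    using controllable_imp_reachable[OF n co that] unfolding reachable_def S_def by blast
  have S0: "0 \<le> c" if "c \<in> S p" for c p
    using that supplied_nonneg[OF fp] unfolding S_def by auto
  have bdd: "bdd_below (S p)" for p using S0 by (meson bdd_belowI)
  have V_le: "V p \<le> c" if "c \<in> S p" for p c unfolding V_def by (rule cInf_lower[OF that bdd])
  have V_ge: "a \<le> V p" if "p \<in> carrier_vec m" "\<And>c. c \<in> S p \<Longrightarrow> a \<le> c" for a p
    unfolding V_def by (rule cInf_greatest[OF ne[OF that(1)] that(2)])
  have V0: "0 \<le> V p" if "p \<in> carrier_vec m" for p by (rule V_ge[OF that S0])
  have hom_le: "V (a \<cdot>\<^sub>v x) \<le> a\<^sup>2 * V x" if x: "x \<in> carrier_vec m" for a x
  proof (cases "a = 0")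
    case True
    have "0 \<cdot>\<^sub>v x = 0\<^sub>v m" by (rule eq_vecI) (use x in auto)
    then show ?thesis using V_le[OF SI[OF traj_rest(1)]] True by (simp add: traj_rest)
  next
    case False
    have "V (a \<cdot>\<^sub>v x) / a\<^sup>2 \<le> V x"
    proof (rule V_ge[OF x])
      fix c assume "c \<in> S x"
      then obtain K w u where *: "c = supplied K w u" "traj K w u" "endpoint w u = x" unfolding S_def by blast
      have "V (a \<cdot>\<^sub>v x) \<le> a\<^sup>2 * c"
        using V_le[OF SI[OF traj_smult(1)[OF *(2), of a]]] traj_smult(2,3)[OF *(2), of a] * by simp
      then show "V (a \<cdot>\<^sub>v x) / a\<^sup>2 \<le> c" using False by (simp add: field_simps)
    qed
    then show ?thesis using False by (simp add: field_simps)
  qed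
  have hom: "V (a \<cdot>\<^sub>v x) = a\<^sup>2 * V x" if x: "x \<in> carrier_vec m" for a x
  proof (cases "a = 0")
    case True
    then show ?thesis using hom_le[OF x, of 0] V0[of "0 \<cdot>\<^sub>v x"] x by simp
  next
    case False
    have "V ((1 / a) \<cdot>\<^sub>v (a \<cdot>\<^sub>v x)) \<le> (1 / a)\<^sup>2 * V (a \<cdot>\<^sub>v x)"
      using x by (intro hom_le) simp
    then have "a\<^sup>2 * V x \<le> V (a \<cdot>\<^sub>v x)"
      using False by (simp add: smult_smult_assoc power_divide field_simps)
    then show ?thesis using hom_le[OF x, of a] by simp
  qed
  have par_le: "V (x + y) + V (x - y) \<le> 2 * V x + 2 * V y" if x: "x \<in> carrier_vec m"
    and y: "y \<in> carrier_vec m" for x y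
  proof -
    have 1: "V (x + y) + V (x - y) \<le> 2 * c + 2 * d" if "c \<in> S x" "d \<in> S y" for c d
    proof -
      obtain K w u where *: "c = supplied K w u" "traj K w u" "endpoint w u = x"
        using \<open>c \<in> S x\<close> unfolding S_def by blast
      obtain L w' u' where **: "d = supplied L w' u'" "traj L w' u'" "endpoint w' u' = y"
        using \<open>d \<in> S y\<close> unfolding S_def by blast
      have t: "traj (max K L) w u" "traj (max K L) w' u'"
        by (rule traj_mono[OF *(2)], simp) (rule traj_mono[OF **(2)], simp)
      have s: "supplied (max K L) w u = c" "supplied (max K L) w' u' = d"
        unfolding *(1) **(1) by (rule supplied_mono[OF *(2)], simp) (rule supplied_mono[OF **(2)], simp)
      show ?thesis
        using V_le[OF SI[OF traj_add(1)[OF t]]] V_le[OF SI[OF traj_diff(1)[OF t]]] supplied_parallelogram[OF t]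
        unfolding traj_add(2)[OF t] traj_diff(2)[OF t] s * ** by linarith
    qed
    have "(V (x + y) + V (x - y) - 2 * d) / 2 \<le> V x" if "d \<in> S y" for d
      by (rule V_ge[OF x]) (use 1[OF _ that] in \<open>simp add: field_simps\<close>)
    then have "(V (x + y) + V (x - y) - 2 * V x) / 2 \<le> V y"
      by (intro V_ge[OF y]) (simp add: field_simps)
    then show ?thesis by (simp add: field_simps)
  qed
  have par: "V (x + y) + V (x - y) = 2 * V x + 2 * V y" if x: "x \<in> carrier_vec m"
    and y: "y \<in> carrier_vec m" for x y
  proof -
    have "(x + y) + (x - y) = 2 \<cdot>\<^sub>v x" "(x + y) - (x - y) = 2 \<cdot>\<^sub>v y"
      by (rule eq_vecI; use x y in auto)+
    then have "4 * V x + 4 * V y \<le> 2 * V (x + y) + 2 * V (x - y)"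
      using par_le[of "x + y" "x - y"] x y hom[OF x, of 2] hom[OF y, of 2] by simp
    then show ?thesis using par_le[OF x y] by linarith
  qed
  obtain X where X: "X \<in> carrier_mat m m" "X\<^sup>T = X"
    and VX: "\<And>x. x \<in> carrier_vec m \<Longrightarrow> V x = x \<bullet> (X *\<^sub>v x)"
    using parallelogram_imp_quadratic_form[OF par hom V0] by blast
  have Xc: "X *\<^sub>v x \<in> carrier_vec m" if "x \<in> carrier_vec m" for x using X that by simp
  have diss: "4 * (w \<bullet> (X *\<^sub>v vel w g)) \<le> g \<bullet> (C *\<^sub>v vel w g)"
    if w: "w \<in> carrier_vec m" and g: "g \<in> carrier_vec n" for w g
  proof -
    define v where "v = vel w g"
    have v: "v \<in> carrier_vec m" using w g by (simp add: v_def)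
    have "V (w + v) - g \<bullet> (C *\<^sub>v v) \<le> V (w - v)"
    proof (rule V_ge)
      fix c assume "c \<in> S (w - v)"
      then obtain K y u where *: "c = supplied K y u" "traj K y u" "endpoint y u = w - v" unfolding S_def by blast
      have e: "w - vel w g = endpoint y u" using * v_def by simp
      note st = traj_step[OF *(2) w g e]
      show "V (w + v) - g \<bullet> (C *\<^sub>v v) \<le> c"
        using V_le[OF SI[OF st(1)]] unfolding st(2,3) * v_def by simp
    qed (use w v in simp)
    moreover have "V (w + v) - V (w - v) = 4 * (w \<bullet> (X *\<^sub>v v))"
    proof -
      have sym: "v \<bullet> (X *\<^sub>v w) = w \<bullet> (X *\<^sub>v v)"
        using transpose_vec_mult_scalar[OF X(1) w v] X(2) comm_scalar_prod[OF Xc[OF v] w] by simp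
      have wv: "w + v \<in> carrier_vec m" "w - v \<in> carrier_vec m" using w v by auto
      show ?thesis
        unfolding VX[OF wv(1)] VX[OF wv(2)] mult_add_distrib_mat_vec[OF X(1) w v] mult_minus_distrib_mat_vec[OF X(1) w v]
        using w v Xc[OF w] Xc[OF v] sym
        by (simp add: add_scalar_prod_distrib[of _ m] scalar_prod_add_distrib[of _ m]
            minus_scalar_prod_distrib[of _ m] scalar_prod_minus_distrib[of _ m])
    qed
    ultimately show ?thesis unfolding v_def by linarith
  qed
  have X4: "(4 \<cdot>\<^sub>m X) *\<^sub>v x = 4 \<cdot>\<^sub>v (X *\<^sub>v x)" if "x \<in> carrier_vec m" for x
    by (rule smult_mat_mult_vec[OF X(1) that])
  have q4: "x \<bullet> ((4 \<cdot>\<^sub>m X) *\<^sub>v y) = 4 * (x \<bullet> (X *\<^sub>v y))"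
    if "x \<in> carrier_vec m" "y \<in> carrier_vec m" for x y
    unfolding X4[OF that(2)] by (rule scalar_prod_smult_distrib[OF that(1) Xc[OF that(2)]])
  show ?thesis
  proof (intro bexI[of _ "4 \<cdot>\<^sub>m X"] conjI ballI)
    have "(4 \<cdot>\<^sub>m X)\<^sup>T = 4 \<cdot>\<^sub>m X\<^sup>T" by (rule eq_matI) auto
    then show "(4 \<cdot>\<^sub>m X)\<^sup>T = 4 \<cdot>\<^sub>m X" using X(2) by simp
    show "4 \<cdot>\<^sub>m X \<in> carrier_mat m m" using X(1) by simp
  next
    fix x :: "real vec" assume x: "x \<in> carrier_vec m"
    show "0 \<le> x \<bullet> ((4 \<cdot>\<^sub>m X) *\<^sub>v x)" unfolding q4[OF x x] using V0[OF x] VX[OF x]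
      by simp
  next
    fix w g :: "real vec" assume wg: "w \<in> carrier_vec m" "g \<in> carrier_vec n"
    show "w \<bullet> ((4 \<cdot>\<^sub>m X) *\<^sub>v vel w g) \<le> g \<bullet> (C *\<^sub>v vel w g)"
      unfolding q4[OF wg(1) vel_carrier[OF wg]] by (rule diss[OF wg])
  qed
qed

end

section \<open>From the storage function to the matrix inequality\<close>

text \<open>Near 0 the linear terms decide.\<close>
lemma linear_dominated_by_quadratic:
  fixes a b c :: real
  assumes "\<And>t. t * a + t\<^sup>2 * c \<le> t * b"
  shows "a = b"
proof (rule ccontr)
  assume "a \<noteq> b"
  define d where "d = a - b"
  have d: "d \<noteq> 0" using \<open>a \<noteq> b\<close> by (simp add: d_def)
  define k where "k = 1 + \<bar>c\<bar>"
  have k: "k > 0" by (simp add: k_def)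
  have "d / k * d + (d / k)\<^sup>2 * c \<le> 0" 
  proof -
    have "d / k * d = d / k * a - d / k * b" by (simp only: d_def right_diff_distrib)
    then show ?thesis using assms[of "d / k"] by linarith
  qed
  moreover have "d / k * d + (d / k)\<^sup>2 * c = (d\<^sup>2 / k\<^sup>2) * (k + c)"
    using k by (simp add: field_simps power2_eq_square)
  moreover have "k + c > 0" by (simp add: k_def)
  then have "0 < (d\<^sup>2 / k\<^sup>2) * (k + c)" using d k by simp
  ultimately show False by linarith
qed

lemma mat_adjoint_carrier [simp]: "M \<in> carrier_mat r c \<Longrightarrow> mat_adjoint M \<in> carrier_mat c r"
  unfolding mat_adjoint_def by auto

lemma mat_adjoint_entry:
  "M \<in> carrier_mat r c \<Longrightarrow> i < c \<Longrightarrow> j < r \<Longrightarrow> mat_adjoint M $$ (i, j) = conjugate (M $$ (j, i))"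
  unfolding mat_adjoint_def by (auto simp: mat_of_rows_index)

lemma mat_adjoint_real: "mat_adjoint (M :: real mat) = M\<^sup>T"
  by (rule eq_matI) (auto simp: mat_adjoint_entry[OF carrier_matI[OF refl refl]] mat_adjoint_def mat_of_rows_index)

lemma scalar_prod_transpose:
  fixes M :: "'a::comm_semiring_1 mat"
  assumes M: "M \<in> carrier_mat r c" and x: "x \<in> carrier_vec c" and y: "y \<in> carrier_vec r"
  shows "y \<bullet> (M *\<^sub>v x) = (M\<^sup>T *\<^sub>v y) \<bullet> x"
  using transpose_vec_mult_scalar[OF M x y] by simp

lemma vec_eq_if_scalar_prod_eq:
  fixes a b :: "real vec"
  assumes a: "a \<in> carrier_vec m" and b: "b \<in> carrier_vec m"
    and eq: "\<And>q. q \<in> carrier_vec m \<Longrightarrow> a \<bullet> q = b \<bullet> q"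
  shows "a = b"
proof (rule eq_vecI)
  fix i assume "i < dim_vec b"
  then have i: "i < m" using b by simp
  show "a $ i = b $ i" using eq[of "unit_vec m i"] a b i by (simp add: scalar_prod_right_unit)
qed (use a b in simp)

lemma mat_eq_if_mult_vec_eq:
  fixes M N :: "real mat"
  assumes M: "M \<in> carrier_mat r c" and N: "N \<in> carrier_mat r c"
    and eq: "\<And>v. v \<in> carrier_vec c \<Longrightarrow> M *\<^sub>v v = N *\<^sub>v v"
  shows "M = N"
proof (rule eq_matI)
  fix i j assume "i < dim_row N" "j < dim_col N"
  then have ij: "i < r" "j < c" using N by auto
  have "(P *\<^sub>v unit_vec c j) $ i = P $$ (i, j)" if "P \<in> carrier_mat r c" for P :: "real mat"
    using that ij by (simp add: scalar_prod_right_unit)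
  then show "M $$ (i, j) = N $$ (i, j)" using eq[of "unit_vec c j"] M N by (metis unit_vec_carrier)
qed (use M N in auto)

lemma neg_semidef_lyapunov:
  fixes A Y :: "real mat"
  assumes A: "A \<in> carrier_mat m m" and Y: "Y \<in> carrier_mat m m" and sym: "Y\<^sup>T = Y"
  shows "neg_semidef (A * Y + Y * mat_adjoint A) \<longleftrightarrow> (\<forall>v \<in> carrier_vec m. v \<bullet> ((A * Y) *\<^sub>v v) \<le> 0)"
proof -
  have AY: "A * Y \<in> carrier_mat m m" and YA: "Y * A\<^sup>T \<in> carrier_mat m m" using A Y by auto
  define L where "L = A * Y + Y * A\<^sup>T"
  have L: "L \<in> carrier_mat m m" using AY YA by (simp add: L_def)
  have T: "(A * Y)\<^sup>T = Y * A\<^sup>T" using transpose_mult[OF A Y] sym by simp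
  then have "(Y * A\<^sup>T)\<^sup>T = A * Y" by (metis transpose_transpose)
  with T have "L\<^sup>T = L" using transpose_add[OF AY YA] comm_add_mat[OF AY YA] unfolding L_def by simp
  moreover have "(- L)\<^sup>T = - L\<^sup>T" by (rule eq_matI) auto
  ultimately have herm: "mat_adjoint (- L) = - L" unfolding mat_adjoint_real by simp
  have form: "((- L) *\<^sub>v v) \<bullet>c v = - 2 * (v \<bullet> ((A * Y) *\<^sub>v v))"
    if v: "v \<in> carrier_vec m" for v
  proof -
    have Lv: "L *\<^sub>v v \<in> carrier_vec m" using L v by simp
    have "(- L) *\<^sub>v v = (-1) \<cdot>\<^sub>v (L *\<^sub>v v)" by (rule eq_vecI) (use L v in auto)
    then have "((- L) *\<^sub>v v) \<bullet> v = - (v \<bullet> (L *\<^sub>v v))"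
      using smult_scalar_prod_distrib[OF Lv v, of "-1"] comm_scalar_prod[OF v Lv] by simp
    moreover have "v \<bullet> ((Y * A\<^sup>T) *\<^sub>v v) = v \<bullet> ((A * Y) *\<^sub>v v)"
      using scalar_prod_transpose[OF AY v v] T comm_scalar_prod[OF v mult_mat_vec_carrier[OF YA v]] by simp
    then have "v \<bullet> (L *\<^sub>v v) = 2 * (v \<bullet> ((A * Y) *\<^sub>v v))"
      unfolding L_def add_mult_distrib_mat_vec[OF AY YA v]
      using scalar_prod_add_distrib[OF v mult_mat_vec_carrier[OF AY v] mult_mat_vec_carrier[OF YA v]] by simp
    ultimately show ?thesis by simp
  qed
  have "neg_semidef L \<longleftrightarrow> (\<forall>v \<in> carrier_vec m. 0 \<le> ((- L) *\<^sub>v v) \<bullet>c v)"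
    unfolding neg_semidef_def pos_semidef_def using herm L by simp
  then show ?thesis unfolding L_def[symmetric] mat_adjoint_real using form by simp
qed

context stable_system
begin

lemma A_injective:
  assumes v: "v \<in> carrier_vec m" and 0: "A *\<^sub>v v = 0\<^sub>v m"
  shows "v = 0\<^sub>v m"
proof (rule ccontr)
  assume nz: "v \<noteq> 0\<^sub>v m"
  have "cmat A *\<^sub>v map_vec complex_of_real v = 0\<^sub>v m"
    unfolding of_real_hom.mult_mat_vec_hom[OF A v, symmetric] 0 by auto
  then have "eigenvector (cmat A) (map_vec complex_of_real v) 0"
    unfolding eigenvector_def using v A nz by auto
  then show False using hurwitz unfolding hurwitz_def eigenvalue_def by fastforce
qed

text \<open>If \<open>X\<close> satisfies the dissipation inequality, then \<open>Y = X\<^sup>-\<^sup>1\<close> is as required.\<close>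
lemma storage_imp_lmi:
  assumes n: "n \<ge> 1" and ob: "observable C A"
    and X: "X \<in> carrier_mat m m" "X\<^sup>T = X"
      and psd: "\<And>x. x \<in> carrier_vec m \<Longrightarrow> 0 \<le> x \<bullet> (X *\<^sub>v x)"
    and diss: "\<And>w g. w \<in> carrier_vec m \<Longrightarrow> g \<in> carrier_vec n \<Longrightarrow> w \<bullet> (X *\<^sub>v vel w g) \<le> g \<bullet> (C *\<^sub>v vel w g)"
  shows "\<exists>Y \<in> carrier_mat m m. pos_def Y \<and> neg_semidef (A * Y + Y * mat_adjoint A) \<and> B = - (A * Y * mat_adjoint C)"
proof -
  obtain Ai where Ai: "Ai \<in> carrier_mat m m" "A * Ai = 1\<^sub>m m"
    using invertible_if_kernel_trivial[OF A A_injective] by blast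
  have Xc: "X *\<^sub>v x \<in> carrier_vec m" if "x \<in> carrier_vec m" for x using X(1) that by simp
  have Ac: "A *\<^sub>v x \<in> carrier_vec m" if "x \<in> carrier_vec m" for x using A that by simp
  have Cc: "C *\<^sub>v x \<in> carrier_vec n" if "x \<in> carrier_vec m" for x using C that by simp
  have X_sym: "y \<bullet> (X *\<^sub>v x) = (X *\<^sub>v y) \<bullet> x"
    if "x \<in> carrier_vec m" "y \<in> carrier_vec m" for x y
    using scalar_prod_transpose[OF X(1) that] X(2) by simp
  have lyap: "w \<bullet> (X *\<^sub>v (A *\<^sub>v w)) \<le> 0" if w: "w \<in> carrier_vec m" for w
    using diss[OF w zero_carrier_vec] Cc[OF Ac[OF w]] by (simp add: vel_zero_input[OF w])
  define W where "W g = - (Ai *\<^sub>v (B *\<^sub>v g))" for g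
  have Wc: "W g \<in> carrier_vec m" if "g \<in> carrier_vec n" for g using Ai B that by (simp add: W_def)
  have AW: "A *\<^sub>v W g = - (B *\<^sub>v g)" if g: "g \<in> carrier_vec n" for g
  proof -
    have Bg: "B *\<^sub>v g \<in> carrier_vec m" using B g by simp
    have "A *\<^sub>v (Ai *\<^sub>v (B *\<^sub>v g)) = B *\<^sub>v g"
      using assoc_mult_mat_vec[OF A Ai(1) Bg] Ai(2) Bg by simp
    moreover have "W g = (-1) \<cdot>\<^sub>v (Ai *\<^sub>v (B *\<^sub>v g))" unfolding W_def by auto
    ultimately have "A *\<^sub>v W g = (-1) \<cdot>\<^sub>v (B *\<^sub>v g)"
      using mult_mat_vec[OF A mult_mat_vec_carrier[OF Ai(1) Bg], of "-1"] by simp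
    then show ?thesis by auto
  qed
  \<comment> \<open>At \<open>w = - A\<^sup>-\<^sup>1 B g\<close> the velocity vanishes and the dissipation inequality is an equality, so
    its first-order terms agree.\<close>
  have XW: "W g \<bullet> (X *\<^sub>v q) = g \<bullet> (C *\<^sub>v q)" if g: "g \<in> carrier_vec n"
    and q: "q \<in> carrier_vec m" for g q
  proof -
    define p where "p = Ai *\<^sub>v q"
    have p: "p \<in> carrier_vec m" using Ai q by (simp add: p_def)
    have Ap: "A *\<^sub>v p = q" using assoc_mult_mat_vec[OF A Ai(1) q] Ai(2) q by (simp add: p_def)
    have "t * (W g \<bullet> (X *\<^sub>v q)) + t\<^sup>2 * (p \<bullet> (X *\<^sub>v q)) \<le> t * (g \<bullet> (C *\<^sub>v q))" for t
    proof -
      have tp: "t \<cdot>\<^sub>v p \<in> carrier_vec m" using p by simp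
      have wc: "W g + t \<cdot>\<^sub>v p \<in> carrier_vec m" using Wc[OF g] tp by simp
      have "vel (W g + t \<cdot>\<^sub>v p) g = (- (B *\<^sub>v g) + t \<cdot>\<^sub>v q) + B *\<^sub>v g"
        unfolding vel_def mult_add_distrib_mat_vec[OF A Wc[OF g] tp] AW[OF g] mult_mat_vec[OF A p] Ap ..
      also have "\<dots> = t \<cdot>\<^sub>v q" by (rule eq_vecI) (use B g q in auto)
      finally have v: "vel (W g + t \<cdot>\<^sub>v p) g = t \<cdot>\<^sub>v q" .
      have "(W g + t \<cdot>\<^sub>v p) \<bullet> (t \<cdot>\<^sub>v (X *\<^sub>v q)) = t * (W g \<bullet> (X *\<^sub>v q)) + t\<^sup>2 * (p \<bullet> (X *\<^sub>v q))"
        using add_scalar_prod_distrib[OF Wc[OF g] tp, of "t \<cdot>\<^sub>v (X *\<^sub>v q)"] Wc[OF g] p Xc[OF q]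
        by (simp add: power2_eq_square)
      then show ?thesis
        using diss[OF wc g] unfolding v mult_mat_vec[OF X(1) q] mult_mat_vec[OF C q]
        using scalar_prod_smult_distrib[OF g Cc[OF q]] by simp
    qed
    then show ?thesis by (rule linear_dominated_by_quadratic)
  qed
  \<comment> \<open>The kernel of \<open>X\<close> is invariant under \<open>A\<close> and contained in the kernel of \<open>C\<close>.\<close>
  have ker: "X *\<^sub>v (A *\<^sub>v w) = 0\<^sub>v m" "C *\<^sub>v w = 0\<^sub>v n" if w: "w \<in> carrier_vec m"
    and 0: "X *\<^sub>v w = 0\<^sub>v m" for w
  proof -
    have "q \<bullet> (X *\<^sub>v (A *\<^sub>v w)) = 0" if q: "q \<in> carrier_vec m" for q
    proof (rule linear_dominated_by_quadratic[where c = "q \<bullet> (X *\<^sub>v (A *\<^sub>v q))"])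
      fix t
      have tq: "t \<cdot>\<^sub>v q \<in> carrier_vec m" using q by simp
      have wq: "w + t \<cdot>\<^sub>v q \<in> carrier_vec m" using w tq by simp
      have Aq: "A *\<^sub>v (w + t \<cdot>\<^sub>v q) = A *\<^sub>v w + t \<cdot>\<^sub>v (A *\<^sub>v q)"
        unfolding mult_add_distrib_mat_vec[OF A w tq] mult_mat_vec[OF A q] ..
      have XAq: "X *\<^sub>v (A *\<^sub>v (w + t \<cdot>\<^sub>v q)) = X *\<^sub>v (A *\<^sub>v w) + t \<cdot>\<^sub>v (X *\<^sub>v (A *\<^sub>v q))"
        unfolding Aq using mult_add_distrib_mat_vec[OF X(1) Ac[OF w], of "t \<cdot>\<^sub>v (A *\<^sub>v q)"] mult_mat_vec[OF X(1) Ac[OF q]] Ac[OF q] by simp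
      have "w \<bullet> (X *\<^sub>v (A *\<^sub>v (w + t \<cdot>\<^sub>v q))) = 0"
        unfolding X_sym[OF Ac[OF wq] w] 0 using Ac[OF wq] by simp
      moreover have "(w + t \<cdot>\<^sub>v q) \<bullet> (X *\<^sub>v (A *\<^sub>v (w + t \<cdot>\<^sub>v q))) \<le> 0" by (rule lyap[OF wq])
      ultimately have "(t \<cdot>\<^sub>v q) \<bullet> (X *\<^sub>v (A *\<^sub>v (w + t \<cdot>\<^sub>v q))) \<le> 0"
        using add_scalar_prod_distrib[OF w tq Xc[OF Ac[OF wq]]] by simp
      moreover have "(t \<cdot>\<^sub>v q) \<bullet> (X *\<^sub>v (A *\<^sub>v w) + t \<cdot>\<^sub>v (X *\<^sub>v (A *\<^sub>v q)))
          = t * (q \<bullet> (X *\<^sub>v (A *\<^sub>v w))) + t\<^sup>2 * (q \<bullet> (X *\<^sub>v (A *\<^sub>v q)))"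
        using scalar_prod_add_distrib[OF tq Xc[OF Ac[OF w]], of "t \<cdot>\<^sub>v (X *\<^sub>v (A *\<^sub>v q))"] q Xc[OF Ac[OF w]] Xc[OF Ac[OF q]]
        by (simp add: power2_eq_square)
      ultimately show "t * (q \<bullet> (X *\<^sub>v (A *\<^sub>v w))) + t\<^sup>2 * (q \<bullet> (X *\<^sub>v (A *\<^sub>v q))) \<le> t * 0"
        unfolding XAq by simp
    qed
    then show "X *\<^sub>v (A *\<^sub>v w) = 0\<^sub>v m"
      by (intro vec_eq_if_scalar_prod_eq[OF Xc[OF Ac[OF w]] zero_carrier_vec])
        (use comm_scalar_prod[OF Xc[OF Ac[OF w]]] in simp)
    have "g \<bullet> (C *\<^sub>v w) = 0" if g: "g \<in> carrier_vec n" for g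
      using XW[OF g w] Wc[OF g] unfolding 0 by simp
    then show "C *\<^sub>v w = 0\<^sub>v n"
      by (intro vec_eq_if_scalar_prod_eq[OF Cc[OF w] zero_carrier_vec]) (use comm_scalar_prod[OF Cc[OF w]] in simp)
  qed
  have X_inj: "w = 0\<^sub>v m" if w: "w \<in> carrier_vec m" and 0: "X *\<^sub>v w = 0\<^sub>v m" for w
  proof -
    have Akw: "A ^\<^sub>m k *\<^sub>v w \<in> carrier_vec m" for k
      by (rule mult_mat_vec_carrier[OF pow_carrier_mat[OF A] w])
    have Xk: "X *\<^sub>v (A ^\<^sub>m k *\<^sub>v w) = 0\<^sub>v m" for k
    proof (induction k)
      case 0
      then show ?case using A w \<open>X *\<^sub>v w = 0\<^sub>v m\<close> by simp
    next
      case (Suc k)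
      have "A ^\<^sub>m Suc k *\<^sub>v w = A *\<^sub>v (A ^\<^sub>m k *\<^sub>v w)"
        unfolding pow_mat.simps(2) pow_mat_commute[OF A] by (rule assoc_mult_mat_vec[OF A pow_carrier_mat[OF A] w])
      then show ?case using ker(1)[OF Akw Suc] by simp
    qed
    have CAk: "C * A ^\<^sub>m k \<in> carrier_mat n m" for k by (rule mult_carrier_mat[OF C pow_carrier_mat[OF A]])
    have CAkw: "(C * A ^\<^sub>m k) *\<^sub>v w = 0\<^sub>v n" for k
      using assoc_mult_mat_vec[OF C pow_carrier_mat[OF A] w] ker(2)[OF Akw Xk] by simp
    define Ob where "Ob = observability_mat C A"
    have Ob: "Ob \<in> carrier_mat (m * n) m" using A C by (simp add: Ob_def observability_mat_def)
    have "Ob *\<^sub>v w = 0\<^sub>v (m * n)"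
    proof (rule eq_vecI)
      fix i assume "i < dim_vec (0\<^sub>v (m * n) :: real vec)"
      then have i: "i < m * n" by simp
      have im: "i mod n < n" using n by simp
      have "Ob $$ (i, l) = (C * A ^\<^sub>m (i div n)) $$ (i mod n, l)" if "l < m" for l
        using i that A C by (simp add: Ob_def observability_mat_def del: index_mult_mat(1))
      then have "(Ob *\<^sub>v w) $ i = ((C * A ^\<^sub>m (i div n)) *\<^sub>v w) $ (i mod n)"
        unfolding mult_mat_vec_entry[OF Ob w i] mult_mat_vec_entry[OF CAk w im] by (intro sum.cong refl) simp
      then show "(Ob *\<^sub>v w) $ i = 0\<^sub>v (m * n) $ i" unfolding CAkw using i im by simp
    qed (use Ob in simp)
    then show ?thesis using full_col_rank_kernel[OF Ob _ w] ob A C unfolding observable_def Ob_def by auto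
  qed
  obtain Y where Y: "Y \<in> carrier_mat m m" "Y * X = 1\<^sub>m m" "X * Y = 1\<^sub>m m"
    using invertible_if_kernel_trivial[OF X(1) X_inj] by blast
  have Yc: "Y *\<^sub>v x \<in> carrier_vec m" if "x \<in> carrier_vec m" for x using Y(1) that by simp
  have XY: "X *\<^sub>v (Y *\<^sub>v x) = x" "Y *\<^sub>v (X *\<^sub>v x) = x" if "x \<in> carrier_vec m" for x
    using assoc_mult_mat_vec[OF X(1) Y(1) that] assoc_mult_mat_vec[OF Y(1) X(1) that] Y(2,3) that by simp_all
  have YT: "Y\<^sup>T \<in> carrier_mat m m" using Y(1) by simp
  have "Y\<^sup>T * X = 1\<^sub>m m" using transpose_mult[OF X(1) Y(1)] X(2) Y(3) by simp
  then have Y_sym: "Y\<^sup>T = Y"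
    using assoc_mult_mat[OF YT X(1) Y(1)] Y YT by simp
  have Yq: "(Y *\<^sub>v v) \<bullet> v = (Y *\<^sub>v v) \<bullet> (X *\<^sub>v (Y *\<^sub>v v))"
    if "v \<in> carrier_vec m" for v
    using XY(1)[OF that] by simp
  have "pos_def Y"
    unfolding pos_def_def mat_adjoint_real
  proof (intro conjI ballI impI)
    show "square_mat Y" using Y(1) by simp
    show "Y\<^sup>T = Y" by (rule Y_sym)
    fix v :: "real vec" assume "v \<in> carrier_vec (dim_row Y)" and nz: "v \<noteq> 0\<^sub>v (dim_row Y)"
    then have v: "v \<in> carrier_vec m" using Y(1) by simp
    define w where "w = Y *\<^sub>v v"
    have w: "w \<in> carrier_vec m" using Yc[OF v] by (simp add: w_def)
    have "w \<bullet> (X *\<^sub>v w) \<noteq> 0"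
    proof
      assume z: "w \<bullet> (X *\<^sub>v w) = 0"
      have "(X *\<^sub>v w) \<bullet> q = 0" if q: "q \<in> carrier_vec m" for q
      proof -
        have "- 2 * ((X *\<^sub>v w) \<bullet> q) = 0"
        proof (rule linear_dominated_by_quadratic[where c = "- (q \<bullet> (X *\<^sub>v q))"])
          fix t
          have tq: "t \<cdot>\<^sub>v q \<in> carrier_vec m" using q by simp
          have wq: "w + t \<cdot>\<^sub>v q \<in> carrier_vec m" using w tq by simp
          have "(w + t \<cdot>\<^sub>v q) \<bullet> (X *\<^sub>v w + t \<cdot>\<^sub>v (X *\<^sub>v q)) = w \<bullet> (X *\<^sub>v w) + t * (w \<bullet> (X *\<^sub>v q)) + t * (q \<bullet> (X *\<^sub>v w)) + t\<^sup>2 * (q \<bullet> (X *\<^sub>v q))"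
            using w q tq Xc[OF w] Xc[OF q]
            by (simp add: add_scalar_prod_distrib[of _ m] scalar_prod_add_distrib[of _ m] power2_eq_square algebra_simps)
          moreover have "X *\<^sub>v (w + t \<cdot>\<^sub>v q) = X *\<^sub>v w + t \<cdot>\<^sub>v (X *\<^sub>v q)"
            unfolding mult_add_distrib_mat_vec[OF X(1) w tq] mult_mat_vec[OF X(1) q] ..
          moreover have "w \<bullet> (X *\<^sub>v q) = (X *\<^sub>v w) \<bullet> q" by (rule X_sym[OF q w])
          moreover have "q \<bullet> (X *\<^sub>v w) = (X *\<^sub>v w) \<bullet> q"
            by (rule comm_scalar_prod[OF q Xc[OF w]])
          ultimately show "t * (- 2 * ((X *\<^sub>v w) \<bullet> q)) + t\<^sup>2 * - (q \<bullet> (X *\<^sub>v q)) \<le> t * 0"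
            using psd[OF wq] z by simp
        qed
        then show ?thesis by simp
      qed
      then have "X *\<^sub>v w = 0\<^sub>v m" by (intro vec_eq_if_scalar_prod_eq[OF Xc[OF w] zero_carrier_vec]) simp
      then have "v = 0\<^sub>v m" using XY(1)[OF v] by (simp add: w_def)
      then show False using nz Y(1) by simp
    qed
    then show "0 < (Y *\<^sub>v v) \<bullet>c v" using psd[OF w] Yq[OF v] by (simp add: w_def)
  qed
  moreover have "neg_semidef (A * Y + Y * mat_adjoint A)"
    unfolding neg_semidef_lyapunov[OF A Y(1) Y_sym]
  proof
    fix v :: "real vec" assume v: "v \<in> carrier_vec m"
    have w: "Y *\<^sub>v v \<in> carrier_vec m" by (rule Yc[OF v])
    have "v \<bullet> (A *\<^sub>v (Y *\<^sub>v v)) = (Y *\<^sub>v v) \<bullet> (X *\<^sub>v (A *\<^sub>v (Y *\<^sub>v v)))"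
      unfolding X_sym[OF Ac[OF w] w] XY(1)[OF v] ..
    then show "v \<bullet> ((A * Y) *\<^sub>v v) \<le> 0"
      using lyap[OF w] assoc_mult_mat_vec[OF A Y(1) v] by simp
  qed
  moreover have "B = - (A * Y * mat_adjoint C)"
    unfolding mat_adjoint_real
  proof (rule mat_eq_if_mult_vec_eq[OF B])
    have CT: "C\<^sup>T \<in> carrier_mat m n" using C by simp
    have AY: "A * Y \<in> carrier_mat m m" using A Y(1) by simp
    show "- (A * Y * C\<^sup>T) \<in> carrier_mat m n" using AY CT by simp
    fix g :: "real vec" assume g: "g \<in> carrier_vec n"
    have Cg: "C\<^sup>T *\<^sub>v g \<in> carrier_vec m" using CT g by simp
    have "X *\<^sub>v W g = C\<^sup>T *\<^sub>v g"
    proof (rule vec_eq_if_scalar_prod_eq[OF Xc[OF Wc[OF g]] Cg])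
      fix q :: "real vec" assume q: "q \<in> carrier_vec m"
      show "(X *\<^sub>v W g) \<bullet> q = (C\<^sup>T *\<^sub>v g) \<bullet> q"
        using XW[OF g q] X_sym[OF q Wc[OF g]] scalar_prod_transpose[OF C q g] by simp
    qed
    then have "W g = Y *\<^sub>v (C\<^sup>T *\<^sub>v g)" using XY(2)[OF Wc[OF g]] by simp
    then have "- (B *\<^sub>v g) = A *\<^sub>v (Y *\<^sub>v (C\<^sup>T *\<^sub>v g))" using AW[OF g] by simp
    also have "\<dots> = (A * Y * C\<^sup>T) *\<^sub>v g"
      using assoc_mult_mat_vec[OF A Y(1) Cg] assoc_mult_mat_vec[OF AY CT g] by simp
    finally have e: "- (B *\<^sub>v g) = (A * Y * C\<^sup>T) *\<^sub>v g" .
    have "- (A * Y * C\<^sup>T) *\<^sub>v g = - ((A * Y * C\<^sup>T) *\<^sub>v g)"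
      by (rule eq_vecI) (use A g C in auto)
    also have "\<dots> = B *\<^sub>v g" unfolding e[symmetric] by simp
    finally show "B *\<^sub>v g = - (A * Y * C\<^sup>T) *\<^sub>v g" ..
  qed
  ultimately show ?thesis using Y(1) by blast
qed

end

section \<open>The frequency response\<close>

lemma complex_form_entries:
  fixes M :: "complex mat"
  assumes "M \<in> carrier_mat r c" "h \<in> carrier_vec r" "g \<in> carrier_vec c"
  shows "conjugate h \<bullet> (M *\<^sub>v g) = (\<Sum>i<r. \<Sum>j<c. cnj (h $ i) * M $$ (i, j) * g $ j)"
proof -
  have "conjugate h \<bullet> (M *\<^sub>v g) = (\<Sum>i<r. cnj (h $ i) * (M *\<^sub>v g) $ i)"
    using assms by (simp add: scalar_prod_def[of "conjugate h"] lessThan_atLeast0 del: index_mult_mat_vec)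
  also have "\<dots> = (\<Sum>i<r. cnj (h $ i) * (\<Sum>j<c. M $$ (i, j) * g $ j))"
    by (intro sum.cong refl) (simp add: mult_mat_vec_entry[OF assms(1,3)] del: index_mult_mat_vec)
  finally show ?thesis by (simp add: sum_distrib_left mult.assoc)
qed

lemma real_matrix_form:
  fixes M :: "real mat"
  assumes M: "M \<in> carrier_mat m m" and z: "z \<in> carrier_vec m"
  defines "x \<equiv> vec m (\<lambda>i. Re (z $ i))" and "y \<equiv> vec m (\<lambda>i. Im (z $ i))"
  shows "Re (conjugate z \<bullet> (cmat M *\<^sub>v z)) = x \<bullet> (M *\<^sub>v x) + y \<bullet> (M *\<^sub>v y)"
    and "Im (conjugate z \<bullet> (cmat M *\<^sub>v z)) = x \<bullet> (M *\<^sub>v y) - y \<bullet> (M *\<^sub>v x)"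
proof -
  have cM: "cmat M \<in> carrier_mat m m" using M by simp
  have xc: "x \<in> carrier_vec m" and yc: "y \<in> carrier_vec m" by (simp_all add: x_def y_def)
  have form: "p \<bullet> (M *\<^sub>v q) = (\<Sum>i<m. \<Sum>j<m. p $ i * M $$ (i, j) * q $ j)"
    if p: "p \<in> carrier_vec m" and q: "q \<in> carrier_vec m" for p q :: "real vec"
  proof -
    have "p \<bullet> (M *\<^sub>v q) = (\<Sum>i<m. p $ i * (M *\<^sub>v q) $ i)"
      using M by (simp add: scalar_prod_def[of p] lessThan_atLeast0 del: index_mult_mat_vec)
    also have "\<dots> = (\<Sum>i<m. p $ i * (\<Sum>j<m. M $$ (i, j) * q $ j))"
      by (intro sum.cong refl) (simp add: mult_mat_vec_entry[OF M q] del: index_mult_mat_vec)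
    finally show ?thesis by (simp add: sum_distrib_left mult.assoc)
  qed
  have e: "cnj (z $ i) * cmat M $$ (i, j) * z $ j = of_real (M $$ (i, j)) * (cnj (z $ i) * z $ j)"
    if "i < m" "j < m" for i j
    using that M by (simp add: mult_ac)
  have re: "Re (cnj (z $ i) * cmat M $$ (i, j) * z $ j) = x $ i * M $$ (i, j) * x $ j + y $ i * M $$ (i, j) * y $ j"
    if "i < m" "j < m" for i j
    unfolding e[OF that] using that by (simp add: x_def y_def algebra_simps)
  have im: "Im (cnj (z $ i) * cmat M $$ (i, j) * z $ j) = x $ i * M $$ (i, j) * y $ j - y $ i * M $$ (i, j) * x $ j"
    if "i < m" "j < m" for i j
    unfolding e[OF that] using that by (simp add: x_def y_def algebra_simps)
  show "Re (conjugate z \<bullet> (cmat M *\<^sub>v z)) = x \<bullet> (M *\<^sub>v x) + y \<bullet> (M *\<^sub>v y)"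
    unfolding complex_form_entries[OF cM z z] Re_sum form[OF xc xc] form[OF yc yc] sum.distrib[symmetric]
    by (intro sum.cong refl re) auto
  show "Im (conjugate z \<bullet> (cmat M *\<^sub>v z)) = x \<bullet> (M *\<^sub>v y) - y \<bullet> (M *\<^sub>v x)"
    unfolding complex_form_entries[OF cM z z] Im_sum form[OF xc yc] form[OF yc xc] sum_subtractf[symmetric]
    by (intro sum.cong refl im) auto
qed

lemma symmetric_form_real:
  fixes M :: "real mat"
  assumes M: "M \<in> carrier_mat m m" and sym: "M\<^sup>T = M" and z: "z \<in> carrier_vec m"
  shows "Im (conjugate z \<bullet> (cmat M *\<^sub>v z)) = 0"
proof -
  define x y where "x = vec m (\<lambda>i. Re (z $ i))" and "y = vec m (\<lambda>i. Im (z $ i))"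
  have c: "x \<in> carrier_vec m" "y \<in> carrier_vec m" by (simp_all add: x_def y_def)
  have "x \<bullet> (M *\<^sub>v y) = y \<bullet> (M *\<^sub>v x)"
    using scalar_prod_transpose[OF M c(2,1)] comm_scalar_prod[OF c(2) mult_mat_vec_carrier[OF M c(1)]] sym by simp
  then show ?thesis unfolding real_matrix_form(2)[OF M z] x_def y_def by simp
qed

text \<open>At \<open>z = e\<^sub>a + \<i> e\<^sub>b\<close> the imaginary part is \<open>M\<^sub>a\<^sub>b - M\<^sub>b\<^sub>a\<close>.\<close>
lemma Im_form_nonpos_imp_symmetric:
  fixes M :: "real mat"
  assumes M: "M \<in> carrier_mat m m" and le: "\<And>z. z \<in> carrier_vec m \<Longrightarrow> Im (conjugate z \<bullet> (cmat M *\<^sub>v z)) \<le> 0"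
  shows "M\<^sup>T = M"
proof -
  have 1: "M $$ (a, b) \<le> M $$ (b, a)" if ab: "a < m" "b < m" for a b
  proof -
    define z where "z = vec m (\<lambda>i. Complex (unit_vec m a $ i) (unit_vec m b $ i))"
    have z: "z \<in> carrier_vec m" by (simp add: z_def)
    have x: "vec m (\<lambda>i. Re (z $ i)) = unit_vec m a" and y: "vec m (\<lambda>i. Im (z $ i)) = unit_vec m b"
      by (rule eq_vecI; simp add: z_def)+
    have "unit_vec m a \<bullet> (M *\<^sub>v unit_vec m b) = M $$ (a, b)" "unit_vec m b \<bullet> (M *\<^sub>v unit_vec m a) = M $$ (b, a)"
      using ab M by (simp_all add: scalar_prod_left_unit scalar_prod_right_unit)
    then show ?thesis using le[OF z] real_matrix_form(2)[OF M z] unfolding x y by simp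
  qed
  show ?thesis by (rule eq_matI) (use M 1 in \<open>auto intro!: antisym\<close>)
qed

text \<open>The matrix \<open>\<i> (M - M\<^sup>*)\<close> is Hermitian, with quadratic form \<open>- 2 Im (g\<^sup>* M g)\<close>.\<close>
lemma pos_semidef_imaginary_part:
  fixes M :: "complex mat"
  assumes M: "M \<in> carrier_mat n n"
  shows "pos_semidef (\<i> \<cdot>\<^sub>m (M - mat_adjoint M)) \<longleftrightarrow> (\<forall>g \<in> carrier_vec n. Im (conjugate g \<bullet> (M *\<^sub>v g)) \<le> 0)"
proof -
  define H where "H = \<i> \<cdot>\<^sub>m (M - mat_adjoint M)"
  have H: "H \<in> carrier_mat n n" unfolding H_def
    by (intro smult_carrier_mat minus_carrier_mat mat_adjoint_carrier M)
  have entry: "H $$ (i, j) = \<i> * (M $$ (i, j) - cnj (M $$ (j, i)))" if "i < n" "j < n" for i j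
    using that M by (simp add: H_def mat_adjoint_entry[OF M] mat_adjoint_carrier[OF M, THEN carrier_matD(1)]
        mat_adjoint_carrier[OF M, THEN carrier_matD(2)])
  have herm: "mat_adjoint H = H"
    by (rule eq_matI) (use H mat_adjoint_carrier[OF H, THEN carrier_matD(1)] mat_adjoint_carrier[OF H, THEN carrier_matD(2)]
        in \<open>auto simp: mat_adjoint_entry[OF H] entry algebra_simps\<close>)
  have form: "(H *\<^sub>v g) \<bullet>c g = of_real (- 2 * Im (conjugate g \<bullet> (M *\<^sub>v g)))"
    if g: "g \<in> carrier_vec n" for g
  proof -
    define q where "q = conjugate g \<bullet> (M *\<^sub>v g)"
    have q: "q = (\<Sum>i<n. \<Sum>j<n. cnj (g $ i) * M $$ (i, j) * g $ j)"
      unfolding q_def by (rule complex_form_entries[OF M g g])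
    have "cnj q = (\<Sum>i<n. \<Sum>j<n. g $ i * cnj (M $$ (i, j)) * cnj (g $ j))" unfolding q by simp
    also have "\<dots> = (\<Sum>i<n. \<Sum>j<n. g $ j * cnj (M $$ (j, i)) * cnj (g $ i))" by (rule sum.swap)
    finally have q': "cnj q = (\<Sum>i<n. \<Sum>j<n. cnj (g $ i) * cnj (M $$ (j, i)) * g $ j)" by (simp add: mult_ac)
    have "(H *\<^sub>v g) \<bullet>c g = conjugate g \<bullet> (H *\<^sub>v g)"
      by (rule conjugate_vec_sprod_comm[OF mult_mat_vec_carrier[OF H g] g])
    also have "\<dots> = (\<Sum>i<n. \<Sum>j<n. \<i> * (cnj (g $ i) * M $$ (i, j) * g $ j - cnj (g $ i) * cnj (M $$ (j, i)) * g $ j))"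
      unfolding complex_form_entries[OF H g g] by (intro sum.cong refl) (simp add: entry algebra_simps)
    also have "\<dots> = \<i> * (q - cnj q)"
      unfolding q' unfolding q sum_subtractf[symmetric] sum_distrib_left ..
    also have "\<dots> = of_real (- 2 * Im q)" by (simp add: complex_eq_iff)
    finally show ?thesis unfolding q_def .
  qed
  have "pos_semidef H \<longleftrightarrow> (\<forall>g \<in> carrier_vec n. 0 \<le> (H *\<^sub>v g) \<bullet>c g)"
    unfolding pos_semidef_def using H herm by auto
  also have "\<dots> \<longleftrightarrow> (\<forall>g \<in> carrier_vec n. Im (conjugate g \<bullet> (M *\<^sub>v g)) \<le> 0)"
    by (intro ball_cong refl) (simp add: form less_eq_complex_def)
  finally show ?thesis unfolding H_def .
qed

lemma conjugate_cmat_vec: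
  assumes M: "M \<in> carrier_mat r c" and v: "v \<in> carrier_vec c"
  shows "conjugate (cmat M *\<^sub>v v) = cmat M *\<^sub>v conjugate v"
proof (rule eq_vecI)
  fix i assume "i < dim_vec (cmat M *\<^sub>v conjugate v)"
  then have i: "i < r" using M by simp
  have cM: "cmat M \<in> carrier_mat r c" using M by simp
  have "conjugate (cmat M *\<^sub>v v) $ i = cnj ((cmat M *\<^sub>v v) $ i)" using i M by simp
  also have "\<dots> = (\<Sum>j<c. cmat M $$ (i, j) * cnj (v $ j))"
    unfolding mult_mat_vec_entry[OF cM v i] using i M by simp
  also have "\<dots> = (cmat M *\<^sub>v conjugate v) $ i"
    unfolding mult_mat_vec_entry[OF cM carrier_vec_conjugate[OF v] i] using v by simp
  finally show "conjugate (cmat M *\<^sub>v v) $ i = (cmat M *\<^sub>v conjugate v) $ i" .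
qed (use M in simp)

lemma cmat_form_transpose:
  assumes M: "M \<in> carrier_mat r c" and h: "h \<in> carrier_vec r" and g: "g \<in> carrier_vec c"
  shows "conjugate h \<bullet> (cmat M *\<^sub>v g) = conjugate (cmat (M\<^sup>T) *\<^sub>v h) \<bullet> g"
proof -
  have cM: "cmat M \<in> carrier_mat r c" and MT: "M\<^sup>T \<in> carrier_mat c r" using M by auto
  have "conjugate h \<bullet> (cmat M *\<^sub>v g) = ((cmat M)\<^sup>T *\<^sub>v conjugate h) \<bullet> g"
    by (rule scalar_prod_transpose[OF cM g carrier_vec_conjugate[OF h]])
  then show ?thesis unfolding map_mat_transpose conjugate_cmat_vec[OF MT h] .
qed

lemma eigenvalue_free_solution:
  fixes M :: "complex mat"
  assumes M: "M \<in> carrier_mat m m" and z: "\<not> eigenvalue M z" and b: "b \<in> carrier_vec m"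
  shows "\<exists>w \<in> carrier_vec m. z \<cdot>\<^sub>v w = M *\<^sub>v w + b"
proof -
  have zM: "z \<cdot>\<^sub>m 1\<^sub>m m - M \<in> carrier_mat m m" by (rule minus_carrier_mat[OF M])
  have Mc: "M *\<^sub>v v \<in> carrier_vec m" if "v \<in> carrier_vec m" for v using M that by simp
  have solve: "z \<cdot>\<^sub>v v = M *\<^sub>v v + a" if v: "v \<in> carrier_vec m"
    and a: "a \<in> carrier_vec m" and e: "(z \<cdot>\<^sub>m 1\<^sub>m m - M) *\<^sub>v v = a" for v a
  proof (rule eq_vecI)
    fix i assume "i < dim_vec (M *\<^sub>v v + a)"
    then have i: "i < m" using a by simp
    have "(z \<cdot>\<^sub>v v - M *\<^sub>v v) $ i = a $ i" using e unfolding char_matrix_mult_vec[OF M v] by simp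
    then show "(z \<cdot>\<^sub>v v) $ i = (M *\<^sub>v v + a) $ i" using i v a Mc[OF v] M
      by (simp add: diff_eq_eq add.commute del: index_mult_mat_vec)
  qed (use v a in simp)
  have "v = 0\<^sub>v m" if v: "v \<in> carrier_vec m"
    and 0: "(z \<cdot>\<^sub>m 1\<^sub>m m - M) *\<^sub>v v = 0\<^sub>v m" for v
  proof (rule ccontr)
    assume "v \<noteq> 0\<^sub>v m"
    moreover have "M *\<^sub>v v = z \<cdot>\<^sub>v v" using solve[OF v zero_carrier_vec 0] Mc[OF v] by simp
    ultimately show False using z M v unfolding eigenvalue_def eigenvector_def by auto
  qed
  then obtain N where N: "N \<in> carrier_mat m m" "(z \<cdot>\<^sub>m 1\<^sub>m m - M) * N = 1\<^sub>m m"
    using invertible_if_kernel_trivial[OF zM] by blast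
  have Nb: "N *\<^sub>v b \<in> carrier_vec m" using N b by simp
  have "(z \<cdot>\<^sub>m 1\<^sub>m m - M) *\<^sub>v (N *\<^sub>v b) = b"
    using assoc_mult_mat_vec[OF zM N(1) b] N(2) b by simp
  from solve[OF Nb b this] Nb show ?thesis by blast
qed

context linear_system
begin

lemma lmi_imp_freq_passive:
  assumes Y: "Y \<in> carrier_mat m m" and pd: "pos_def Y"
    and nsd: "neg_semidef (A * Y + Y * mat_adjoint A)" and BY: "B = - (A * Y * mat_adjoint C)"
  shows "freq_passive A B C"
  unfolding freq_passive_def
proof (intro allI ballI impI)
  fix \<omega> :: real and w g
  assume "w \<in> carrier_vec (dim_row A)" "g \<in> carrier_vec (dim_col B)"
    and eq: "(\<i> * of_real \<omega>) \<cdot>\<^sub>v w = cmat A *\<^sub>v w + cmat B *\<^sub>v g"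
  then have w: "w \<in> carrier_vec m" and g: "g \<in> carrier_vec n" using A B by auto
  define v where "v = (\<i> * complex_of_real \<omega>) \<cdot>\<^sub>v w"
  have v: "v \<in> carrier_vec m" using w by (simp add: v_def)
  have CT: "C\<^sup>T \<in> carrier_mat m n" and AY: "A * Y \<in> carrier_mat m m"
    using A C Y by auto
  have cA: "cmat A \<in> carrier_mat m m" and cY: "cmat Y \<in> carrier_mat m m"
    and cCT: "cmat (C\<^sup>T) \<in> carrier_mat m n"
    and cC: "cmat C \<in> carrier_mat n m" and cAY: "cmat (A * Y) \<in> carrier_mat m m"
    using A Y C CT AY by auto
  have Y_sym: "Y\<^sup>T = Y" using pd unfolding pos_def_def mat_adjoint_real by simp
  define p where "p = cmat (C\<^sup>T) *\<^sub>v g"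
  have p: "p \<in> carrier_vec m" using cCT g by (simp add: p_def)
  have "x = 0\<^sub>v m" if x: "x \<in> carrier_vec m" and 0: "cmat Y *\<^sub>v x = 0\<^sub>v m" for x
  proof -
    define a b where "a = vec m (\<lambda>i. Re (x $ i))" and "b = vec m (\<lambda>i. Im (x $ i))"
    have ab: "a \<in> carrier_vec m" "b \<in> carrier_vec m" by (simp_all add: a_def b_def)
    have pos: "0 < c \<bullet> (Y *\<^sub>v c)" if "c \<in> carrier_vec m" "c \<noteq> 0\<^sub>v m" for c
      using pd that Y comm_scalar_prod[OF that(1) mult_mat_vec_carrier[OF Y that(1)]] unfolding pos_def_def by simp
    have "a \<bullet> (Y *\<^sub>v a) + b \<bullet> (Y *\<^sub>v b) = 0"
      using real_matrix_form(1)[OF Y x] x unfolding 0 a_def b_def by simp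
    moreover have "0 \<le> c \<bullet> (Y *\<^sub>v c)" if "c \<in> carrier_vec m" for c
      using pos[OF that] Y that by (cases "c = 0\<^sub>v m") (auto simp: mult_mat_zero_vec[OF Y])
    ultimately have "a = 0\<^sub>v m" "b = 0\<^sub>v m" using pos ab by (metis add_nonneg_eq_0_iff less_irrefl)+
    then have "Re (x $ i) = 0" "Im (x $ i) = 0" if "i < m" for i
      using that by (auto simp: a_def b_def vec_eq_iff)
    then show ?thesis using x by (intro eq_vecI) (auto simp: complex_eq_iff)
  qed
  then obtain Z where Z: "Z \<in> carrier_mat m m" "cmat Y * Z = 1\<^sub>m m"
    using invertible_if_kernel_trivial[OF cY] by blast
  \<comment> \<open>With \<open>s = Y\<^sup>-\<^sup>1 w\<close> and \<open>z = s - p\<close> the velocity is both \<open>A Y z\<close> and \<open>\<i> \<omega> Y s\<close>.\<close>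
  define s where "s = Z *\<^sub>v w"
  have s: "s \<in> carrier_vec m" using Z w by (simp add: s_def)
  have Ys: "cmat Y *\<^sub>v s = w" using assoc_mult_mat_vec[OF cY Z(1) w] Z(2) w by (simp add: s_def)
  define z where "z = s - p"
  have z: "z \<in> carrier_vec m" using s p by (simp add: z_def)
  have Bg: "cmat B *\<^sub>v g = - (cmat (A * Y) *\<^sub>v p)"
  proof -
    have "cmat B = (-1) \<cdot>\<^sub>m (cmat (A * Y) * cmat (C\<^sup>T))"
      unfolding BY mat_adjoint_real of_real_hom.mat_hom_mult[OF AY CT, symmetric] by (rule eq_matI) auto
    then have "cmat B *\<^sub>v g = (-1) \<cdot>\<^sub>v ((cmat (A * Y) * cmat (C\<^sup>T)) *\<^sub>v g)"
      using smult_mat_mult_vec[OF mult_carrier_mat[OF cAY cCT] g] by simp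
    moreover have "(-1) \<cdot>\<^sub>v x = - x" for x :: "complex vec" by auto
    ultimately show ?thesis unfolding p_def assoc_mult_mat_vec[OF cAY cCT g] by metis
  qed
  have "cmat A *\<^sub>v w = cmat (A * Y) *\<^sub>v s"
    unfolding of_real_hom.mat_hom_mult[OF A Y] using assoc_mult_mat_vec[OF cA cY s] Ys by simp
  then have vz: "v = cmat (A * Y) *\<^sub>v z"
    unfolding v_def eq Bg z_def mult_minus_distrib_mat_vec[OF cAY s p]
    using mult_mat_vec_carrier[OF cAY s] mult_mat_vec_carrier[OF cAY p] by (intro eq_vecI) auto
  have "conjugate s \<bullet> v = (\<i> * complex_of_real \<omega>) * (conjugate s \<bullet> (cmat Y *\<^sub>v s))"
    unfolding v_def Ys using scalar_prod_smult_distrib[OF carrier_vec_conjugate[OF s] w] by simp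
  then have 1: "Re (conjugate s \<bullet> v) = 0" using symmetric_form_real[OF Y Y_sym s] by simp
  have 2: "Re (conjugate z \<bullet> v) \<le> 0"
  proof -
    have le: "c \<bullet> ((A * Y) *\<^sub>v c) \<le> 0" if "c \<in> carrier_vec m" for c
      using nsd that unfolding neg_semidef_lyapunov[OF A Y Y_sym] by blast
    show ?thesis unfolding vz real_matrix_form(1)[OF AY z] by (intro add_nonpos_nonpos le) auto
  qed
  have "conjugate z = conjugate s - conjugate p" by (rule eq_vecI) (use s p in \<open>auto simp: z_def\<close>)
  then have "conjugate z \<bullet> v = conjugate s \<bullet> v - conjugate p \<bullet> v"
    using minus_scalar_prod_distrib[OF carrier_vec_conjugate[OF s] carrier_vec_conjugate[OF p] v] by simp
  then have "0 \<le> Re (conjugate p \<bullet> v)" using 1 2 by simp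
  then show "0 \<le> Re (conjugate g \<bullet> (cmat C *\<^sub>v ((\<i> * of_real \<omega>) \<cdot>\<^sub>v w)))"
    using cmat_form_transpose[OF C g v] unfolding v_def p_def by simp
qed

end

context stable_system
begin

lemma imaginary_axis_regular: "\<not> eigenvalue (cmat A) (\<i> * complex_of_real \<omega>)"
  using hurwitz unfolding hurwitz_def by fastforce

lemma freq_passive_supply:
  assumes w: "w \<in> carrier_vec m" and g: "g \<in> carrier_vec n"
  shows "Re (conjugate g \<bullet> (cmat C *\<^sub>v ((\<i> * complex_of_real \<omega>) \<cdot>\<^sub>v w))) = - \<omega> * Im (conjugate g \<bullet> (cmat C *\<^sub>v w))"
proof -
  have cC: "cmat C \<in> carrier_mat n m" using C by simp
  show ?thesis
    unfolding mult_mat_vec[OF cC w] scalar_prod_smult_distrib[OF carrier_vec_conjugate[OF g] mult_mat_vec_carrier[OF cC w]]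
    by simp
qed

lemma transfer_form:
  assumes D: "D \<in> carrier_mat n n" and w: "w \<in> carrier_vec m" and g: "g \<in> carrier_vec n"
    and eq: "(\<i> * complex_of_real \<omega>) \<cdot>\<^sub>v w = cmat A *\<^sub>v w + cmat B *\<^sub>v g"
  shows "conjugate g \<bullet> (tfm_eval (transfer_mat A B C D) (\<i> * complex_of_real \<omega>) *\<^sub>v g)
    = conjugate g \<bullet> (cmat C *\<^sub>v w) + conjugate g \<bullet> (cmat D *\<^sub>v g)"
proof -
  have cC: "cmat C \<in> carrier_mat n m" and cD: "cmat D \<in> carrier_mat n n" using C D by auto
  show ?thesis
    unfolding transfer_mat_regular(2)[OF A B C D imaginary_axis_regular w g eq]
    by (rule scalar_prod_add_distrib[OF carrier_vec_conjugate[OF g] mult_mat_vec_carrier[OF cC w] mult_mat_vec_carrier[OF cD g]])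
qed

lemma oscillation_exists:
  assumes g: "g \<in> carrier_vec n"
  shows "\<exists>w \<in> carrier_vec m. (\<i> * complex_of_real \<omega>) \<cdot>\<^sub>v w = cmat A *\<^sub>v w + cmat B *\<^sub>v g"
proof -
  have cA: "cmat A \<in> carrier_mat m m" and cB: "cmat B \<in> carrier_mat m n" using A B by auto
  show ?thesis by (rule eigenvalue_free_solution[OF cA imaginary_axis_regular mult_mat_vec_carrier[OF cB g]])
qed

text \<open>As \<open>\<omega>\<close> tends to infinity, \<open>R(\<i> \<omega>)\<close> tends to \<open>D\<close>.  Quantitatively, \<open>\<i> \<omega> w = A w + B g\<close>
  bounds the sum norm of \<open>w\<close> by \<open>b / (\<omega> - a)\<close>, where \<open>a\<close> and \<open>b\<close> are the sums of the moduli
  of the entries of \<open>A\<close> and \<open>B g\<close>.\<close>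
lemma feedthrough_symmetric:
  assumes D: "D \<in> carrier_mat n n"
    and NI: "\<And>\<omega> g. 0 < \<omega> \<Longrightarrow> g \<in> carrier_vec n \<Longrightarrow>
      Im (conjugate g \<bullet> (tfm_eval (transfer_mat A B C D) (\<i> * complex_of_real \<omega>) *\<^sub>v g)) \<le> 0"
  shows "D\<^sup>T = D"
proof (rule Im_form_nonpos_imp_symmetric[OF D])
  fix g :: "complex vec" assume g: "g \<in> carrier_vec n"
  have cA: "cmat A \<in> carrier_mat m m" and cB: "cmat B \<in> carrier_mat m n"
    and cC: "cmat C \<in> carrier_mat n m" using A B C by auto
  define a where "a = (\<Sum>i<m. \<Sum>j<m. norm (cmat A $$ (i, j)))"
  define b where "b = (\<Sum>i<m. norm ((cmat B *\<^sub>v g) $ i))"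
  define c where "c = (\<Sum>i<n. \<Sum>j<m. norm (cnj (g $ i) * cmat C $$ (i, j)))"
  have abc: "0 \<le> a" "0 \<le> b" "0 \<le> c" unfolding a_def b_def c_def by (intro sum_nonneg norm_ge_zero)+
  define d where "d = Im (conjugate g \<bullet> (cmat D *\<^sub>v g))"
  have bound: "d * t \<le> c * b" if t: "0 < t" for t
  proof -
    obtain w where w: "w \<in> carrier_vec m"
      and eq: "(\<i> * complex_of_real (a + t)) \<cdot>\<^sub>v w = cmat A *\<^sub>v w + cmat B *\<^sub>v g"
      using oscillation_exists[OF g] by blast
    define l where "l = (\<Sum>i<m. norm (w $ i))"
    have l: "norm (w $ j) \<le> l" if "j < m" for j unfolding l_def using that by (intro member_le_sum) auto
    have l0: "0 \<le> l" unfolding l_def by (intro sum_nonneg norm_ge_zero)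
    have "(a + t) * norm (w $ i) \<le> (\<Sum>j<m. norm (cmat A $$ (i, j))) * l + norm ((cmat B *\<^sub>v g) $ i)"
      if i: "i < m" for i
    proof -
      have "(\<i> * complex_of_real (a + t)) * w $ i = (cmat A *\<^sub>v w) $ i + (cmat B *\<^sub>v g) $ i"
        using arg_cong[OF eq, of "\<lambda>x. x $ i"] i w A B by (simp del: index_mult_mat_vec)
      then have "norm ((\<i> * complex_of_real (a + t)) * w $ i) \<le> norm ((cmat A *\<^sub>v w) $ i) + norm ((cmat B *\<^sub>v g) $ i)"
        by (metis norm_triangle_ineq)
      moreover have "norm ((\<i> * complex_of_real (a + t)) * w $ i) = (a + t) * norm (w $ i)"
        unfolding norm_mult using abc t by (simp del: of_real_add)
      moreover have "norm ((cmat A *\<^sub>v w) $ i) \<le> (\<Sum>j<m. norm (cmat A $$ (i, j)) * l)"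
        unfolding mult_mat_vec_entry[OF cA w i]
        by (rule order_trans[OF norm_sum]) (intro sum_mono, simp only: norm_mult, intro mult_left_mono l norm_ge_zero, simp)
      ultimately show ?thesis by (simp add: sum_distrib_right)
    qed
    then have "(\<Sum>i<m. (a + t) * norm (w $ i)) \<le> (\<Sum>i<m. (\<Sum>j<m. norm (cmat A $$ (i, j))) * l + norm ((cmat B *\<^sub>v g) $ i))"
      by (intro sum_mono) blast
    then have "(a + t) * l \<le> a * l + b"
      unfolding l_def a_def b_def sum.distrib sum_distrib_left[symmetric] sum_distrib_right[symmetric] .
    then have tl: "t * l \<le> b" by (simp add: distrib_right)
    have "norm (conjugate g \<bullet> (cmat C *\<^sub>v w)) \<le> c * l"
    proof -
      have "norm (conjugate g \<bullet> (cmat C *\<^sub>v w)) \<le> (\<Sum>i<n. \<Sum>j<m. norm (cnj (g $ i) * cmat C $$ (i, j) * w $ j))"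
        unfolding complex_form_entries[OF cC g w] by (rule order_trans[OF norm_sum]) (intro sum_mono norm_sum)
      also have "\<dots> \<le> (\<Sum>i<n. \<Sum>j<m. norm (cnj (g $ i) * cmat C $$ (i, j)) * l)"
        by (intro sum_mono) (subst norm_mult, intro mult_left_mono l norm_ge_zero, simp)
      also have "\<dots> = c * l" by (simp only: c_def sum_distrib_right)
      finally show ?thesis .
    qed
    then have "- Im (conjugate g \<bullet> (cmat C *\<^sub>v w)) \<le> c * l"
      using abs_Im_le_cmod order_trans abs_le_D2 by blast
    moreover have "Im (conjugate g \<bullet> (cmat C *\<^sub>v w)) + d \<le> 0"
      using NI[of "a + t", OF _ g] abc t unfolding transfer_form[OF D w g eq] d_def by simp
    ultimately have "d \<le> c * l" by simp
    then have "d * t \<le> c * l * t" using t by (simp add: mult_right_mono)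
    also have "\<dots> = c * (t * l)" by simp
    also have "\<dots> \<le> c * b" using tl abc by (intro mult_left_mono)
    finally show ?thesis .
  qed
  show "Im (conjugate g \<bullet> (cmat D *\<^sub>v g)) \<le> 0"
  proof (rule ccontr)
    assume "\<not> ?thesis"
    then have d: "0 < d" by (simp add: d_def)
    have "0 < (c * b + 1) / d" using d abc by (intro divide_pos_pos add_nonneg_pos) auto
    from bound[OF this] show False using d by simp
  qed
qed

lemma NI_imp_freq_passive:
  assumes D: "D \<in> carrier_mat n n" and sym: "D\<^sup>T = D"
    and NI: "\<And>\<omega> g. 0 < \<omega> \<Longrightarrow> g \<in> carrier_vec n \<Longrightarrow>
      Im (conjugate g \<bullet> (tfm_eval (transfer_mat A B C D) (\<i> * complex_of_real \<omega>) *\<^sub>v g)) \<le> 0"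
  shows "freq_passive A B C"
proof -
  have cA: "cmat A \<in> carrier_mat m m" and cB: "cmat B \<in> carrier_mat m n"
    and cC: "cmat C \<in> carrier_mat n m" using A B C by auto
  have pos: "0 \<le> Re (conjugate g \<bullet> (cmat C *\<^sub>v ((\<i> * complex_of_real \<omega>) \<cdot>\<^sub>v w)))"
    if \<omega>: "0 < \<omega>" and w: "w \<in> carrier_vec m" and g: "g \<in> carrier_vec n"
      and eq: "(\<i> * complex_of_real \<omega>) \<cdot>\<^sub>v w = cmat A *\<^sub>v w + cmat B *\<^sub>v g"
        for \<omega> w g
  proof -
    have "Im (conjugate g \<bullet> (cmat C *\<^sub>v w)) \<le> 0"
      using NI[OF \<omega> g] symmetric_form_real[OF D sym g] unfolding transfer_form[OF D w g eq] by simp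
    then show ?thesis unfolding freq_passive_supply[OF w g] using \<omega> by (simp add: mult_nonneg_nonpos)
  qed
  show ?thesis
    unfolding freq_passive_def
  proof (intro allI ballI impI)
    fix \<omega> :: real and w g
    assume "w \<in> carrier_vec (dim_row A)" "g \<in> carrier_vec (dim_col B)"
      and eq: "(\<i> * of_real \<omega>) \<cdot>\<^sub>v w = cmat A *\<^sub>v w + cmat B *\<^sub>v g"
    then have w: "w \<in> carrier_vec m" and g: "g \<in> carrier_vec n" using A B by auto
    note w' = carrier_vec_conjugate[OF w] and g' = carrier_vec_conjugate[OF g]
    consider "\<omega> > 0" | "\<omega> = 0" | "\<omega> < 0" by linarith
    then show "0 \<le> Re (conjugate g \<bullet> (cmat C *\<^sub>v ((\<i> * of_real \<omega>) \<cdot>\<^sub>v w)))"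
    proof cases
      case 1
      then show ?thesis by (rule pos[OF _ w g eq])
    next
      case 2
      then show ?thesis unfolding freq_passive_supply[OF w g] by simp
    next
      case 3
      \<comment> \<open>The conjugate oscillation has frequency \<open>- \<omega>\<close>.\<close>
      have "(\<i> * complex_of_real (- \<omega>)) \<cdot>\<^sub>v conjugate w = conjugate ((\<i> * of_real \<omega>) \<cdot>\<^sub>v w)"
        unfolding conjugate_smult_vec by simp
      also have "\<dots> = cmat A *\<^sub>v conjugate w + cmat B *\<^sub>v conjugate g"
        unfolding eq conjugate_add_vec[OF mult_mat_vec_carrier[OF cA w] mult_mat_vec_carrier[OF cB g]]
          conjugate_cmat_vec[OF A w] conjugate_cmat_vec[OF B g] ..
      finally have eq': "(\<i> * complex_of_real (- \<omega>)) \<cdot>\<^sub>v conjugate w = cmat A *\<^sub>v conjugate w + cmat B *\<^sub>v conjugate g" .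
      have "0 \<le> Re (conjugate (conjugate g) \<bullet> (cmat C *\<^sub>v ((\<i> * complex_of_real (- \<omega>)) \<cdot>\<^sub>v conjugate w)))"
        by (rule pos[OF _ w' g' eq']) (use 3 in simp)
      then have "0 \<le> \<omega> * Im (conjugate (conjugate g) \<bullet> (cmat C *\<^sub>v conjugate w))"
        unfolding freq_passive_supply[OF w' g'] by simp
      moreover have "conjugate (conjugate g) \<bullet> (cmat C *\<^sub>v conjugate w) = conjugate (conjugate g \<bullet> (cmat C *\<^sub>v w))"
        unfolding conjugate_cmat_vec[OF C w, symmetric]
        by (rule conjugate_sprod_vec[OF g' mult_mat_vec_carrier[OF cC w], symmetric])
      ultimately show ?thesis unfolding freq_passive_supply[OF w g] by simp
    qed
  qed
qed

lemma freq_passive_imp_NI: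
  assumes D: "D \<in> carrier_mat n n" and sym: "D\<^sup>T = D" and fp: "freq_passive A B C"
    and \<omega>: "0 < \<omega>" and g: "g \<in> carrier_vec n"
  shows "Im (conjugate g \<bullet> (tfm_eval (transfer_mat A B C D) (\<i> * complex_of_real \<omega>) *\<^sub>v g)) \<le> 0"
proof -
  obtain w where w: "w \<in> carrier_vec m"
    and eq: "(\<i> * complex_of_real \<omega>) \<cdot>\<^sub>v w = cmat A *\<^sub>v w + cmat B *\<^sub>v g"
    using oscillation_exists[OF g] by blast
  have "0 \<le> Re (conjugate g \<bullet> (cmat C *\<^sub>v ((\<i> * complex_of_real \<omega>) \<cdot>\<^sub>v w)))"
    using fp eq w g A B unfolding freq_passive_def by auto
  then have "\<omega> * Im (conjugate g \<bullet> (cmat C *\<^sub>v w)) \<le> 0"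
    unfolding freq_passive_supply[OF w g] by simp
  then have "Im (conjugate g \<bullet> (cmat C *\<^sub>v w)) \<le> 0" using \<omega> by (simp add: mult_le_0_iff)
  then show ?thesis unfolding transfer_form[OF D w g eq] using symmetric_form_real[OF D sym g] by simp
qed

end

theorem lemma1:
  fixes n m :: nat and R :: "ratfun mat" and A B C D :: "real mat"
  assumes "n \<ge> 1"
    and "R \<in> carrier_mat n n" and "proper_tfm R"
    and "A \<in> carrier_mat m m" and "B \<in> carrier_mat m n"
    and "C \<in> carrier_mat n m" and "D \<in> carrier_mat n n"
    and "minimal_realisation R A B C D"
  shows "R \<in> NI_class n \<longleftrightarrow>
    hurwitz A \<and> D = mat_adjoint D \<and>
    (\<exists>Y \<in> carrier_mat m m. pos_def Y \<and>
       neg_semidef (A * Y + Y * mat_adjoint A) \<and>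
       B = - (A * Y * mat_adjoint C))"
proof -
  note n = assms(1) and R = assms(2) and A = assms(4) and B = assms(5) and C = assms(6) and D = assms(7)
  have Req: "R = transfer_mat A B C D" and co: "controllable A B" and ob: "observable C A"
    using assms(8) unfolding minimal_realisation_def by auto
  define form where "form \<omega> g = Im (conjugate g \<bullet> (tfm_eval R (\<i> * complex_of_real \<omega>) *\<^sub>v g))" for \<omega> g
  have RH: "R \<in> RH_inf n \<longleftrightarrow> stable_tfm R" using R assms(3) unfolding RH_inf_def by simp
  have NI: "R \<in> NI_class n \<longleftrightarrow> stable_tfm R \<and> (\<forall>\<omega>. 0 < \<omega> \<longrightarrow> (\<forall>g \<in> carrier_vec n. form \<omega> g \<le> 0))"
    unfolding NI_class_def mem_Collect_eq RH form_def pos_semidef_imaginary_part[OF tfm_eval_carrier[OF R]] ..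
  have stable: "stable_tfm R \<longleftrightarrow> hurwitz A"
  proof
    assume s: "stable_tfm R"
    show "hurwitz A"
      unfolding hurwitz_def
    proof (intro allI impI)
      fix z assume z: "eigenvalue (cmat A) z"
      have "\<not> regular_at R z"
        using minimal_regular_not_eigenvalue[OF n A B C D co ob] z unfolding Req by blast
      then show "Re z < 0" using s unfolding regular_at_def stable_tfm_def by blast
    qed
  next
    assume h: "hurwitz A"
    show "stable_tfm R"
      unfolding stable_tfm_def
    proof (intro allI impI)
      fix i j z assume ij: "i < dim_row R" "j < dim_col R" and "rf_pole (R $$ (i, j)) z"
      then have "\<not> regular_at R z" unfolding regular_at_def by blast
      then have "eigenvalue (cmat A) z" using transfer_mat_regular(1)[OF A B C D] unfolding Req by blast
      then show "Re z < 0" using h unfolding hurwitz_def by blast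
    qed
  qed
  \<comment> \<open>With \<open>A\<close> Hurwitz, both sides amount to \<open>D\<close> being symmetric and \<open>freq_passive A B C\<close>.\<close>
  have main: "(\<forall>\<omega>. 0 < \<omega> \<longrightarrow> (\<forall>g \<in> carrier_vec n. form \<omega> g \<le> 0)) \<longleftrightarrow> D = mat_adjoint D \<and>
    (\<exists>Y \<in> carrier_mat m m. pos_def Y \<and> neg_semidef (A * Y + Y * mat_adjoint A) \<and> B = - (A * Y * mat_adjoint C))"
    if h: "hurwitz A"
  proof -
    interpret stable_system m n A B C by unfold_locales (fact A B C h)+
    show ?thesis
    proof
      assume f: "\<forall>\<omega>. 0 < \<omega> \<longrightarrow> (\<forall>g \<in> carrier_vec n. form \<omega> g \<le> 0)"
      have DT: "D\<^sup>T = D" by (rule feedthrough_symmetric[OF D]) (use f in \<open>auto simp: form_def Req\<close>)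
      have "freq_passive A B C" by (rule NI_imp_freq_passive[OF D DT]) (use f in \<open>auto simp: form_def Req\<close>)
      then obtain X where X: "X \<in> carrier_mat m m" "X\<^sup>T = X" "\<And>x. x \<in> carrier_vec m \<Longrightarrow> 0 \<le> x \<bullet> (X *\<^sub>v x)"
        "\<And>w g. w \<in> carrier_vec m \<Longrightarrow> g \<in> carrier_vec n \<Longrightarrow> w \<bullet> (X *\<^sub>v vel w g) \<le> g \<bullet> (C *\<^sub>v vel w g)"
        using storage_function[OF n co] by blast
      show "D = mat_adjoint D \<and> (\<exists>Y \<in> carrier_mat m m. pos_def Y \<and>
          neg_semidef (A * Y + Y * mat_adjoint A) \<and> B = - (A * Y * mat_adjoint C))"
        using storage_imp_lmi[OF n ob X] DT unfolding mat_adjoint_real by simp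
    next
      assume l: "D = mat_adjoint D \<and> (\<exists>Y \<in> carrier_mat m m. pos_def Y \<and>
          neg_semidef (A * Y + Y * mat_adjoint A) \<and> B = - (A * Y * mat_adjoint C))"
      then have DT: "D\<^sup>T = D" unfolding mat_adjoint_real by simp
      have "freq_passive A B C" using l lmi_imp_freq_passive by blast
      then show "\<forall>\<omega>. 0 < \<omega> \<longrightarrow> (\<forall>g \<in> carrier_vec n. form \<omega> g \<le> 0)"
        using freq_passive_imp_NI[OF D DT] unfolding form_def Req by blast
    qed
  qed
  show ?thesis unfolding NI stable using main by blast
qed

end
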